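(* Every Tutte cut property is either a min-edge cut property (i.e. equal to the min-edge cut property defined by $(X,\delta)$ for some $X\subseteq\{\emptyset,\{-\},\{+\}\}$ and $\delta\in\{+,-\}$), or is the property cut weird, or is the property cut co-weird. Analogously, every Tutte cycle property is either a min-edge cycle property, or is cycle weird, or is cycle co-weird.
   Context: Graphs are finite, undirected and connected; loops and multiple edges are allowed. A reference orientation $\mathcal{O}_{\mathrm{ref}}$ of $G$ assigns to each edge $e=\{u,v\}$ one of the ordered pairs $(u,v),(v,u)$. Every edge $e$ has two formal orientations $e^+$ and $e^-$ (treated as distinct even if $e$ is a loop): $e^+$ is directed as $\mathcal{O}_{\mathrm{ref}}(e)$ and $e^-$ is directed oppositely; $e^{\varepsilon}=(u,v)$ means $e^\varepsilon$ is directed from $u$ to $v$. Let $\mathbb{E}(G)=\{e^+,e^-: e\in E(G)\}$. An ordered, oriented graph is a triple $\mathbb{G}=(G,\mathcal{O}_{\mathrm{ref}},<)$ with $<$ a total order on $E(G)$. A fourientation of $\mathbb{G}$ is a subset $\mathcal{O}\subseteq\mathbb{E}(G)$; $e$ is oriented, unoriented, bioriented in $\mathcal{O}$ if exactly one, none, both of $e^+,e^-$ lie in $\mathcal{O}$. A cut is a partition $Cu=\{U,U^c\}$ of $V(G)$ into two nonempty parts, $E(Cu)$ is the set of edges with one endpoint in each part; it is simple if the induced subgraphs on $U$ and $U^c$ are connected. A directed cut is an ordered pair $\overrightarrow{Cu}=(U,U^c)$, with $E(\overrightarrow{Cu})=E(Cu)$; $\mathbb{E}(\overrightarrow{Cu})$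 is the set of edge orientations directed from $U$ to $U^c$. A cycle is a cyclic list $v_1,e_1,\dots,v_k,e_k$ ($k\ge 1$) with distinct edges $e_i=\{v_i,v_{i+1}\}$ (indices mod $k$), up to rotation and reflection; it is simple if the $v_i$ are distinct. A directed cycle $\overrightarrow{Cy}=v_1,e_1^{\delta_1},\dots,v_k,e_k^{\delta_k}$ additionally has $e_i^{\delta_i}=(v_i,v_{i+1})$, up to rotation; $E(\overrightarrow{Cy})=\{e_i\}$, $\mathbb{E}(\overrightarrow{Cy})=\{e_i^{\delta_i}\}$. An isthmus is an edge $e$ with $E(Cu)=\{e\}$ for some cut; a loop is an edge joining a vertex to itself. $\overrightarrow{Cu}$ is a potential cut of $\mathcal{O}$ if $e^{\varepsilon}\in\mathbb{E}(\overrightarrow{Cu})$ implies $e^{-\varepsilon}\notin\mathcal{O}$; $\overrightarrow{Cy}$ is a potential cycle of $\mathcal{O}$ if $\mathbb{E}(\overrightarrow{Cy})\subseteq\mathcal{O}$. $\mathbb{G}\setminus e$ and $\mathbb{G}/e$ denote deletion and contraction with induced reference orientation and order. A fourientation $\mathcal{O}$ of $\mathbb{G}\setminus e$ or $\mathbb{G}/e$ is also regarded as the fourientation of $\mathbb{G}$ in which $e$ is unoriented. For a simple cut $Cu$, $\mathbb{G}_{Cu}$ is obtained by contracting all edges not in $E(Cu)$; for a simple cycle $Cy$, $\mathbb{G}_{Cy}$ is obtained by deleting all edges not in $E(Cy)$ and removing isolated vertices; $\mathcal{O}_{C}$ is the fourientation of $\mathbb{G}_C$ induced by $\mathcal{O}$.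 A fourientation property is a map from pairs $(\mathbb{G},\mathcal{O})$ ($\mathcal{O}$ a fourientation of $\mathbb{G}$) to $\{\mathrm{good},\mathrm{bad}\}$, invariant under isomorphism (bijections of vertices and edges compatible with incidence, reference orientation, edge order and $\mathcal{O}$); a property is identified with its set of good fourientations. It is a cut (cycle) property if $\mathcal{O}$ is good for $\mathbb{G}$ if and only if $\mathcal{O}_C$ is good for $\mathbb{G}_C$ for every simple cut (cycle) $C$. A cut (cycle) property is a Tutte cut (cycle) property if for all $\mathbb{G}$ (statements for cycle properties in parentheses): T1: $\mathcal{O}$ is bad for $\mathbb{G}$ only if $\mathcal{O}$ has a potential cut (cycle). T2: if the maximum edge $e$ of $\mathbb{G}$ is neither an isthmus nor a loop, then for every fourientation $\mathcal{O}$ of $\mathbb{G}\setminus e$ ($\mathbb{G}/e$): (a) if $\mathcal{O}$ is good for $\mathbb{G}\setminus e$ ($\mathbb{G}/e$), then $\mathcal{O}\cup\{e^+\}$ and $\mathcal{O}\cup\{e^-\}$ are both good for $\mathbb{G}$; (b) if $\mathcal{O}$ is bad for $\mathbb{G}\setminus e$ ($\mathbb{G}/e$) but $\mathcal{O}\cup\{e^+,e^-\}$ ($\mathcal{O}$) is good for $\mathbb{G}$, then exactly one of $\mathcal{O}\cup\{e^+\}$, $\mathcal{O}\cup\{e^-\}$ is good for $\mathbb{G}$; (c) $\mathcal{O}$ is good for $\mathbb{G}\setminus e$ ($\mathbb{G}/e$) if and only if $\mathcal{O}$ ($\mathcal{O}\cup\{e^+,e^-\}$) is good for $\mathbb{G}$.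 Min-edge properties. A min-edge cut (cycle) property is given by a set $X\subseteq\{\emptyset,\{-\},\{+\}\}$ (for cycles, $X\subseteq\{\{-\},\{+\},\{-,+\}\}$) and $\delta\in\{+,-\}$. A potential cut (cycle) $\overrightarrow{C}$ of a fourientation $\mathcal{O}$ of $\mathbb{G}$, with $e_{\min}$ the $<$-minimum edge of $E(\overrightarrow{C})$, is bad with respect to $(X,\delta)$ if both (i) $\{\varepsilon: e_{\min}^{\varepsilon}\in\mathcal{O}\}\in X$, and (ii) if $e_{\min}$ is unoriented (for cycles: bioriented) in $\mathcal{O}$ then $e_{\min}^{\delta}\in\mathbb{E}(\overrightarrow{C})$. Otherwise it is good. $\mathcal{O}$ is good with respect to the min-edge cut (cycle) property $(X,\delta)$ if and only if all of its potential cuts (cycles) are good. Exceptional properties. A fourientation is good for cut weird (cycle weird) if each of its potential cuts (cycles) contains at least one oriented edge and the minimum oriented edge of the cut (cycle) is oriented in agreement with its reference orientation (i.e. as $e^+$). It is good for cut co-weird (cycle co-weird) if each of its potential cuts (cycles) contains at least one oriented edge and the minimum oriented edge of the cut (cycle) is oriented in disagreement with its reference orientation (i.e. as $e^-$). *)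

theory Defs
  imports "Graph_Theory.Digraph_Isomorphism" "HOL-Library.Infinite_Typeclass"
begin

section \<open>Ordered, oriented graphs and fourientations\<close>

text \<open>
  A multigraph \<open>G\<close> together with a reference orientation is a \<^typ>\<open>('v, 'e) pre_digraph\<close>: its
  arcs are the edges of \<open>G\<close>, and an edge is directed by the reference orientation from its tail to
  its head. The underlying undirected edge is \<open>{tail G e, head G e}\<close>, and
  \<^const>\<open>connected\<close> is connectedness of the underlying undirected graph. The total order on the
  edges is a separate component \<open>r\<close>, a reflexive linear order with field \<open>arcs G\<close>.
\<close>

definition ordered_graph :: "('v, 'e) pre_digraph \<Rightarrow> 'e rel \<Rightarrow> bool" where
  "ordered_graph G r \<longleftrightarrow> fin_digraph G \<and> connected G \<and> linear_order_on (arcs G) r"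

datatype sign = Pos | Neg

fun opp :: "sign \<Rightarrow> sign" where
  "opp Pos = Neg"
| "opp Neg = Pos"

text \<open>The pairs \<open>(e, Pos)\<close> and \<open>(e, Neg)\<close> are the formal orientations \<open>e\<^sup>+\<close> and \<open>e\<^sup>-\<close>.\<close>

type_synonym 'e dart = "'e \<times> sign"

fun source :: "('v, 'e) pre_digraph \<Rightarrow> 'e dart \<Rightarrow> 'v" where
  "source G (e, Pos) = tail G e"
| "source G (e, Neg) = head G e"

fun target :: "('v, 'e) pre_digraph \<Rightarrow> 'e dart \<Rightarrow> 'v" where
  "target G (e, Pos) = head G e"
| "target G (e, Neg) = tail G e"

definition darts :: "('v, 'e) pre_digraph \<Rightarrow> 'e dart set" where
  "darts G = arcs G \<times> UNIV"

definition fourientation :: "('v, 'e) pre_digraph \<Rightarrow> 'e dart set \<Rightarrow> bool" where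
  "fourientation G F \<longleftrightarrow> F \<subseteq> darts G"

definition signs :: "'e dart set \<Rightarrow> 'e \<Rightarrow> sign set" where
  "signs F e = {\<epsilon>. (e, \<epsilon>) \<in> F}"

definition oriented :: "'e dart set \<Rightarrow> 'e \<Rightarrow> bool" where
  "oriented F e \<longleftrightarrow> (\<exists>!\<epsilon>. (e, \<epsilon>) \<in> F)"

definition unoriented :: "'e dart set \<Rightarrow> 'e \<Rightarrow> bool" where
  "unoriented F e \<longleftrightarrow> (e, Pos) \<notin> F \<and> (e, Neg) \<notin> F"

definition bioriented :: "'e dart set \<Rightarrow> 'e \<Rightarrow> bool" where
  "bioriented F e \<longleftrightarrow> (e, Pos) \<in> F \<and> (e, Neg) \<in> F"

definition is_min :: "'e rel \<Rightarrow> 'e set \<Rightarrow> 'e \<Rightarrow> bool" where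
  "is_min r A e \<longleftrightarrow> e \<in> A \<and> (\<forall>f\<in>A. (e, f) \<in> r)"

definition is_max :: "'e rel \<Rightarrow> 'e set \<Rightarrow> 'e \<Rightarrow> bool" where
  "is_max r A e \<longleftrightarrow> e \<in> A \<and> (\<forall>f\<in>A. (f, e) \<in> r)"


section \<open>Cuts\<close>

text \<open>
  The set \<open>U\<close> stands both for the cut \<open>{U, U\<^sup>c}\<close> and for the directed cut \<open>(U, U\<^sup>c)\<close>; the reverse
  directed cut is represented by \<open>verts G - U\<close>. The notions \<open>cut_edges\<close> and \<open>simple_cut\<close>, which
  belong to undirected cuts, do not change when \<open>U\<close> is replaced by \<open>verts G - U\<close>.
\<close>

definition is_cut :: "('v, 'e) pre_digraph \<Rightarrow> 'v set \<Rightarrow> bool" where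
  "is_cut G U \<longleftrightarrow> U \<subseteq> verts G \<and> U \<noteq> {} \<and> verts G - U \<noteq> {}"

definition cut_edges :: "('v, 'e) pre_digraph \<Rightarrow> 'v set \<Rightarrow> 'e set" where
  "cut_edges G U = {e \<in> arcs G.
     (tail G e \<in> U \<and> head G e \<in> verts G - U) \<or> (head G e \<in> U \<and> tail G e \<in> verts G - U)}"

definition cut_darts :: "('v, 'e) pre_digraph \<Rightarrow> 'v set \<Rightarrow> 'e dart set" where
  "cut_darts G U = {d \<in> darts G. source G d \<in> U \<and> target G d \<in> verts G - U}"

definition simple_cut :: "('v, 'e) pre_digraph \<Rightarrow> 'v set \<Rightarrow> bool" where
  "simple_cut G U \<longleftrightarrow> is_cut G U \<and> connected (G \<restriction> U) \<and> connected (G \<restriction> (verts G - U))"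

definition potential_cut :: "('v, 'e) pre_digraph \<Rightarrow> 'e dart set \<Rightarrow> 'v set \<Rightarrow> bool" where
  "potential_cut G F U \<longleftrightarrow>
     is_cut G U \<and> (\<forall>e \<epsilon>. (e, \<epsilon>) \<in> cut_darts G U \<longrightarrow> (e, opp \<epsilon>) \<notin> F)"

definition isthmus :: "('v, 'e) pre_digraph \<Rightarrow> 'e \<Rightarrow> bool" where
  "isthmus G e \<longleftrightarrow> (\<exists>U. is_cut G U \<and> cut_edges G U = {e})"

definition loop :: "('v, 'e) pre_digraph \<Rightarrow> 'e \<Rightarrow> bool" where
  "loop G e \<longleftrightarrow> e \<in> arcs G \<and> tail G e = head G e"


section \<open>Cycles\<close>

text \<open>
  Cyclic lists are represented by lists \<open>[(v\<^sub>1, e\<^sub>1), \<dots>, (v\<^sub>k, e\<^sub>k)]\<close>. They are not quotiented by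
  rotation (and reflection): everything below depends only on the edges and darts occurring.
\<close>

definition is_cycle :: "('v, 'e) pre_digraph \<Rightarrow> ('v \<times> 'e) list \<Rightarrow> bool" where
  "is_cycle G c \<longleftrightarrow> c \<noteq> [] \<and> distinct (map snd c) \<and>
     (\<forall>i<length c. snd (c ! i) \<in> arcs G \<and>
        {tail G (snd (c ! i)), head G (snd (c ! i))} = {fst (c ! i), fst (c ! (Suc i mod length c))})"

definition simple_cycle :: "('v, 'e) pre_digraph \<Rightarrow> ('v \<times> 'e) list \<Rightarrow> bool" where
  "simple_cycle G c \<longleftrightarrow> is_cycle G c \<and> distinct (map fst c)"

definition cycle_edges :: "('v \<times> 'e) list \<Rightarrow> 'e set" where
  "cycle_edges c = snd ` set c"

definition undirected :: "('v \<times> 'e dart) list \<Rightarrow> ('v \<times> 'e) list" where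
  "undirected c = map (\<lambda>(v, d). (v, fst d)) c"

definition directed_cycle :: "('v, 'e) pre_digraph \<Rightarrow> ('v \<times> 'e dart) list \<Rightarrow> bool" where
  "directed_cycle G c \<longleftrightarrow> is_cycle G (undirected c) \<and>
     (\<forall>i<length c. source G (snd (c ! i)) = fst (c ! i) \<and>
        target G (snd (c ! i)) = fst (c ! (Suc i mod length c)))"

definition cycle_darts :: "('v \<times> 'e dart) list \<Rightarrow> 'e dart set" where
  "cycle_darts c = snd ` set c"

definition potential_cycle ::
    "('v, 'e) pre_digraph \<Rightarrow> 'e dart set \<Rightarrow> ('v \<times> 'e dart) list \<Rightarrow> bool" where
  "potential_cycle G F c \<longleftrightarrow> directed_cycle G c \<and> cycle_darts c \<subseteq> F"


section \<open>Minors\<close>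

text \<open>
  Contracting a set \<open>A\<close> of edges identifies the vertices in each component of the spanning subgraph
  with edge set \<open>A\<close>; the merged vertex is an arbitrarily chosen member of the component (all
  choices give isomorphic graphs). Loops in \<open>A\<close> are removed.
\<close>

definition contract :: "('v, 'e) pre_digraph \<Rightarrow> 'e set \<Rightarrow> ('v, 'e) pre_digraph" where
  "contract G A =
     (let rep = (\<lambda>v. SOME w. v \<rightarrow>\<^sup>*\<^bsub>with_proj (mk_symmetric (G\<lparr>arcs := arcs G \<inter> A\<rparr>))\<^esub> w)
      in \<lparr>verts = rep ` verts G, arcs = arcs G - A,
          tail = (\<lambda>e. rep (tail G e)), head = (\<lambda>e. rep (head G e))\<rparr>)"

definition cut_minor :: "('v, 'e) pre_digraph \<Rightarrow> 'v set \<Rightarrow> ('v, 'e) pre_digraph" where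
  "cut_minor G U = contract G (arcs G - cut_edges G U)"

definition cycle_minor :: "('v, 'e) pre_digraph \<Rightarrow> ('v \<times> 'e) list \<Rightarrow> ('v, 'e) pre_digraph" where
  "cycle_minor G c =
     G\<lparr>verts := tail G ` cycle_edges c \<union> head G ` cycle_edges c, arcs := cycle_edges c\<rparr>"


section \<open>Fourientation properties\<close>

text \<open>
  A property maps \<open>(G, r, F)\<close> to \<^const>\<open>True\<close> (good) or \<^const>\<open>False\<close> (bad). Only its values at
  fourientations \<open>F\<close> of ordered, oriented graphs \<open>(G, r)\<close> are meaningful. As vertices and edges
  range over infinite types, every finite graph has an isomorphic copy in the domain.
\<close>

type_synonym ('v, 'e) property = "('v, 'e) pre_digraph \<Rightarrow> 'e rel \<Rightarrow> 'e dart set \<Rightarrow> bool"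

definition same_property :: "('v, 'e) property \<Rightarrow> ('v, 'e) property \<Rightarrow> bool" where
  "same_property P Q \<longleftrightarrow>
     (\<forall>G r F. ordered_graph G r \<longrightarrow> fourientation G F \<longrightarrow> (P G r F \<longleftrightarrow> Q G r F))"

text \<open>
  The components \<^const>\<open>iso_tail\<close> and \<^const>\<open>iso_head\<close> of a library isomorphism are the tail and
  head functions of the target graph, so \<^const>\<open>app_iso\<close> ranges over all isomorphic copies of \<open>G\<close>.
\<close>

definition fourientation_property :: "('v, 'e) property \<Rightarrow> bool" where
  "fourientation_property P \<longleftrightarrow>
     (\<forall>G r F h. ordered_graph G r \<longrightarrow> fourientation G F \<longrightarrow> pre_digraph.digraph_isomorphism G h \<longrightarrow>
        (P (app_iso h G) (map_prod (iso_arcs h) (iso_arcs h) ` r) (map_prod (iso_arcs h) id ` F)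
          \<longleftrightarrow> P G r F))"

text \<open>The value of \<open>P\<close> at a minor \<open>H\<close>, with the edge order and fourientation induced from \<open>G\<close>.\<close>

definition good_minor ::
    "('v, 'e) property \<Rightarrow> ('v, 'e) pre_digraph \<Rightarrow> 'e rel \<Rightarrow> 'e dart set \<Rightarrow> bool" where
  "good_minor P H r F \<longleftrightarrow> P H (Restr r (arcs H)) (F \<inter> darts H)"

definition cut_property :: "('v, 'e) property \<Rightarrow> bool" where
  "cut_property P \<longleftrightarrow> fourientation_property P \<and>
     (\<forall>G r F. ordered_graph G r \<longrightarrow> fourientation G F \<longrightarrow>
        (P G r F \<longleftrightarrow> (\<forall>U. simple_cut G U \<longrightarrow> good_minor P (cut_minor G U) r F)))"

definition cycle_property :: "('v, 'e) property \<Rightarrow> bool" where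
  "cycle_property P \<longleftrightarrow> fourientation_property P \<and>
     (\<forall>G r F. ordered_graph G r \<longrightarrow> fourientation G F \<longrightarrow>
        (P G r F \<longleftrightarrow> (\<forall>c. simple_cycle G c \<longrightarrow> good_minor P (cycle_minor G c) r F)))"

definition cut_T1 :: "('v, 'e) property \<Rightarrow> bool" where
  "cut_T1 P \<longleftrightarrow>
     (\<forall>G r F. ordered_graph G r \<longrightarrow> fourientation G F \<longrightarrow> \<not> P G r F \<longrightarrow> (\<exists>U. potential_cut G F U))"

definition cycle_T1 :: "('v, 'e) property \<Rightarrow> bool" where
  "cycle_T1 P \<longleftrightarrow>
     (\<forall>G r F. ordered_graph G r \<longrightarrow> fourientation G F \<longrightarrow> \<not> P G r F \<longrightarrow> (\<exists>c. potential_cycle G F c))"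

text \<open>
  In the following two definitions \<open>F\<close> is a fourientation of the deletion or contraction \<open>H\<close>. The
  same set is the fourientation of \<open>G\<close> in which \<open>e\<close> is unoriented.
\<close>

definition cut_T2 :: "('v, 'e) property \<Rightarrow> bool" where
  "cut_T2 P \<longleftrightarrow>
     (\<forall>G r e F. let H = pre_digraph.del_arc G e in
        ordered_graph G r \<longrightarrow> is_max r (arcs G) e \<longrightarrow> \<not> isthmus G e \<longrightarrow> \<not> loop G e \<longrightarrow>
        fourientation H F \<longrightarrow>
          (good_minor P H r F \<longrightarrow> P G r (F \<union> {(e, Pos)}) \<and> P G r (F \<union> {(e, Neg)})) \<and>
          (\<not> good_minor P H r F \<longrightarrow> P G r (F \<union> {(e, Pos), (e, Neg)}) \<longrightarrow>
             (\<exists>!\<epsilon>. P G r (F \<union> {(e, \<epsilon>)}))) \<and>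
          (good_minor P H r F \<longleftrightarrow> P G r F))"

definition cycle_T2 :: "('v, 'e) property \<Rightarrow> bool" where
  "cycle_T2 P \<longleftrightarrow>
     (\<forall>G r e F. let H = contract G {e} in
        ordered_graph G r \<longrightarrow> is_max r (arcs G) e \<longrightarrow> \<not> isthmus G e \<longrightarrow> \<not> loop G e \<longrightarrow>
        fourientation H F \<longrightarrow>
          (good_minor P H r F \<longrightarrow> P G r (F \<union> {(e, Pos)}) \<and> P G r (F \<union> {(e, Neg)})) \<and>
          (\<not> good_minor P H r F \<longrightarrow> P G r F \<longrightarrow> (\<exists>!\<epsilon>. P G r (F \<union> {(e, \<epsilon>)}))) \<and>
          (good_minor P H r F \<longleftrightarrow> P G r (F \<union> {(e, Pos), (e, Neg)})))"

definition tutte_cut_property :: "('v, 'e) property \<Rightarrow> bool" where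
  "tutte_cut_property P \<longleftrightarrow> cut_property P \<and> cut_T1 P \<and> cut_T2 P"

definition tutte_cycle_property :: "('v, 'e) property \<Rightarrow> bool" where
  "tutte_cycle_property P \<longleftrightarrow> cycle_property P \<and> cycle_T1 P \<and> cycle_T2 P"


section \<open>Min-edge properties and the exceptional properties\<close>

definition bad_cut ::
    "sign set set \<Rightarrow> sign \<Rightarrow> ('v, 'e) pre_digraph \<Rightarrow> 'e rel \<Rightarrow> 'e dart set \<Rightarrow> 'v set \<Rightarrow> bool" where
  "bad_cut X \<delta> G r F U \<longleftrightarrow>
     (\<exists>e. is_min r (cut_edges G U) e \<and> signs F e \<in> X \<and>
        (unoriented F e \<longrightarrow> (e, \<delta>) \<in> cut_darts G U))"

definition min_edge_cut :: "sign set set \<Rightarrow> sign \<Rightarrow> ('v, 'e) property" where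
  "min_edge_cut X \<delta> G r F \<longleftrightarrow> (\<forall>U. potential_cut G F U \<longrightarrow> \<not> bad_cut X \<delta> G r F U)"

definition bad_cycle ::
    "sign set set \<Rightarrow> sign \<Rightarrow> 'e rel \<Rightarrow> 'e dart set \<Rightarrow> ('v \<times> 'e dart) list \<Rightarrow> bool" where
  "bad_cycle X \<delta> r F c \<longleftrightarrow>
     (\<exists>e. is_min r (cycle_edges (undirected c)) e \<and> signs F e \<in> X \<and>
        (bioriented F e \<longrightarrow> (e, \<delta>) \<in> cycle_darts c))"

definition min_edge_cycle :: "sign set set \<Rightarrow> sign \<Rightarrow> ('v, 'e) property" where
  "min_edge_cycle X \<delta> G r F \<longleftrightarrow> (\<forall>c. potential_cycle G F c \<longrightarrow> \<not> bad_cycle X \<delta> r F c)"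

text \<open>\<open>A\<close> contains an oriented edge, and the minimum oriented edge of \<open>A\<close> is oriented as \<open>e\<^sup>\<epsilon>\<close>.\<close>

definition min_oriented :: "'e rel \<Rightarrow> 'e dart set \<Rightarrow> 'e set \<Rightarrow> sign \<Rightarrow> bool" where
  "min_oriented r F A \<epsilon> \<longleftrightarrow> (\<exists>e. is_min r {e \<in> A. oriented F e} e \<and> (e, \<epsilon>) \<in> F)"

definition cut_weird :: "('v, 'e) property" where
  "cut_weird G r F \<longleftrightarrow> (\<forall>U. potential_cut G F U \<longrightarrow> min_oriented r F (cut_edges G U) Pos)"

definition cut_coweird :: "('v, 'e) property" where
  "cut_coweird G r F \<longleftrightarrow> (\<forall>U. potential_cut G F U \<longrightarrow> min_oriented r F (cut_edges G U) Neg)"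

definition cycle_weird :: "('v, 'e) property" where
  "cycle_weird G r F \<longleftrightarrow>
     (\<forall>c. potential_cycle G F c \<longrightarrow> min_oriented r F (cycle_edges (undirected c)) Pos)"

definition cycle_coweird :: "('v, 'e) property" where
  "cycle_coweird G r F \<longleftrightarrow>
     (\<forall>c. potential_cycle G F c \<longrightarrow> min_oriented r F (cycle_edges (undirected c)) Neg)"

end

(*
  A cut (cycle) property is determined by its values on two-vertex graphs (cycle graphs), and by T1
  only fourientations with a potential cut (cycle) C matter there. Such an instance is a word: for
  each edge of C, its rank in the edge order, its sign along C, and whether it is oriented. For cuts
  one passes to the complementary fourientation, which turns T1 and T2 for cuts into the form they
  have for cycles. T2 on these small graphs says that letters above the first oriented one do not
  matter and that the words whose only oriented letter is the last one come in pairs of opposite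
  badness. The remaining freedom is restricted by one further graph: a triangle with multiple edges
  (for cycles: a theta graph) in which the maximum edge e separates two circuits X + e and Y - e.
  There T2 forces the concatenation XY of two bad (good) words with oriented letters to be bad (good).
  Inserting in this way the minimum letter of one word into another reduces everything to words of
  length at most two.
*)

theory Submission
  imports Defs "HOL-Library.Countable"
begin

section \<open>Bad words\<close>

text \<open>The pairs of opposite badness come from T1. If the maximum edge of a circuit graph is
  left out, no direction of the circuit is potential, so this fourientation is good; when the minor
  is bad, T2(b) then makes exactly one orientation of that edge bad. The second orientation is read
  along the reversed circuit, hence the flipped reversals.

  Suppose that bioriented letters alone are bad. By this pairing the four words with a bioriented
  sign \<open>s\<close> below an oriented sign \<open>t\<close> are fixed by two of them, and their
  badness depends either on \<open>s\<close> alone or on \<open>t\<close> alone. The first case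
  leads to min-edge properties, the second is the source of the two exceptional ones.

  The obstacle is that gluing needs two words of equal badness. A long word can be compared with a
  single oriented letter only if some such letter has the same badness; otherwise the mirror image
  of the word, of opposite badness, takes its place.

  Words describe simple circuits only, while the properties to be recognized quantify over all
  potential cuts or cycles. The passage rests on finding, through any given dart of a potential one,
  a simple one inside it.\<close>

fun flip :: "int \<times> sign \<times> bool \<Rightarrow> int \<times> sign \<times> bool" where
  "flip (k, s, b) = (k, opp s, b)"

definition valid :: "(int \<times> 'a) list \<Rightarrow> bool" where
  "valid A \<longleftrightarrow> A \<noteq> [] \<and> distinct (map fst A)"

definition has_o :: "(int \<times> sign \<times> bool) list \<Rightarrow> bool" where
  "has_o A \<longleftrightarrow> (\<exists>x\<in>set A. snd (snd x))"

definition least :: "(int \<times> 'a) list \<Rightarrow> int \<times> 'a \<Rightarrow> bool" where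
  "least A x \<longleftrightarrow> x \<in> set A \<and> (\<forall>y\<in>set A. fst x \<le> fst y)"

lemma opp_opp [simp]: "opp (opp s) = s"
  by (cases s) auto

lemma opp_neq [simp]: "opp s \<noteq> s" "s \<noteq> opp s"
  by (cases s; simp)+

lemma opp_eq_iff [simp]: "opp s = opp t \<longleftrightarrow> s = t"
  by (cases s; cases t) auto

lemma neq_iff_opp: "s \<noteq> t \<longleftrightarrow> s = opp t"
  by (cases s; cases t) auto

lemma fst_flip [simp]: "fst (flip x) = fst x" and snd_snd_flip [simp]: "snd (snd (flip x)) = snd (snd x)"
  by (cases x; simp)+

lemma has_o_simps [simp]:
  "has_o (A @ A') \<longleftrightarrow> has_o A \<or> has_o A'" "has_o (x # A) \<longleftrightarrow> snd (snd x) \<or> has_o A" "\<not> has_o []"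
  "has_o (rev A) \<longleftrightarrow> has_o A" "has_o (map flip A) \<longleftrightarrow> has_o A" "has_o (map (apfst h) A) \<longleftrightarrow> has_o A"
  by (auto simp: has_o_def)

lemma valid_flip [simp]: "valid (map flip A) \<longleftrightarrow> valid A"
  by (simp add: valid_def comp_def)

lemma valid_rev [simp]: "valid (rev A) \<longleftrightarrow> valid A"
  by (simp add: valid_def rev_map[symmetric])

lemma valid_append_commute: "valid (xs @ ys) \<longleftrightarrow> valid (ys @ xs)"
  by (auto simp: valid_def)

lemma valid_eqI: "valid A \<Longrightarrow> x \<in> set A \<Longrightarrow> y \<in> set A \<Longrightarrow> fst x = fst y \<Longrightarrow> x = y"
  unfolding valid_def distinct_map by (blast dest: inj_onD)

lemma ex_least: "A \<noteq> [] \<Longrightarrow> \<exists>x. least A x"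
proof -
  assume "A \<noteq> []"
  then have "Min (fst ` set A) \<in> fst ` set A"
    by (intro Min_in) auto
  then obtain x where "x \<in> set A" "fst x = Min (fst ` set A)"
    by auto
  then have "least A x"
    unfolding least_def by simp
  then show ?thesis ..
qed

lemma ex_greatest: "A \<noteq> [] \<Longrightarrow> \<exists>x\<in>set A. \<forall>y\<in>set A. fst y \<le> (fst x :: int)"
proof -
  assume "A \<noteq> []"
  then have "Max (fst ` set A) \<in> fst ` set A"
    by (intro Max_in) auto
  then obtain x where "x \<in> set A" "fst x = Max (fst ` set A)"
    by auto
  then have "\<forall>y\<in>set A. fst y \<le> fst x"
    by simp
  then show ?thesis
    using \<open>x \<in> set A\<close> ..
qed

lemma least_split: "least A x \<Longrightarrow> \<exists>xs ys. A = xs @ x # ys"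
  by (simp add: least_def split_list)

lemma fst_neq_split: "valid (xs @ x # ys) \<Longrightarrow> y \<in> set (xs @ ys) \<Longrightarrow> fst y \<noteq> fst x"
  unfolding valid_def by (auto simp: rev_image_eqI)

lemma least_less_split: "valid (xs @ x # ys) \<Longrightarrow> least (xs @ x # ys) x \<Longrightarrow> y \<in> set (xs @ ys) \<Longrightarrow> fst x < fst y"
  using fst_neq_split[of xs x ys y] unfolding least_def by (auto simp: order.strict_iff_order)

text \<open>A letter with flag \<open>False\<close> is bioriented. \<open>rev_flip\<close> is
  confined to words of such letters since only then is the reversed circuit potential too. In
  \<open>ext_u_o\<close> the flipped reversal describes the fourientation whose top edge has the
  opposite orientation, read backwards. \<open>glue\<close> is one statement for bad and for good
  words, with \<open>i\<close> as the common value.\<close>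

locale word_core =
  fixes B :: "(int \<times> sign \<times> bool) list \<Rightarrow> bool"
  assumes mono: "valid A \<Longrightarrow> strict_mono_on (fst ` set A) h \<Longrightarrow> B (map (apfst h) A) = B A"
    and rot: "valid A \<Longrightarrow> B (rotate1 A) = B A"
    and rev_flip: "valid A \<Longrightarrow> \<not> has_o A \<Longrightarrow> B (rev (map flip A)) = B A"
    and ext_o: "valid A \<Longrightarrow> (\<And>x. x \<in> set A \<Longrightarrow> fst x < n) \<Longrightarrow> has_o A \<Longrightarrow> B (A @ [(n, s, b)]) = B A"
    and ext_u: "valid A \<Longrightarrow> (\<And>x. x \<in> set A \<Longrightarrow> fst x < n) \<Longrightarrow> \<not> has_o A \<Longrightarrow> B (A @ [(n, s, False)]) = B A"
    and ext_u_o: "valid A \<Longrightarrow> (\<And>x. x \<in> set A \<Longrightarrow> fst x < n) \<Longrightarrow> \<not> has_o A \<Longrightarrow> B A \<Longrightarrow>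
          B (rev (map flip (A @ [(n, s, True)]))) \<noteq> B (A @ [(n, s, True)])"
    and ext_u_good: "valid A \<Longrightarrow> (\<And>x. x \<in> set A \<Longrightarrow> fst x < n) \<Longrightarrow> \<not> has_o A \<Longrightarrow> \<not> B A \<Longrightarrow>
          \<not> B (A @ [(n, s, True)])"
    and glue: "valid A \<Longrightarrow> valid A' \<Longrightarrow> valid (A @ A') \<Longrightarrow> has_o A \<Longrightarrow> has_o A' \<Longrightarrow> B A = i \<Longrightarrow> B A' = i \<Longrightarrow>
          B (A @ A') = i"
begin

section \<open>Rotation and truncation of words\<close>

lemma rot_append: "valid (xs @ ys) \<Longrightarrow> B (xs @ ys) = B (ys @ xs)"
proof (induction xs arbitrary: ys)
  case (Cons x xs)
  have v: "valid (xs @ ys @ [x])"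
    using Cons.prems by (auto simp: valid_def)
  show ?case
    using rot[OF Cons.prems] Cons.IH[OF v] by simp
qed simp

lemma remove_max:
  assumes "valid (xs @ (n, s, b) # ys)" "has_o (xs @ ys)" "\<And>x. x \<in> set (xs @ ys) \<Longrightarrow> fst x < n"
  shows "B (xs @ (n, s, b) # ys) = B (xs @ ys)"
proof -
  have v: "valid (xs @ ys)"
    using assms by (auto simp: valid_def)
  have "B (xs @ (n, s, b) # ys) = B ((ys @ xs) @ [(n, s, b)])"
    using rot_append[of "xs @ [(n, s, b)]" ys] assms(1) by simp
  also have "\<dots> = B (ys @ xs)"
    using assms v by (intro ext_o) (auto simp: valid_append_commute)
  finally show ?thesis
    using rot_append[OF v] by simp
qed

text \<open>Letters above \<open>c\<close> are peeled off from the top. An oriented letter of rank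
  at most \<open>c\<close> survives each time, so \<open>ext_o\<close> remains applicable.\<close>

lemma truncate:
  assumes "valid A" "has_o (filter (\<lambda>x. fst x \<le> c) A)"
  shows "B A = B (filter (\<lambda>x. fst x \<le> c) A)"
  using assms
proof (induction "length A" arbitrary: A rule: less_induct)
  case less
  show ?case
  proof (cases "\<forall>x\<in>set A. fst x \<le> c")
    case True
    then show ?thesis by (metis filter_True)
  next
    case False
    obtain x where x: "x \<in> set A" "\<forall>y\<in>set A. fst y \<le> fst x"
      using ex_greatest[of A] less.prems(1) unfolding valid_def by blast
    then obtain xs ys where A: "A = xs @ x # ys"
      by (meson split_list)
    obtain n s b where xn: "x = (n, s, b)"
      by (cases x)
    have n: "c < n"
      using False x xn by force
    then have filt: "filter (\<lambda>x. fst x \<le> c) A = filter (\<lambda>x. fst x \<le> c) (xs @ ys)"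
      using A xn by simp
    have o: "has_o (xs @ ys)"
      using less.prems(2) unfolding filt unfolding has_o_def by auto
    have lt: "fst y < n" if "y \<in> set (xs @ ys)" for y
      using fst_neq_split[of xs x ys y] less.prems(1) x that unfolding A xn by force
    have "B A = B (xs @ ys)"
      using less.prems(1) o lt unfolding A xn by (intro remove_max) auto
    also have "\<dots> = B (filter (\<lambda>x. fst x \<le> c) (xs @ ys))"
      using less.prems(1) less.prems(2)[unfolded filt] o by (intro less.hyps) (auto simp: A valid_def)
    finally show ?thesis
      unfolding filt .
  qed
qed

lemma shift1: "B [(k, s, b)] = B [(0, s, b)]"
  using mono[of "[(k, s, b)]" "\<lambda>_. 0"] by (simp add: valid_def strict_mono_on_def)

lemma shift2:
  assumes "k < l"
  shows "B [(k, s, b), (l, t, c)] = B [(0, s, b), (1, t, c)]" "B [(l, t, c), (k, s, b)] = B [(0, s, b), (1, t, c)]"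
proof -
  show *: "B [(k, s, b), (l, t, c)] = B [(0, s, b), (1, t, c)]"
    using mono[of "[(0, s, b), (1, t, c)]" "\<lambda>i. if i = 0 then k else l"] assms
    by (fastforce simp: valid_def strict_mono_on_def)
  show "B [(l, t, c), (k, s, b)] = B [(0, s, b), (1, t, c)]"
    using * rot[of "[(k, s, b), (l, t, c)]"] assms by (simp add: valid_def)
qed

text \<open>Peeling off top letters by \<open>ext_u\<close> leaves one bioriented letter, and
  reversal exchanges its two signs.\<close>

lemma all_u:
  assumes "valid A" "\<not> has_o A"
  shows "B A = B [(0, Pos, False)]"
  using assms
proof (induction "length A" arbitrary: A rule: less_induct)
  case less
  obtain x where x: "x \<in> set A" "\<forall>y\<in>set A. fst y \<le> fst x"
    using ex_greatest[of A] less.prems(1) unfolding valid_def by blast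
  then obtain xs ys where A: "A = xs @ x # ys"
    by (meson split_list)
  have "\<not> snd (snd x)"
    using less.prems A by simp
  then obtain n s where xn: "x = (n, s, False)"
    by (cases x) auto
  show ?case
  proof (cases "xs @ ys = []")
    case True
    have "B [(0, s, False)] = B [(0, Pos, False)]"
      using rev_flip[of "[(0, Pos, False)]"] by (cases s) (auto simp: valid_def)
    then show ?thesis
      using True A xn shift1[of n s False] by simp
  next
    case False
    have lt: "fst y < n" if "y \<in> set (ys @ xs)" for y
      using fst_neq_split[of xs x ys y] less.prems(1) x that unfolding A xn by force
    have v: "valid (ys @ xs)" "\<not> has_o (ys @ xs)"
      using less.prems False by (auto simp: A valid_def)
    have "B A = B ((ys @ xs) @ [(n, s, False)])"
      using rot_append[of "xs @ [(n, s, False)]" ys] less.prems(1) by (simp add: A xn)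
    also have "\<dots> = B (ys @ xs)"
      using lt v by (intro ext_u) auto
    also have "\<dots> = B [(0, Pos, False)]"
      using v by (intro less.hyps) (auto simp: A)
    finally show ?thesis .
  qed
qed

text \<open>Every other letter lies above the least one, so truncation at its rank leaves this
  letter alone.\<close>

lemma least_oriented:
  assumes "valid A" "least A (k, s, True)"
  shows "B A = B [(0, s, True)]"
proof -
  obtain xs ys where A: "A = xs @ (k, s, True) # ys"
    using least_split[OF assms(2)] by blast
  have "fst x > k" if "x \<in> set (xs @ ys)" for x
    using least_less_split[of xs "(k, s, True)" ys x] assms that by (simp add: A)
  then have "filter (\<lambda>x. fst x \<le> k) A = [(k, s, True)]"
    unfolding A by (auto simp: filter_empty_conv not_le)
  then show ?thesis
    using truncate[OF assms(1), of k] shift1[of k s True] by simp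
qed

text \<open>Truncation at the rank of the least oriented letter, followed by a rotation, makes this
  letter the last, the highest and the only oriented one. This is the shape to which
  \<open>ext_u_o\<close> and \<open>ext_u_good\<close> apply; the bioriented minimum of
  \<open>A\<close> survives in \<open>xs\<close>.\<close>

lemma terminal_form:
  assumes "valid A" "has_o A" "least A (k, \<tau>, False)"
  obtains xs c s where "valid (xs @ [(c, s, True)])" "\<not> has_o xs" "valid xs" "\<And>x. x \<in> set xs \<Longrightarrow> fst x < c"
    "least xs (k, \<tau>, False)" "least (filter (\<lambda>x. snd (snd x)) A) (c, s, True)" "B A = B (xs @ [(c, s, True)])"
    "set xs \<subseteq> set A" "length xs < length A"
proof -
  have "filter (\<lambda>x. snd (snd x)) A \<noteq> []"
    using assms(2) by (auto simp: has_o_def filter_empty_conv)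
  then obtain x where "least (filter (\<lambda>x. snd (snd x)) A) x"
    using ex_least by blast
  moreover from this obtain c s where "x = (c, s, True)"
    by (cases x) (auto simp: least_def)
  ultimately have x: "least (filter (\<lambda>x. snd (snd x)) A) (c, s, True)"
    by simp
  then obtain ys zs where A: "A = ys @ (c, s, True) # zs"
    by (auto simp: least_def dest: split_list)
  have ne: "fst x \<noteq> c" if "x \<in> set (ys @ zs)" for x
    using fst_neq_split[of ys _ zs x] assms(1) that unfolding A by force
  let ?f = "filter (\<lambda>x. fst x \<le> c)"
  let ?xs = "?f zs @ ?f ys"
  have fA: "?f A = ?f ys @ (c, s, True) # ?f zs"
    by (simp add: A)
  have vf: "valid (?f A)"
    using assms(1) unfolding valid_def by (auto simp: distinct_map_filter) (simp add: A)
  have kc: "k < c"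
    using assms(3) ne[of "(k, \<tau>, False)"] by (force simp: least_def A)
  have lx: "least ?xs (k, \<tau>, False)"
    using assms(3) kc by (auto simp: least_def A)
  show thesis
  proof (rule that[of ?xs c s])
    show "valid (?xs @ [(c, s, True)])"
      using vf valid_append_commute[of "?f ys @ [(c, s, True)]" "?f zs"] unfolding fA
      by (auto simp: valid_def simp del: filter_append)
    have "\<not> snd (snd x)" if "x \<in> set ?xs" for x
    proof
      assume "snd (snd x)"
      then have "c \<le> fst x"
        using x that by (auto simp: least_def A)
      then show False
        using that ne[of x] by auto
    qed
    then show "\<not> has_o ?xs"
      unfolding has_o_def by blast
    have "distinct (map fst ?xs)"
      using vf unfolding fA valid_def by auto
    moreover have "?xs \<noteq> []"
      using lx unfolding least_def by (metis empty_iff empty_set)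
    ultimately show "valid ?xs"
      unfolding valid_def by blast
    show "fst x < c" if "x \<in> set ?xs" for x
      using that ne[of x] by auto
    show "least ?xs (k, \<tau>, False)" by (fact lx)
    show "least (filter (\<lambda>x. snd (snd x)) A) (c, s, True)" by (fact x)
    have "B A = B (?f A)"
      by (intro truncate assms) (auto simp: fA)
    then show "B A = B (?xs @ [(c, s, True)])"
      using rot_append[of "?f ys @ [(c, s, True)]" "?f zs"] vf fA by simp
    show "set ?xs \<subseteq> set A"
      by (auto simp: A)
    show "length ?xs < length A"
      using length_filter_le[of "\<lambda>x. fst x \<le> c" zs] length_filter_le[of "\<lambda>x. fst x \<le> c" ys]
      unfolding A by (simp del: length_filter_le)
  qed
qed

text \<open>
  Only the least entry of \<open>T\<close> survives the truncation of \<open>A @ T\<close> once the rest of \<open>T\<close> is shifted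
  above \<open>A\<close>.
\<close>

lemma insert_least:
  assumes A: "valid A" "has_o A" "B A = i" and T: "valid T" "has_o T" "B T = i" "least T (k, \<tau>, False)"
    and k': "\<And>x. x \<in> set A \<Longrightarrow> k' < fst x"
  shows "B (A @ [(k', \<tau>, False)]) = i"
proof -
  obtain xs ys where Teq: "T = xs @ (k, \<tau>, False) # ys"
    using least_split[OF T(4)] by blast
  define T' where "T' = ys @ xs"
  have T'_gt: "fst x > k" if "x \<in> set T'" for x
    using least_less_split[of xs "(k, \<tau>, False)" ys x] T that by (auto simp: Teq T'_def)
  have vT: "valid ((k, \<tau>, False) # T')"
    using T(1) unfolding Teq T'_def by (auto simp: valid_def)
  have BT: "B ((k, \<tau>, False) # T') = i"
    using rot_append[of xs "(k, \<tau>, False) # ys"] T by (simp add: Teq T'_def)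
  define N where "N = Max (insert k' (fst ` set A))"
  have N: "k' \<le> N" "\<And>x. x \<in> set A \<Longrightarrow> fst x \<le> N"
    unfolding N_def by auto
  \<comment> \<open>All ranks of \<open>T\<close> are at least \<open>k\<close>, and from there on
    \<open>h\<close> is strictly increasing: \<open>k\<close> goes to \<open>k'\<close>, which is at
    most \<open>N\<close>, and larger ranks go beyond \<open>N\<close>.\<close>
  define h where "h j = (if j \<le> k then k' else N + (j - k))" for j
  let ?T2 = "map (apfst h) T'"
  have T2_gt: "fst x > N" if "x \<in> set ?T2" for x
    using that T'_gt by (force simp: h_def)
  have hmono: "strict_mono_on {k..} h"
    using N(1) by (auto simp: strict_mono_on_def h_def)
  have sub: "fst ` set ((k, \<tau>, False) # T') \<subseteq> {k..}"
    using T'_gt by force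
  have map_T: "map (apfst h) ((k, \<tau>, False) # T') = (k', \<tau>, False) # ?T2"
    by (simp add: h_def)
  have hm: "strict_mono_on (fst ` set ((k, \<tau>, False) # T')) h"
    by (rule monotone_on_subset[OF hmono sub])
  have BT2: "B ((k', \<tau>, False) # ?T2) = i"
    using mono[OF vT hm] BT unfolding map_T by simp
  have "map fst (map (apfst h) ((k, \<tau>, False) # T')) = map h (map fst ((k, \<tau>, False) # T'))"
    by (simp add: comp_def)
  moreover have "distinct (map h (map fst ((k, \<tau>, False) # T')))"
    using vT strict_mono_on_imp_inj_on[OF hm] unfolding valid_def distinct_map by (metis image_set)
  ultimately have dT2: "distinct (map fst ((k', \<tau>, False) # ?T2))"
    unfolding map_T by simp
  have disj: "fst ` set A \<inter> fst ` set ((k', \<tau>, False) # ?T2) = {}"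
  proof -
    have "fst y \<noteq> fst x" if "x \<in> set A" "y \<in> set ((k', \<tau>, False) # ?T2)" for x y
      using T2_gt[of y] N(2)[OF that(1)] k'[OF that(1)] that(2) by (auto simp del: set_map)
    then show ?thesis by (smt (verit) disjoint_iff imageE)
  qed
  have v: "valid (A @ (k', \<tau>, False) # ?T2)"
    using A(1) dT2 disj unfolding valid_def map_append distinct_append by (simp only: set_map) blast
  have "B (A @ (k', \<tau>, False) # ?T2) = i"
    by (intro glue A BT2 v) (use T(2) dT2 in \<open>auto simp: valid_def Teq T'_def\<close>)
  moreover have "filter (\<lambda>x. fst x \<le> N) (A @ (k', \<tau>, False) # ?T2) = A @ [(k', \<tau>, False)]"
    using N T2_gt by (auto simp: filter_empty_conv not_le filter_id_conv)
  ultimately show ?thesis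
    using truncate[OF v, of N] A(2) by simp
qed

section \<open>Words of length one and two, and the trichotomy\<close>

abbreviation "\<gamma> s \<equiv> B [(0, s, True)]"
abbreviation "q s t \<equiv> B [(0, s, False), (1, t, True)]"

text \<open>Transfers the value of a word of any length to a two-letter word that keeps only its
  least letter, provided that a single oriented letter of the same value exists.\<close>

lemma insert_below_single:
  assumes "valid T" "has_o T" "least T (k, \<tau>, False)" "\<gamma> \<sigma> = B T"
  shows "q \<tau> \<sigma> = B T"
proof -
  let ?A = "[(0 :: int, \<sigma>, True)]"
  have v: "valid ?A" "has_o ?A"
    by (simp_all add: valid_def)
  have lt: "-1 < fst x" if "x \<in> set ?A" for x
    using that by simp
  \<comment> \<open>The inserted letter needs a rank below 0; \<open>shift2\<close> afterwards
    renames the ranks -1 and 0 to 0 and 1.\<close>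
  have "B (?A @ [(-1, \<tau>, False)]) = B T"
    using insert_least[OF v assms(4,1,2) refl assms(3) lt] .
  then show ?thesis
    using shift2(2)[of "-1" 0 \<sigma> True \<tau> False] by simp
qed

text \<open>Up to rotation the two words are flipped reversals of each other, so
  \<open>ext_u_o\<close> applies to the pair.\<close>

lemma q_opp:
  assumes "B [(0, Pos, False)]"
  shows "q (opp s) (opp t) \<longleftrightarrow> \<not> q s t"
proof -
  have v: "valid [(0 :: int, s, False)]" "\<not> has_o [(0, s, False)]"
    by (simp_all add: valid_def)
  have "B (rev (map flip ([(0, s, False)] @ [(1, t, True)]))) \<noteq> B ([(0, s, False)] @ [(1, t, True)])"
    by (rule ext_u_o[OF v(1) _ v(2)]) (use all_u[OF v] assms in auto)
  then show ?thesis
    using shift2(2)[of 0 1 "opp t" True "opp s" False] by simp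
qed

text \<open>By \<open>q_opp\<close> the hypothesis on \<open>q\<close> means that a two-letter word
  is decided by its bioriented sign. Inserting the least letter of \<open>A\<close> below a single
  oriented letter carries this over to \<open>A\<close>.\<close>

lemma least_unoriented_case:
  assumes \<beta>: "B [(0, Pos, False)]" and q: "q Pos Pos = q Pos Neg"
    and A: "valid A" "has_o A" "least A (k, \<tau>, False)"
  shows "B A \<longleftrightarrow> (\<tau> = Pos \<longleftrightarrow> q Pos Pos)"
proof -
  have q': "q s t \<longleftrightarrow> (s = Pos \<longleftrightarrow> q Pos Pos)" for s t
    using q_opp[OF \<beta>, of Pos Pos] q_opp[OF \<beta>, of Pos Neg] q
    by (cases s; cases t; simp only: opp.simps sign.distinct; argo)
  show ?thesis
  proof (cases "\<exists>\<sigma>. \<gamma> \<sigma> = B A")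
    case True
    then show ?thesis
      using insert_below_single[OF A] q'[of \<tau>] by blast
  next
    case False
    obtain xs c s where T: "valid (xs @ [(c, s, True)])" "\<not> has_o xs" "valid xs" "\<And>x. x \<in> set xs \<Longrightarrow> fst x < c"
      "least xs (k, \<tau>, False)" "B A = B (xs @ [(c, s, True)])"
      using terminal_form[OF A] by metis
    \<comment> \<open>Both single oriented letters now have the value opposite to that of
      \<open>A\<close>. So has the flipped reversal of the terminal form, whose least letter carries
      \<open>opp \<tau>\<close>; hence this word can be inserted, and \<open>q_opp\<close>
      translates the result back.\<close>
    let ?T = "rev (map flip (xs @ [(c, s, True)]))"
    have "B ?T \<longleftrightarrow> \<not> B A"
      using ext_u_o[OF T(3) T(4) T(2), of s] all_u[OF T(3,2)] \<beta> T(6) by simp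
    moreover have "least ?T (k, opp \<tau>, False)"
      using T(4)[of "(k, \<tau>, False)"] T(5) by (force simp: least_def)
    moreover have "valid ?T"
      using T(1) by (simp only: valid_rev valid_flip)
    ultimately have "q (opp \<tau>) Pos \<longleftrightarrow> \<not> B A"
      using insert_below_single[of ?T k "opp \<tau>" Pos] False by auto
    then show ?thesis
      using q'[of "opp \<tau>" Pos] by (cases \<tau>; simp only: opp.simps sign.distinct; argo)
  qed
qed

text \<open>Here a two-letter word is decided by its oriented sign. A bioriented least letter can
  therefore be removed and put back by gluing with a two-letter word of the same value, until the
  least letter is the oriented one.\<close>

lemma weird_case:
  assumes \<beta>: "B [(0, Pos, False)]" and q: "q Pos Pos \<noteq> q Pos Neg"
    and A: "valid A" "least (filter (\<lambda>x. snd (snd x)) A) (c, s, True)"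
  shows "B A = q Pos s"
proof -
  \<comment> \<open>\<open>q_opp\<close> turns the difference between \<open>q Pos Pos\<close> and
    \<open>q Pos Neg\<close> into independence of the first sign.\<close>
  have q': "q t u \<longleftrightarrow> q Pos u" for t u
    using q_opp[OF \<beta>, of Pos Pos] q_opp[OF \<beta>, of Pos Neg] q
    by (cases t; cases u; simp only: opp.simps; argo)
  have q_neq: "q t (opp u) \<longleftrightarrow> \<not> q t' u" for t t' u
    using q q'[of t u] q'[of t' u] q'[of t "opp u"] by (cases u; simp only: opp.simps; argo)
  \<comment> \<open>Were \<open>\<gamma> u\<close> different from \<open>q Pos u\<close>, it would
    equal \<open>q Pos (opp u)\<close>. Inserting the bioriented letter of that word below the
    single letter \<open>u\<close> would then give \<open>q Pos u = q Pos (opp u)\<close>.\<close>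
  have \<gamma>: "\<gamma> u = q Pos u" for u
  proof (rule ccontr)
    assume *: "\<gamma> u \<noteq> q Pos u"
    then have "q Pos u = q Pos (opp u)"
      using insert_below_single[of "[(0, Pos, False), (1, opp u, True)]" 0 Pos u] q_neq[of Pos u Pos]
      by (auto simp: valid_def least_def)
    then show False
      using q_neq by blast
  qed
  show ?thesis
    using A
  proof (induction "length A" arbitrary: A c s rule: less_induct)
    case less
    have o: "has_o A"
      using less.prems by (force simp: least_def has_o_def)
    obtain k \<tau> b where k: "least A (k, \<tau>, b)"
      using ex_least less.prems(1) unfolding valid_def by (metis prod_cases3)
    show ?case
    proof (cases b)
      case True
      have c: "(c, s, True) \<in> set A"
        using less.prems(2) unfolding least_def by auto
      have kA: "(k, \<tau>, True) \<in> set A"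
        using k True unfolding least_def by simp
      have "c \<le> fst (k, \<tau>, True)"
        using less.prems(2) kA unfolding least_def by fastforce
      moreover have "k \<le> fst (c, s, True)"
        using k c unfolding least_def by (metis fst_conv)
      ultimately have "(k, \<tau>, True) = (c, s, True)"
        by (intro valid_eqI[OF less.prems(1) kA c]) simp
      then have "least A (c, s, True)"
        using k True by simp
      then show ?thesis
        using least_oriented[OF less.prems(1)] \<gamma>[of s] by simp
    next
      case False
      then have k: "least A (k, \<tau>, False)"
        using k by simp
      then obtain xs ys where Aeq: "A = xs @ (k, \<tau>, False) # ys"
        using least_split[OF k] by blast
      have gt: "k < fst x" if "x \<in> set (ys @ xs)" for x
        using least_less_split[of xs "(k, \<tau>, False)" ys x] less.prems(1) k that by (auto simp: Aeq)
      have v: "valid (ys @ xs)"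
        using less.prems(1) o by (auto simp: valid_def Aeq)
      have "B (ys @ xs) = q Pos s"
        using less.prems v by (intro less.hyps[of _ c]) (auto simp: Aeq least_def)
      \<comment> \<open>The word supplying the letter has value \<open>q \<tau> s\<close>, which is
        \<open>q Pos s\<close> and so agrees with the value of the rest of \<open>A\<close>.\<close>
      then have "B ((ys @ xs) @ [(k, \<tau>, False)]) = q Pos s"
        using gt v o q'[of \<tau> s]
        by (intro insert_least[of _ _ "[(0, \<tau>, False), (1, s, True)]" 0])
          (auto simp: valid_def least_def Aeq)
      then show ?thesis
        using rot_append[of "xs @ [(k, \<tau>, False)]" ys] less.prems(1) by (simp add: Aeq)
    qed
  qed
qed

text \<open>The three alternatives correspond to a good bioriented letter, to two-letter words
  decided by their bioriented sign, and to two-letter words decided by their oriented sign. In the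
  last two, words without oriented letters are bad whatever their signs, so they form a separate
  disjunct.\<close>

theorem classification:
  shows "(\<exists>Y. \<forall>A. valid A \<longrightarrow> B A = (\<exists>k s. least A (k, s, True) \<and> s \<in> Y)) \<or>
    (\<exists>Y \<delta>. \<forall>A. valid A \<longrightarrow>
       B A = (\<not> has_o A \<or> (\<exists>k s. least A (k, s, True) \<and> s \<in> Y) \<or> (\<exists>k. least A (k, \<delta>, False)))) \<or>
    (\<exists>\<delta>. \<forall>A. valid A \<longrightarrow>
       B A = (\<not> has_o A \<or> (\<exists>k. least (filter (\<lambda>x. snd (snd x)) A) (k, \<delta>, True))))"
proof -
  have least_unique: "x = y" if "valid A" "least A x" "least A y" for A :: "(int \<times> sign \<times> bool) list" and x y
    using that by (meson least_def nle_le valid_eqI)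
  have least_cases: "(\<exists>k s. least A (k, s, True)) \<or> (\<exists>k s. least A (k, s, False))"
    if "valid A" for A :: "(int \<times> sign \<times> bool) list"
    using ex_least[of A] that unfolding valid_def by (metis (full_types) prod_cases3)
  have least_o: "has_o A" if "least A (k, s, True)" for A :: "(int \<times> sign \<times> bool) list" and k s
    using that by (force simp: least_def has_o_def)
  let ?Y = "{s. \<gamma> s}"
  consider "\<not> B [(0, Pos, False)]" | "B [(0, Pos, False)]" "q Pos Pos = q Pos Neg"
    | "B [(0, Pos, False)]" "q Pos Pos \<noteq> q Pos Neg" by blast
  then show ?thesis
  proof cases
    case 1
    have "B A = (\<exists>k s. least A (k, s, True) \<and> s \<in> ?Y)" if v: "valid A" for A
    proof (cases "\<exists>k s. least A (k, s, True)")
      case True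
      then obtain k s where ks: "least A (k, s, True)" by blast
      then show ?thesis
        using least_oriented[OF v] least_unique[OF v ks] by auto
    next
      case False
      then obtain k \<tau> where k: "least A (k, \<tau>, False)"
        using least_cases[OF v] by blast
      have "\<not> B A"
      proof (cases "has_o A")
        case True
        obtain xs c s where T: "valid (xs @ [(c, s, True)])" "\<not> has_o xs" "valid xs" "\<And>x. x \<in> set xs \<Longrightarrow> fst x < c"
          "B A = B (xs @ [(c, s, True)])"
          using terminal_form[OF v True k] by metis
        then show ?thesis
          using ext_u_good[OF T(3,4,2)] all_u[OF T(3,2)] 1 by simp
      next
        case F: False
        then show ?thesis using all_u[OF v F] 1 by simp
      qed
      then show ?thesis using False by blast
    qed
    then show ?thesis by blast
  next
    case 2
    \<comment> \<open>The sign that makes a word bad when its least letter is bioriented and some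
      other letter is oriented.\<close>
    define \<delta> where "\<delta> = (if q Pos Pos then Pos else Neg)"
    have "B A = (\<not> has_o A \<or> (\<exists>k s. least A (k, s, True) \<and> s \<in> ?Y) \<or> (\<exists>k. least A (k, \<delta>, False)))"
      if v: "valid A" for A
    proof (cases "has_o A")
      case True
      show ?thesis
      proof (cases "\<exists>k s. least A (k, s, True)")
        case o: True
        then obtain k s where ks: "least A (k, s, True)" by blast
        then show ?thesis
          using least_oriented[OF v ks] least_unique[OF v ks] True ks by blast
      next
        case False
        then obtain k \<tau> where k: "least A (k, \<tau>, False)"
          using least_cases[OF v] by blast
        have "B A \<longleftrightarrow> (\<tau> = Pos \<longleftrightarrow> q Pos Pos)"
          by (rule least_unoriented_case[OF 2 v True k])
        also have "\<dots> \<longleftrightarrow> \<tau> = \<delta>"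
          by (cases \<tau>) (auto simp: \<delta>_def)
        finally show ?thesis
          using True False k least_unique[OF v k] by blast
      qed
    qed (use all_u[OF v] 2 in auto)
    then show ?thesis by blast
  next
    case 3
    \<comment> \<open>Exactly one of the oriented signs makes a two-letter word bad, and this is
      it.\<close>
    define \<delta> where "\<delta> = (if q Pos Pos then Pos else Neg)"
    have \<delta>: "q Pos s \<longleftrightarrow> s = \<delta>" for s
      using 3 by (cases s) (auto simp: \<delta>_def)
    have "B A = (\<not> has_o A \<or> (\<exists>k. least (filter (\<lambda>x. snd (snd x)) A) (k, \<delta>, True)))"
      if v: "valid A" for A
    proof (cases "has_o A")
      case True
      then have ne: "filter (\<lambda>x. snd (snd x)) A \<noteq> []"
        by (auto simp: has_o_def filter_empty_conv)
      then obtain x where x: "least (filter (\<lambda>x. snd (snd x)) A) x"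
        using ex_least by blast
      obtain c s where cs: "x = (c, s, True)"
        using x by (cases x) (auto simp: least_def)
      have "valid (filter (\<lambda>x. snd (snd x)) A)"
        using v ne by (simp add: valid_def distinct_map_filter)
      then have "(\<exists>k. least (filter (\<lambda>x. snd (snd x)) A) (k, \<delta>, True)) \<longleftrightarrow> s = \<delta>"
        using x least_unique[OF _ x] unfolding cs by blast
      then show ?thesis
        using weird_case[OF 3 v] x True \<delta> unfolding cs by simp
    qed (use all_u[OF v] 3 in auto)
    then show ?thesis by blast
  qed
qed

end

section \<open>Cuts and cycles in common\<close>

fun neg :: "'e dart \<Rightarrow> 'e dart" where
  "neg (e, s) = (e, opp s)"

lemma neg_neg [simp]: "neg (neg d) = d" and fst_neg [simp]: "fst (neg d) = fst d"
  and neg_neq [simp]: "neg d \<noteq> d" "d \<noteq> neg d"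
  by (cases d; simp)+

lemma neg_eq_iff [simp]: "neg d = neg d' \<longleftrightarrow> d = d'"
  by (metis neg_neg)

lemma image_fst_neg [simp]: "fst ` neg ` D = fst ` D"
  by (simp add: image_image)

lemma same_edge_cases: "fst d = fst d' \<Longrightarrow> d = d' \<or> d = neg d'"
  by (cases d; cases d'; cases "snd d"; cases "snd d'") auto

lemma ex1_sign: "(\<exists>!\<epsilon>. Q \<epsilon>) \<longleftrightarrow> Q Pos \<noteq> Q Neg"
proof -
  have "(\<exists>\<epsilon>. R \<epsilon>) \<longleftrightarrow> R Pos \<or> R Neg" "(\<forall>\<epsilon>. R \<epsilon>) \<longleftrightarrow> R Pos \<and> R Neg" for R
    by (metis sign.exhaust)+
  then show ?thesis
    unfolding Ex1_def by auto
qed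

section \<open>Words of circuits\<close>

text \<open>Meant for \<open>set L \<subseteq> F\<close>: then an edge of \<open>L\<close> is
  bioriented if the dart opposite to the listed one lies in \<open>F\<close>, and oriented
  otherwise. So the word determines \<open>F\<close> on the edges of \<open>L\<close>.\<close>

definition enc :: "('e \<Rightarrow> int) \<Rightarrow> 'e dart set \<Rightarrow> 'e dart list \<Rightarrow> (int \<times> sign \<times> bool) list" where
  "enc \<rho> F L = map (\<lambda>(e, s). (\<rho> e, s, (e, opp s) \<notin> F)) L"

text \<open>Ranks need not be consecutive. A minor can thus keep the ranks of the whole graph, and
  new letters fit below or above old ones.\<close>

definition emb :: "('e \<Rightarrow> int) \<Rightarrow> 'e rel \<Rightarrow> 'e set \<Rightarrow> bool" where
  "emb \<rho> r E \<longleftrightarrow> (\<forall>e\<in>E. \<forall>f\<in>E. (e, f) \<in> r \<longleftrightarrow> \<rho> e \<le> \<rho> f)"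

lemma enc_simps [simp]:
  "enc \<rho> F [] = []" "enc \<rho> F ((e, s) # L) = (\<rho> e, s, (e, opp s) \<notin> F) # enc \<rho> F L"
  "enc \<rho> F (L @ M) = enc \<rho> F L @ enc \<rho> F M" "length (enc \<rho> F L) = length L"
  "enc \<rho> F (rotate1 L) = rotate1 (enc \<rho> F L)" "enc \<rho> F L = [] \<longleftrightarrow> L = []"
  by (simp_all add: enc_def rotate1_map)

lemma enc_rev [simp]: "enc \<rho> F (rev L) = rev (enc \<rho> F L)"
  by (simp add: enc_def rev_map)

lemma append_eq_enc: "A @ A' = enc \<rho> F L \<Longrightarrow> \<exists>X Y. L = X @ Y \<and> A = enc \<rho> F X \<and> A' = enc \<rho> F Y"
  unfolding enc_def append_eq_map_conv by blast

lemma map_fst_enc: "map fst (enc \<rho> F L) = map \<rho> (map fst L)"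
  by (auto simp: enc_def)

lemma enc_cong: "(\<And>e s. e \<in> fst ` set L \<Longrightarrow> (e, s) \<in> F \<longleftrightarrow> (e, s) \<in> F') \<Longrightarrow> enc \<rho> F L = enc \<rho> F' L"
  by (force simp: enc_def)

lemma has_o_enc: "has_o (enc \<rho> F L) \<longleftrightarrow> \<not> neg ` set L \<subseteq> F"
  unfolding enc_def has_o_def by (induction L) auto

lemma enc_neg:
  assumes "set L \<subseteq> F" "neg ` set L \<subseteq> F"
  shows "enc \<rho> F (map neg L) = map flip (enc \<rho> F L)"
  using assms by (induction L) auto

lemma emb_inj: "emb \<rho> r E \<Longrightarrow> linear_order_on E r \<Longrightarrow> inj_on \<rho> E"
  unfolding emb_def linear_order_on_def partial_order_on_def by (intro inj_onI) (auto intro: antisymD)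

lemma emb_subset: "emb \<rho> r E \<Longrightarrow> E' \<subseteq> E \<Longrightarrow> emb \<rho> r E'"
  unfolding emb_def by blast

lemma emb_Restr: "emb \<rho> r E \<Longrightarrow> E \<subseteq> E' \<Longrightarrow> emb \<rho> (Restr r E') E"
  unfolding emb_def by blast

lemma linear_order_on_Restr:
  assumes "linear_order_on E r" "E' \<subseteq> E"
  shows "linear_order_on E' (Restr r E')"
  using assms
  unfolding linear_order_on_def partial_order_on_def preorder_on_def refl_on_def total_on_def antisym_def trans_def
  by (safe; blast)

lemma linear_order_on_subset: "linear_order_on E r \<Longrightarrow> r \<subseteq> E \<times> E"
  unfolding linear_order_on_def partial_order_on_def preorder_on_def by auto

lemma ex_emb:
  assumes "linear_order_on E r" "finite E"
  shows "\<exists>\<rho>. emb \<rho> r E"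
proof -
  define \<rho> where "\<rho> e = int (card {f \<in> E. (f, e) \<in> r})" for e
  have r: "refl_on E r" "trans r" "antisym r" "total_on E r"
    using assms(1) by (auto simp: linear_order_on_def partial_order_on_def preorder_on_def)
  have "(e, f) \<in> r \<longleftrightarrow> \<rho> e \<le> \<rho> f" if "e \<in> E" "f \<in> E" for e f
  proof
    assume "(e, f) \<in> r"
    then have "{g \<in> E. (g, e) \<in> r} \<subseteq> {g \<in> E. (g, f) \<in> r}"
      using r(2) by (auto dest: transD)
    then show "\<rho> e \<le> \<rho> f"
      unfolding \<rho>_def using assms(2) by (simp add: card_mono)
  next
    assume le: "\<rho> e \<le> \<rho> f"
    show "(e, f) \<in> r"
    proof (rule ccontr)
      assume n: "(e, f) \<notin> r"
      then have "e \<noteq> f"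
        using refl_onD[OF r(1) that(1)] by auto
      then have fe: "(f, e) \<in> r"
        using r(4) that n unfolding total_on_def by blast
      have "{g \<in> E. (g, f) \<in> r} \<subset> {g \<in> E. (g, e) \<in> r}"
        using r fe n that by (auto dest: transD refl_onD)
      then have "\<rho> f < \<rho> e"
        unfolding \<rho>_def using assms(2) by (simp add: psubset_card_mono)
      then show False using le by simp
    qed
  qed
  then show ?thesis
    unfolding emb_def by blast
qed

lemma least_enc:
  assumes "emb \<rho> r (fst ` set L)"
  shows "least (enc \<rho> F L) (k, s, b) \<longleftrightarrow>
    (\<exists>e. (e, s) \<in> set L \<and> k = \<rho> e \<and> is_min r (fst ` set L) e \<and> b = ((e, opp s) \<notin> F))"
proof -
  have "(k, s, b) \<in> set (enc \<rho> F L) \<longleftrightarrow> (\<exists>e. (e, s) \<in> set L \<and> k = \<rho> e \<and> b = ((e, opp s) \<notin> F))"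
    by (auto simp: enc_def)
  moreover have "(\<forall>y\<in>set (enc \<rho> F L). \<rho> e \<le> fst y) \<longleftrightarrow> is_min r (fst ` set L) e" if "(e, s) \<in> set L" for e
  proof -
    have e: "e \<in> fst ` set L"
      using that by force
    have "fst ` set (enc \<rho> F L) = \<rho> ` fst ` set L"
      by (metis list.set_map map_fst_enc)
    then have "(\<forall>y\<in>set (enc \<rho> F L). \<rho> e \<le> fst y) \<longleftrightarrow> (\<forall>f\<in>fst ` set L. \<rho> e \<le> \<rho> f)"
      by (metis (no_types, lifting) image_iff)
    also have "\<dots> \<longleftrightarrow> is_min r (fst ` set L) e"
      using assms e unfolding emb_def is_min_def by blast
    finally show ?thesis .
  qed
  ultimately show ?thesis
    unfolding least_def fst_conv by blast
qed

lemma least_oriented_enc: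
  assumes "emb \<rho> r (fst ` set L)" "set L \<subseteq> F" "distinct (map fst L)"
  shows "(\<exists>k. least (filter (\<lambda>x. snd (snd x)) (enc \<rho> F L)) (k, s, True)) \<longleftrightarrow> min_oriented r F (fst ` set L) s"
proof -
  let ?L = "filter (\<lambda>d. neg d \<notin> F) L"
  have filt: "filter (\<lambda>x. snd (snd x)) (enc \<rho> F L) = enc \<rho> F ?L"
    by (induction L) auto
  have or: "oriented F (fst d) \<longleftrightarrow> neg d \<notin> F" if "d \<in> set L" for d
  proof -
    obtain e t where d: "d = (e, t)"
      by (cases d)
    then have "(e, t) \<in> F"
      using assms(2) that by blast
    then show ?thesis
      by (cases t) (auto simp: oriented_def d ex1_sign)
  qed
  then have edges: "{e \<in> fst ` set L. oriented F e} = fst ` set ?L"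
    by force
  have "emb \<rho> r (fst ` set ?L)"
    using assms(1) by (rule emb_subset) auto
  then have "(\<exists>k. least (enc \<rho> F ?L) (k, s, True)) \<longleftrightarrow>
      (\<exists>e. (e, s) \<in> set ?L \<and> is_min r (fst ` set ?L) e)"
    by (auto simp: least_enc)
  also have "\<dots> \<longleftrightarrow> min_oriented r F (fst ` set L) s"
    unfolding min_oriented_def edges
  proof (rule ex_cong1, safe)
    fix e
    assume "is_min r (fst ` set ?L) e" "(e, s) \<in> F"
    then obtain t where t: "(e, t) \<in> set L" "(e, opp t) \<notin> F"
      by (auto simp: is_min_def)
    then have "t = s"
      using \<open>(e, s) \<in> F\<close> neq_iff_opp by metis
    then show "(e, s) \<in> set ?L"
      using t by simp
  qed (use assms(2) in auto)
  finally show ?thesis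
    unfolding filt .
qed

text \<open>The min-edge condition in its form for cycles, as a condition on a set of darts. Cuts
  are brought into this form by complementation, which turns unoriented edges into bioriented
  ones.\<close>

definition min_bad :: "sign set set \<Rightarrow> sign \<Rightarrow> 'e rel \<Rightarrow> 'e dart set \<Rightarrow> 'e dart set \<Rightarrow> bool" where
  "min_bad X \<delta> r F D \<longleftrightarrow>
     (\<exists>e. is_min r (fst ` D) e \<and> signs F e \<in> X \<and> (bioriented F e \<longrightarrow> (e, \<delta>) \<in> D))"

text \<open>
  Cuts and cycles are treated alike. \<open>Pot G\<close> consists of the dart sets of directed cuts (cycles),
  \<open>circ G L\<close> says that \<open>L\<close> lists the darts of a simple one, for cycles in cyclic order, and
  \<open>elem K L\<close> that moreover \<open>K\<close> is the minor belonging to it. For cuts the complementary fourientation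
  is used, so that a directed cut is potential iff its darts belong to the fourientation.
\<close>

locale tutte_system =
  fixes P :: "('v, 'e::infinite) property"
    and Pot :: "('v, 'e) pre_digraph \<Rightarrow> 'e dart set set"
    and circ elem :: "('v, 'e) pre_digraph \<Rightarrow> 'e dart list \<Rightarrow> bool"
    and cm :: "('v, 'e) pre_digraph \<Rightarrow> 'e set \<Rightarrow> ('v, 'e) pre_digraph"
    and minor :: "('v, 'e) pre_digraph \<Rightarrow> 'e \<Rightarrow> ('v, 'e) pre_digraph"
  assumes iso: "fourientation_property P"
    and decomp: "ordered_graph G r \<Longrightarrow> fourientation G F \<Longrightarrow>
      P G r F \<longleftrightarrow> (\<forall>L. circ G L \<longrightarrow> good_minor P (cm G (fst ` set L)) r F)"
    and T1: "ordered_graph G r \<Longrightarrow> fourientation G F \<Longrightarrow> \<not> P G r F \<Longrightarrow> \<exists>D\<in>Pot G. D \<subseteq> F"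
    and T2: "ordered_graph G r \<Longrightarrow> is_max r (arcs G) e \<Longrightarrow> \<not> isthmus G e \<Longrightarrow> \<not> loop G e \<Longrightarrow>
      fourientation (minor G e) F \<Longrightarrow>
        (good_minor P (minor G e) r F \<longrightarrow> P G r (F \<union> {(e, Pos)}) \<and> P G r (F \<union> {(e, Neg)})) \<and>
        (\<not> good_minor P (minor G e) r F \<longrightarrow> P G r F \<longrightarrow> (\<exists>!\<epsilon>. P G r (F \<union> {(e, \<epsilon>)}))) \<and>
        (good_minor P (minor G e) r F \<longleftrightarrow> P G r (F \<union> {(e, Pos), (e, Neg)}))"
    and circ_edges: "circ G L \<Longrightarrow> L \<noteq> [] \<and> distinct (map fst L) \<and> fst ` set L \<subseteq> arcs G"
    and circ_neg: "circ G L \<Longrightarrow> circ G (rev (map neg L))"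
    and circ_elem: "ordered_graph G r \<Longrightarrow> circ G L \<Longrightarrow> elem (cm G (fst ` set L)) L"
    and elem_rot: "elem K L \<Longrightarrow> elem K (rotate1 L)"
    and elem_neg: "elem K L \<Longrightarrow> elem K (rev (map neg L))"
    and elem_graph: "elem K L \<Longrightarrow> fin_digraph K \<and> connected K \<and> arcs K = fst ` set L"
    and elem_Pot: "elem K L \<Longrightarrow> D \<in> Pot K \<Longrightarrow> D = set L \<or> D = neg ` set L"
    and elem_iso: "elem K L \<Longrightarrow> elem K' (map (map_prod h id) L) \<Longrightarrow> inj_on h (fst ` set L) \<Longrightarrow>
      \<exists>g. inj_on g (verts K) \<and> g ` verts K = verts K' \<and>
          (\<forall>e\<in>arcs K. tail K' (h e) = g (tail K e) \<and> head K' (h e) = g (head K e))"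
    and elem_ex: "L \<noteq> [] \<Longrightarrow> distinct (map fst L) \<Longrightarrow> \<exists>K. elem K L"
    and elem_minor: "elem K (L @ [(e, s)]) \<Longrightarrow> L \<noteq> [] \<Longrightarrow> distinct (map fst (L @ [(e, s)])) \<Longrightarrow>
      elem (minor K e) L \<and> \<not> isthmus K e \<and> \<not> loop K e"
    and pair_ex: "X \<noteq> [] \<Longrightarrow> Y \<noteq> [] \<Longrightarrow> distinct (map fst (X @ Y @ [(e, Pos)])) \<Longrightarrow>
      \<exists>G. fin_digraph G \<and> connected G \<and> arcs G = fst ` set (X @ Y @ [(e, Pos)]) \<and>
        \<not> isthmus G e \<and> \<not> loop G e \<and>
        circ G (X @ [(e, Pos)]) \<and> circ G (Y @ [(e, Neg)]) \<and> circ G (X @ Y) \<and>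
        (\<forall>M. circ G M \<longrightarrow> e \<in> fst ` set M \<or> set M = set (X @ Y) \<or> set M = neg ` set (X @ Y)) \<and>
        fin_digraph (minor G e) \<and> connected (minor G e) \<and> arcs (minor G e) = fst ` set (X @ Y) \<and>
        circ (minor G e) X \<and> circ (minor G e) Y \<and>
        (\<forall>M. circ (minor G e) M \<longrightarrow> set M \<in> {set X, neg ` set X, set Y, neg ` set Y})"
    and Pot_circ: "circ G L \<Longrightarrow> set L \<in> Pot G"
    and Pot_circ_sub: "ordered_graph G r \<Longrightarrow> D \<in> Pot G \<Longrightarrow> d \<in> D \<Longrightarrow> \<exists>L. circ G L \<and> d \<in> set L \<and> set L \<subseteq> D"
    and Pot_nonempty: "ordered_graph G r \<Longrightarrow> D \<in> Pot G \<Longrightarrow> D \<noteq> {}"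
begin

section \<open>Badness of a word is well defined\<close>

text \<open>Some realization of the word is bad; by \<open>B_enc\<close> this is the same as every
  realization being bad.\<close>

definition B :: "(int \<times> sign \<times> bool) list \<Rightarrow> bool" where
  "B A \<longleftrightarrow> (\<exists>K r F L \<rho>. elem K L \<and> distinct (map fst L) \<and> linear_order_on (arcs K) r \<and> fourientation K F \<and> set L \<subseteq> F \<and>
     emb \<rho> r (arcs K) \<and> A = enc \<rho> F L \<and> \<not> P K r F)"

lemma P_iso:
  assumes "ordered_graph K r" "fourientation K F"
    and g: "inj_on g (verts K)" "g ` verts K = verts K'"
    and h: "inj_on h (arcs K)" "h ` arcs K = arcs K'"
    and inc: "\<And>e. e \<in> arcs K \<Longrightarrow> tail K' (h e) = g (tail K e) \<and> head K' (h e) = g (head K e)"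
  shows "P K' (map_prod h h ` r) (map_prod h id ` F) \<longleftrightarrow> P K r F"
proof -
  let ?hom = "\<lparr>iso_verts = g, iso_arcs = h, iso_head = head K', iso_tail = tail K'\<rparr>"
  have "wf_digraph K"
    using assms(1) by (auto simp: ordered_graph_def fin_digraph_def)
  then have "pre_digraph.digraph_isomorphism K ?hom"
    using g h inc by (simp add: pre_digraph.digraph_isomorphism_def)
  moreover have "app_iso ?hom K = K'"
    using g h by (simp add: app_iso_def)
  ultimately show ?thesis
    using iso assms(1,2) unfolding fourientation_property_def
    by (metis digraph_isomorphism.select_convs(2))
qed

text \<open>Two realizations of one word are isomorphic: equal ranks match the edges and their
  orders, equal signs match the listed darts, and equal flags match the fourientations.\<close>

lemma B_enc:
  assumes K: "elem K L" "distinct (map fst L)" and r: "linear_order_on (arcs K) r" and F: "fourientation K F" "set L \<subseteq> F"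
    and \<rho>: "emb \<rho> r (arcs K)"
  shows "B (enc \<rho> F L) \<longleftrightarrow> \<not> P K r F"
proof
  assume "B (enc \<rho> F L)"
  then obtain K' r' F' L' \<rho>' where K': "elem K' L'" "distinct (map fst L')" and r': "linear_order_on (arcs K') r'"
    and F': "fourientation K' F'" "set L' \<subseteq> F'" and \<rho>': "emb \<rho>' r' (arcs K')"
    and eq: "enc \<rho> F L = enc \<rho>' F' L'" and bad: "\<not> P K' r' F'"
    unfolding B_def by auto
  note arcs = elem_graph[OF K(1)] elem_graph[OF K'(1)]
  have inj: "inj_on \<rho> (arcs K)" "inj_on \<rho>' (arcs K')"
    using emb_inj \<rho> \<rho>' r r' by blast+
  \<comment> \<open>The edge of \<open>K'\<close> that has the rank of \<open>e\<close>.\<close>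
  define h where "h e = inv_into (arcs K') \<rho>' (\<rho> e)" for e
  have len: "length L = length L'"
    using arg_cong[OF eq, of length] by simp
  have nth: "h (fst (L ! i)) = fst (L' ! i) \<and> snd (L ! i) = snd (L' ! i) \<and> \<rho> (fst (L ! i)) = \<rho>' (fst (L' ! i)) \<and>
    (neg (L ! i) \<in> F \<longleftrightarrow> neg (L' ! i) \<in> F')" if "i < length L" for i
  proof -
    have "enc \<rho> F L ! i = enc \<rho>' F' L' ! i"
      using eq by simp
    moreover have "fst (L' ! i) \<in> arcs K'"
      using arcs that len by simp
    ultimately show ?thesis
      using that len inj(2) by (auto simp: enc_def h_def split: prod.splits)
  qed
  have L': "L' = map (map_prod h id) L"
    using len nth by (intro nth_equalityI) (auto simp: prod_eq_iff)
  have h: "h ` arcs K = arcs K'" "inj_on h (arcs K)"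
  proof -
    show img: "h ` arcs K = arcs K'"
      using arcs unfolding L' by (simp add: image_image)
    have "card (arcs K) = card (arcs K')"
      using arcs K K' len by (metis distinct_card length_map list.set_map)
    then show "inj_on h (arcs K)"
      using arcs img by (metis eq_card_imp_inj_on fin_digraph.finite_arcs)
  qed
  have \<rho>h: "\<rho>' (h e) = \<rho> e" if "e \<in> arcs K" for e
  proof -
    from that arcs obtain i where "i < length L" "e = fst (L ! i)"
      by (auto simp: in_set_conv_nth)
    then show ?thesis using nth by simp
  qed
  have inj_h: "inj_on h (fst ` set L)"
    using h(2) arcs(1) by simp
  obtain g where g: "inj_on g (verts K)" "g ` verts K = verts K'"
    "\<forall>e\<in>arcs K. tail K' (h e) = g (tail K e) \<and> head K' (h e) = g (head K e)"
    using elem_iso[OF K(1) K'(1)[unfolded L'] inj_h] by blast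
  have "map_prod h h ` r = r'"
  proof (intro subset_antisym subrelI)
    fix e' f' assume "(e', f') \<in> map_prod h h ` r"
    then obtain e f where ef: "(e, f) \<in> r" "e' = h e" "f' = h f" by auto
    then have "e \<in> arcs K" "f \<in> arcs K"
      using linear_order_on_subset[OF r] by auto
    then show "(e', f') \<in> r'"
      using ef \<rho> \<rho>' \<rho>h h(1) unfolding emb_def by (metis image_eqI)
  next
    fix e' f' assume ef: "(e', f') \<in> r'"
    then have "e' \<in> h ` arcs K" "f' \<in> h ` arcs K"
      using linear_order_on_subset[OF r'] h(1) by auto
    then obtain e f where "e \<in> arcs K" "f \<in> arcs K" "e' = h e" "f' = h f" by auto
    then show "(e', f') \<in> map_prod h h ` r"
      using ef \<rho> \<rho>' \<rho>h h(1) unfolding emb_def by (metis image_eqI map_prod_simp)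
  qed
  then have r_eq: "r' = map_prod h h ` r" ..
  have "map_prod h id ` F = F'"
  proof -
    \<comment> \<open>The listed darts lie in both fourientations; for their reverses the flags
      decide.\<close>
    have *: "(h e, s) \<in> F' \<longleftrightarrow> (e, s) \<in> F" if "e \<in> arcs K" for e s
    proof -
      from that arcs obtain i where i: "i < length L" "e = fst (L ! i)"
          by (auto simp: in_set_conv_nth)
      have mem: "L ! i \<in> F" "L' ! i \<in> F'"
        using F F' i len nth_mem by auto
      show ?thesis
      proof (cases "s = snd (L ! i)")
        case True
        then have "(e, s) = L ! i" "(h e, s) = L' ! i"
          using nth[OF i(1)] i by (auto simp: prod_eq_iff)
        then show ?thesis using mem by simp
      next
        case False
        then have "(e, s) = neg (L ! i)" "(h e, s) = neg (L' ! i)"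
          using nth[OF i(1)] i by (cases "L ! i"; cases "L' ! i"; auto simp: neq_iff_opp)+
        then show ?thesis using nth[OF i(1)] by simp
      qed
    qed
    have sub: "F \<subseteq> arcs K \<times> UNIV" "F' \<subseteq> arcs K' \<times> UNIV"
      using F F' by (auto simp: fourientation_def darts_def)
    show ?thesis
    proof (intro subset_antisym subsetI)
      fix d assume "d \<in> map_prod h id ` F"
      then show "d \<in> F'" using * sub by auto
    next
      fix d assume d: "d \<in> F'"
      then have "fst d \<in> h ` arcs K"
        using sub h(1) by auto
      then obtain e where e: "e \<in> arcs K" "d = map_prod h id (e, snd d)"
        by (auto simp: prod_eq_iff)
      then have "(e, snd d) \<in> F"
        using *[OF e(1), of "snd d"] d by (metis id_apply map_prod_simp)
      then show "d \<in> map_prod h id ` F"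
        using e(2) by (rule rev_image_eqI)
    qed
  qed
  then have F_eq: "F' = map_prod h id ` F" ..
  have "ordered_graph K r"
    using arcs r by (simp add: ordered_graph_def)
  from P_iso[OF this F(1) g(1,2) h(2,1)] show "\<not> P K r F"
    using g(3) bad unfolding r_eq F_eq by blast
next
  assume "\<not> P K r F"
  with assms show "B (enc \<rho> F L)"
    unfolding B_def by blast
qed

lemma elem_ordered: "elem K L \<Longrightarrow> linear_order_on (arcs K) r \<Longrightarrow> ordered_graph K r"
  using elem_graph by (simp add: ordered_graph_def)

text \<open>The two directions of \<open>L\<close> are the only candidates for a potential circuit
  of \<open>K\<close>, so T1 applies once both are excluded.\<close>

lemma elem_good:
  assumes "elem K L" "linear_order_on (arcs K) r" "fourientation K F" "\<not> set L \<subseteq> F" "\<not> neg ` set L \<subseteq> F"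
  shows "P K r F"
  using T1[OF elem_ordered] elem_Pot assms by blast

lemma minor_ordered: "circ G L \<Longrightarrow> ordered_graph G r \<Longrightarrow> linear_order_on (arcs (cm G (fst ` set L))) (Restr r (arcs (cm G (fst ` set L))))"
  using circ_elem[THEN elem_graph] circ_edges unfolding ordered_graph_def by (metis linear_order_on_Restr)

text \<open>A circuit that lies in \<open>F\<close> in no direction has a good minor by T1. One that
  lies in \<open>F\<close> backwards is replaced by its reversal, which has the same minor.\<close>

lemma good_iff:
  assumes G: "ordered_graph G r" "fourientation G F"
  shows "P G r F \<longleftrightarrow> (\<forall>L. circ G L \<longrightarrow> set L \<subseteq> F \<longrightarrow> good_minor P (cm G (fst ` set L)) r F)"
proof -
  have "good_minor P (cm G (fst ` set L)) r F"
    if L: "circ G L" and good: "\<And>L. circ G L \<Longrightarrow> set L \<subseteq> F \<Longrightarrow> good_minor P (cm G (fst ` set L)) r F" for L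
  proof -
    let ?K = "cm G (fst ` set L)"
    consider "set L \<subseteq> F" | "neg ` set L \<subseteq> F" | "\<not> set L \<subseteq> F" "\<not> neg ` set L \<subseteq> F" by blast
    then show ?thesis
    proof cases
      case 2
      then show ?thesis
        using good[OF circ_neg[OF L]] by simp
    next
      case 3
      then show ?thesis
        unfolding good_minor_def
        by (intro elem_good[OF circ_elem[OF G(1) L] minor_ordered[OF L G(1)]]) (auto simp: fourientation_def)
    qed (use good L in blast)
  qed
  then show ?thesis
    using decomp[OF G] by blast
qed

lemma good_minor_iff:
  assumes G: "ordered_graph G r" "fourientation G F" and L: "circ G L" "set L \<subseteq> F" and \<rho>: "emb \<rho> r (fst ` set L)"
  shows "good_minor P (cm G (fst ` set L)) r F \<longleftrightarrow> \<not> B (enc \<rho> F L)"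
proof -
  let ?K = "cm G (fst ` set L)"
  note K = circ_elem[OF G(1) L(1)]
  have arcs: "arcs ?K = fst ` set L"
    using elem_graph[OF K] by simp
  have "enc \<rho> F L = enc \<rho> (F \<inter> darts ?K) L"
    by (rule enc_cong) (auto simp: darts_def arcs)
  moreover have "B (enc \<rho> (F \<inter> darts ?K) L) \<longleftrightarrow> \<not> P ?K (Restr r (arcs ?K)) (F \<inter> darts ?K)"
    using L(2) \<rho> circ_edges[OF L(1)]
    by (intro B_enc[OF K _ minor_ordered[OF L(1) G(1)]]) (force simp: fourientation_def darts_def arcs emb_def)+
  ultimately show ?thesis
    unfolding good_minor_def by simp
qed

section \<open>Every word occurs, and badness satisfies the axioms\<close>

text \<open>The edges form an infinite type, so the integers embed into it and ranks can serve as
  names of edges; the edge order is carried over from the integers.\<close>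

lemma realize:
  assumes "valid A"
  shows "\<exists>r F L \<rho>. L \<noteq> [] \<and> distinct (map fst L) \<and> linear_order_on (fst ` set L) r \<and> F \<subseteq> fst ` set L \<times> UNIV \<and>
    set L \<subseteq> F \<and> emb \<rho> r (fst ` set L :: 'e set) \<and> A = enc \<rho> F L"
proof -
  obtain f :: "nat \<Rightarrow> 'e" where f: "inj f"
    using infinite_countable_subset[OF infinite_UNIV] by blast
  define \<iota> :: "int \<Rightarrow> 'e" where "\<iota> k = f (to_nat k)" for k
  have "inj \<iota>"
    using f by (simp add: \<iota>_def inj_def inj_eq[OF f])
  then have \<iota>: "\<iota> i = \<iota> j \<longleftrightarrow> i = j" for i j
    by (simp add: inj_eq)
  have inv: "inv \<iota> (\<iota> i) = i" for i
    using \<open>inj \<iota>\<close> by simp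
  define L where "L = map (\<lambda>(k, s, b). (\<iota> k, s)) A"
  define F where "F = {(\<iota> k, t) | k s b t. (k, s, b) \<in> set A \<and> (t = s \<or> \<not> b)}"
  define r where "r = {(\<iota> i, \<iota> j) | i j. i \<le> j \<and> i \<in> fst ` set A \<and> j \<in> fst ` set A}"
  have edges: "map fst L = map \<iota> (map fst A)"
    by (auto simp: L_def)
  then have edges': "fst ` set L = \<iota> ` fst ` set A"
    by (metis list.set_map)
  have A: "A \<noteq> []" "distinct (map fst A)"
    using assms by (auto simp: valid_def)
  have eqb: "b = b'" if "(k, s, b) \<in> set A" "(k, s', b') \<in> set A" for k s b s' b'
    using valid_eqI[OF assms that] by simp
  have eqs: "s = s'" if "(k, s, b) \<in> set A" "(k, s', b') \<in> set A" for k s b s' b'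
    using valid_eqI[OF assms that] by simp
  show ?thesis
  proof (intro exI conjI)
    show "L \<noteq> []"
      using A by (simp add: L_def)
    show "distinct (map fst L)"
      unfolding edges using A(2) \<open>inj \<iota>\<close> by (metis distinct_map inj_on_subset subset_UNIV)
    show "linear_order_on (fst ` set L) r"
      unfolding edges' linear_order_on_def partial_order_on_def preorder_on_def
      by (auto simp: r_def refl_on_def trans_def antisym_def total_on_def \<iota>) force+
    show "F \<subseteq> fst ` set L \<times> UNIV"
      unfolding edges' by (force simp: F_def)
    show "set L \<subseteq> F"
      by (force simp: F_def L_def)
    show "emb (inv \<iota>) r (fst ` set L)"
      unfolding edges' emb_def by (auto simp: r_def inv \<iota>)
    have "(k, s, b) = (inv \<iota> (\<iota> k), s, (\<iota> k, opp s) \<notin> F)" if "(k, s, b) \<in> set A" for k s b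
    proof -
      have "(\<iota> k, opp s) \<in> F \<longleftrightarrow> (\<exists>s' b'. (k, s', b') \<in> set A \<and> (opp s = s' \<or> \<not> b'))"
        by (auto simp: F_def \<iota>)
      also have "\<dots> \<longleftrightarrow> \<not> b"
        using that eqb[OF that] eqs[OF that] by (metis opp_neq(1))
      finally show ?thesis
        by (simp add: inv)
    qed
    then show "A = enc (inv \<iota>) F L"
      unfolding enc_def L_def by (force intro!: map_idI[symmetric] split: prod.splits)
  qed
qed

lemma B_mono:
  assumes "valid A" "strict_mono_on (fst ` set A) h"
  shows "B (map (apfst h) A) = B A"
proof -
  obtain r F L \<rho> where L: "L \<noteq> []" "distinct (map fst L)" and r: "linear_order_on (fst ` set L) r"
    and F: "F \<subseteq> fst ` set L \<times> UNIV" "set L \<subseteq> F" and \<rho>: "emb \<rho> r (fst ` set L :: 'e set)" and A: "A = enc \<rho> F L"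
    using realize[OF assms(1)] by blast
  obtain K where K: "elem K L"
    using elem_ex[OF L] by blast
  note arcs = elem_graph[OF K]
  have F': "fourientation K F"
    using F arcs by (simp add: fourientation_def darts_def)
  have "fst ` set A = \<rho> ` fst ` set L"
    unfolding A by (metis list.set_map map_fst_enc)
  then have "emb (h \<circ> \<rho>) r (fst ` set L)"
    using \<rho> assms(2) unfolding emb_def by (metis comp_apply imageI strict_mono_on_leD strict_mono_on_less_eq)
  moreover have "map (apfst h) A = enc (h \<circ> \<rho>) F L"
    unfolding A enc_def by auto
  ultimately show ?thesis
    using B_enc[OF K L(2) _ F' F(2)] \<rho> r A arcs by auto
qed

lemma valid_enc: "inj_on \<rho> (fst ` set L) \<Longrightarrow> L \<noteq> [] \<Longrightarrow> distinct (map fst L) \<Longrightarrow> valid (enc \<rho> F L)"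
  unfolding valid_def map_fst_enc by (metis distinct_map enc_simps(6) list.set_map)

lemma B_rot:
  assumes "valid A"
  shows "B (rotate1 A) = B A"
proof -
  obtain r F L \<rho> where L: "L \<noteq> []" "distinct (map fst L)" and r: "linear_order_on (fst ` set L) r"
    and F: "F \<subseteq> fst ` set L \<times> UNIV" "set L \<subseteq> F" and \<rho>: "emb \<rho> r (fst ` set L :: 'e set)" and A: "A = enc \<rho> F L"
    using realize[OF assms(1)] by blast
  obtain K where K: "elem K L"
    using elem_ex[OF L] by blast
  note arcs = elem_graph[OF K]
  have F': "fourientation K F"
    using F arcs by (simp add: fourientation_def darts_def)
  have "distinct (map fst (rotate1 L))"
    using L(2) by (simp add: rotate1_map[symmetric])
  then show ?thesis
    using B_enc[OF K L(2) _ F' F(2)] B_enc[OF elem_rot[OF K] _ _ F'] \<rho> r A arcs F by auto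
qed

lemma B_rev_flip:
  assumes "valid A" "\<not> has_o A"
  shows "B (rev (map flip A)) = B A"
proof -
  obtain r F L \<rho> where L: "L \<noteq> []" "distinct (map fst L)" and r: "linear_order_on (fst ` set L) r"
    and F: "F \<subseteq> fst ` set L \<times> UNIV" "set L \<subseteq> F" and \<rho>: "emb \<rho> r (fst ` set L :: 'e set)" and A: "A = enc \<rho> F L"
    using realize[OF assms(1)] by blast
  obtain K where K: "elem K L"
    using elem_ex[OF L] by blast
  note arcs = elem_graph[OF K]
  have F': "fourientation K F"
    using F arcs by (simp add: fourientation_def darts_def)
  have "distinct (map fst (rev (map neg L)))"
    using L(2) by (simp add: rev_map[symmetric] comp_def)
  moreover have neg: "neg ` set L \<subseteq> F"
    using assms(2) unfolding A has_o_enc by simp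
  moreover have "rev (map flip A) = enc \<rho> F (rev (map neg L))"
    unfolding A enc_neg[OF F(2) neg, symmetric] by (simp add: enc_def rev_map)
  ultimately show ?thesis
    using B_enc[OF K L(2) _ F' F(2)] B_enc[OF elem_neg[OF K] _ _ F'] \<rho> r A arcs by auto
qed

text \<open>T2 is applied to the circuit graph whose maximum edge \<open>e\<close> belongs to the
  appended letter; its minor is the circuit graph of \<open>A\<close>. The states of
  \<open>e\<close> translate as follows: absent is always good, both is the bioriented letter,
  \<open>s\<close> is the oriented letter, and \<open>opp s\<close> concerns the reversed
  circuit.\<close>

lemma extend:
  assumes A: "valid A" and n: "\<And>x. x \<in> set A \<Longrightarrow> fst x < n"
  shows "(\<not> has_o A \<longrightarrow> B A \<longrightarrow> B (rev (map flip (A @ [(n, s, True)]))) \<noteq> B (A @ [(n, s, True)])) \<and>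
    (\<not> has_o A \<longrightarrow> \<not> B A \<longrightarrow> \<not> B (A @ [(n, s, True)])) \<and>
    (has_o A \<longrightarrow> B (A @ [(n, s, True)]) = B A) \<and> B (A @ [(n, s, False)]) = B A"
proof -
  have "valid (A @ [(n, s, True)])"
    using A n by (fastforce simp: valid_def)
  then obtain r F' L' \<rho> where L': "L' \<noteq> []" "distinct (map fst L')" and r': "linear_order_on (fst ` set L') r"
    and F': "F' \<subseteq> fst ` set L' \<times> UNIV" "set L' \<subseteq> F'" and \<rho>': "emb \<rho> r (fst ` set L' :: 'e set)"
    and eq: "A @ [(n, s, True)] = enc \<rho> F' L'"
    using realize by blast
  obtain L d where Ld: "L' = L @ [d]"
    using L'(1) by (metis rev_exhaust)
  obtain e where d: "d = (e, s)" and \<rho>e: "\<rho> e = n"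
    using eq unfolding Ld by (cases d) auto
  let ?E = "fst ` set L"
  have e: "e \<notin> ?E" and dL: "distinct (map fst L)"
    using L'(2) unfolding Ld d by auto
  \<comment> \<open>The top edge is emptied. This gives the fourientation of the minor, to which the
    states of \<open>e\<close> are added one by one.\<close>
  define F where "F = F' - {e} \<times> UNIV"
  have F: "F \<subseteq> ?E \<times> UNIV" "set L \<subseteq> F"
    using F' e unfolding Ld d F_def by force+
  have AL: "A = enc \<rho> F' L"
    using eq unfolding Ld d by simp
  also have AF: "\<dots> = enc \<rho> F L"
    using e by (intro enc_cong) (auto simp: F_def)
  finally have AL: "A = enc \<rho> F L" .
  have L: "L \<noteq> []"
    using A AL by (auto simp: valid_def)
  obtain K where K: "elem K (L @ [(e, s)])"
    using elem_ex[OF L'(1,2)] unfolding Ld d by blast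
  let ?H = "minor K e"
  have H: "elem ?H L" "\<not> isthmus K e" "\<not> loop K e"
    using elem_minor[OF K L] L'(2) unfolding Ld d by auto
  have arcs: "arcs K = insert e ?E" "arcs ?H = ?E"
    using elem_graph[OF K] elem_graph[OF H(1)] by auto
  have r: "linear_order_on (arcs K) r" and \<rho>: "emb \<rho> r (arcs K)"
    using r' \<rho>' unfolding Ld d arcs by auto
  have max: "is_max r (arcs K) e"
  proof -
    have "\<rho> f \<le> n" if "f \<in> arcs K" for f
    proof (cases "f = e")
      case False
      then have "\<rho> f \<in> fst ` set A"
        using that unfolding AL arcs by (metis imageI insertE list.set_map map_fst_enc)
      then show ?thesis using n by fastforce
    qed (simp add: \<rho>e)
    then show ?thesis
      using \<rho> arcs unfolding is_max_def emb_def by (simp add: \<rho>e)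
  qed
  have four: "fourientation K (F \<union> S)" if "S \<subseteq> {e} \<times> UNIV" for S
    using F that unfolding fourientation_def darts_def arcs by auto
  have fourH: "fourientation ?H F"
    using F unfolding fourientation_def darts_def arcs by auto
  have dLe: "distinct (map fst (L @ [(e, s)]))"
    using L'(2) unfolding Ld d .
  have rH: "linear_order_on (arcs ?H) (Restr r (arcs ?H))"
    by (rule linear_order_on_Restr[OF r]) (auto simp: arcs)
  have \<rho>H: "emb \<rho> (Restr r (arcs ?H)) (arcs ?H)"
    using \<rho> unfolding emb_def arcs by auto
  have "F \<inter> darts ?H = F"
    using F unfolding darts_def arcs by auto
  then have BH: "good_minor P ?H r F \<longleftrightarrow> \<not> B A"
    using B_enc[OF H(1) dL rH fourH F(2) \<rho>H] unfolding AL good_minor_def by simp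
  have encL: "enc \<rho> (F \<union> S) L = A" if "S \<subseteq> {e} \<times> UNIV" for S
    unfolding AL using that e by (intro enc_cong) auto
  have Fe: "(e, t) \<notin> F" for t
    using F(1) e by auto
  have B_o: "P K r (F \<union> {(e, s)}) \<longleftrightarrow> \<not> B (A @ [(n, s, True)])"
    using B_enc[OF K dLe r four[of "{(e, s)}"] _ \<rho>] encL[of "{(e, s)}"] F(2) Fe \<rho>e by auto
  have B_u: "P K r (F \<union> {(e, Pos), (e, Neg)}) \<longleftrightarrow> \<not> B (A @ [(n, s, False)])"
    using B_enc[OF K dLe r four[of "{(e, Pos), (e, Neg)}"] _ \<rho>] encL[of "{(e, Pos), (e, Neg)}"] F(2) \<rho>e
    by (cases s) auto
  \<comment> \<open>Without darts of \<open>e\<close> no direction of the circuit is potential. This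
    provides the premise of T2(b) that \<open>F\<close> is good for \<open>K\<close>.\<close>
  have good: "P K r F"
    using elem_good[OF K r four[of "{}"]] Fe by auto
  have T: "(good_minor P ?H r F \<longrightarrow> P K r (F \<union> {(e, Pos)}) \<and> P K r (F \<union> {(e, Neg)})) \<and>
        (\<not> good_minor P ?H r F \<longrightarrow> P K r F \<longrightarrow> (\<exists>!\<epsilon>. P K r (F \<union> {(e, \<epsilon>)}))) \<and>
        (good_minor P ?H r F \<longleftrightarrow> P K r (F \<union> {(e, Pos), (e, Neg)}))"
    by (rule T2[OF elem_ordered[OF K r] max H(2,3) fourH])
  have sym: "(P K r (F \<union> {(e, Pos)}) \<noteq> P K r (F \<union> {(e, Neg)})) \<longleftrightarrow>
      (P K r (F \<union> {(e, s)}) \<noteq> P K r (F \<union> {(e, opp s)}))"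
    by (cases s) auto
  have good_s: "good_minor P ?H r F \<longrightarrow> P K r (F \<union> {(e, s)})"
    using T by (cases s) auto
  have excl: "B A \<longrightarrow> P K r (F \<union> {(e, s)}) \<noteq> P K r (F \<union> {(e, opp s)})"
    using T good unfolding BH ex1_sign sym by blast
  \<comment> \<open>No direction is potential here: \<open>e\<close> blocks the listed one, and an
    oriented letter of \<open>A\<close> blocks the reverse.\<close>
  have opp_o: "P K r (F \<union> {(e, opp s)})" if "has_o A"
  proof -
    have "\<not> neg ` set L \<subseteq> F"
      using that unfolding AL has_o_enc by simp
    then have "\<not> neg ` set L \<subseteq> F \<union> {(e, opp s)}"
      using e by force
    then show ?thesis
      using elem_good[OF K r four[of "{(e, opp s)}"]] Fe by auto
  qed
  \<comment> \<open>Now the reversed circuit is potential, and its word is the flipped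
    reversal.\<close>
  have opp_u: "P K r (F \<union> {(e, opp s)}) \<longleftrightarrow> \<not> B (rev (map flip (A @ [(n, s, True)])))" if "\<not> has_o A"
  proof -
    have neg: "neg ` set L \<subseteq> F \<union> {(e, opp s)}"
      using that unfolding AL has_o_enc by auto
    have "enc \<rho> (F \<union> {(e, opp s)}) (map neg L) = map flip A"
      using enc_neg[OF _ neg, of \<rho>] F(2) encL[of "{(e, opp s)}"] by auto
    then have "enc \<rho> (F \<union> {(e, opp s)}) (rev (map neg (L @ [(e, s)]))) = rev (map flip (A @ [(n, s, True)]))"
      using Fe[of s] \<rho>e by simp
    moreover have "distinct (map fst (rev (map neg (L @ [(e, s)]))))"
      using dLe by (simp add: rev_map[symmetric] comp_def)
    ultimately show ?thesis
      using B_enc[OF elem_neg[OF K] _ r four[of "{(e, opp s)}"] _ \<rho>] neg by auto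
  qed
  show ?thesis
    using T BH B_o B_u good_s excl opp_o opp_u by blast
qed

lemma bad_circ:
  assumes "ordered_graph G r" "fourientation G F" "circ G L" "set L \<subseteq> F" "emb \<rho> r (fst ` set L)" "B (enc \<rho> F L)"
  shows "\<not> P G r F"
  using assms good_iff good_minor_iff by blast

text \<open>In the graph from \<open>pair_ex\<close> the new maximum edge \<open>e\<close> lies on
  the circuits \<open>X\<close> with \<open>(e, Pos)\<close> and \<open>Y\<close> with
  \<open>(e, Neg)\<close>, whereas the circuit \<open>X @ Y\<close> avoids it; in the minor,
  \<open>X\<close> and \<open>Y\<close> are separate circuits. Bad words are handled by T2(b), good
  ones by T2(c).\<close>

lemma B_glue:
  assumes A: "valid A" "valid A'" "valid (A @ A')" and o: "has_o A" "has_o A'" and i: "B A = i" "B A' = i"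
  shows "B (A @ A') = i"
proof -
  \<comment> \<open>A rank above all letters of both words, since T2 concerns the maximum edge
    only.\<close>
  define n where "n = Max (fst ` set (A @ A')) + 1"
  have n: "fst x < n" if "x \<in> set (A @ A')" for x
  proof -
    have "fst x \<le> Max (fst ` set (A @ A'))"
      using that by (intro Max_ge) auto
    then show ?thesis unfolding n_def by simp
  qed
  have v: "valid ((A @ A') @ [(n, Pos, True)])"
    using A n by (fastforce simp: valid_def)
  obtain r F' L' \<rho> where L': "L' \<noteq> []" "distinct (map fst L')" and r': "linear_order_on (fst ` set L') r"
    and F': "F' \<subseteq> fst ` set L' \<times> UNIV" "set L' \<subseteq> F'" and \<rho>': "emb \<rho> r (fst ` set L' :: 'e set)"
    and eq: "(A @ A') @ [(n, Pos, True)] = enc \<rho> F' L'"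
    using realize[OF v] by blast
  obtain X Y e where L'_eq: "L' = X @ Y @ [(e, Pos)]" and AX: "A = enc \<rho> F' X" and AY: "A' = enc \<rho> F' Y"
    and \<rho>e: "\<rho> e = n"
  proof -
    obtain L Z where LZ: "L' = L @ Z" "A @ A' = enc \<rho> F' L" "[(n, Pos, True)] = enc \<rho> F' Z"
      using append_eq_enc[OF eq] by blast
    moreover obtain e where "Z = [(e, Pos)]" "\<rho> e = n"
      using LZ(3)[symmetric] by (cases Z) (auto split: prod.splits)
    moreover obtain X Y where "L = X @ Y" "A = enc \<rho> F' X" "A' = enc \<rho> F' Y"
      using append_eq_enc[OF LZ(2)] by blast
    ultimately show thesis
      using that[of X Y e] by simp
  qed
  have ne: "X \<noteq> []" "Y \<noteq> []"
    using A AX AY by (auto simp: valid_def)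
  obtain G where G: "fin_digraph G" "connected G" and arcs: "arcs G = fst ` set (X @ Y @ [(e, Pos)])"
    and il: "\<not> isthmus G e" "\<not> loop G e"
    and circ: "circ G (X @ [(e, Pos)])" "circ G (Y @ [(e, Neg)])" "circ G (X @ Y)"
    and circs: "\<And>M. circ G M \<Longrightarrow> e \<in> fst ` set M \<or> set M = set (X @ Y) \<or> set M = neg ` set (X @ Y)"
    and H: "fin_digraph (minor G e)" "connected (minor G e)" and arcsH: "arcs (minor G e) = fst ` set (X @ Y)"
    and circH: "circ (minor G e) X" "circ (minor G e) Y"
    and circsH: "\<And>M. circ (minor G e) M \<Longrightarrow> set M \<in> {set X, neg ` set X, set Y, neg ` set Y}"
    using pair_ex[OF ne L'(2)[unfolded L'_eq]] by (elim exE conjE) blast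
  let ?H = "minor G e" and ?E = "fst ` set (X @ Y)"
  have e: "e \<notin> ?E"
    using L'(2) unfolding L'_eq by auto
  define F where "F = F' - {e} \<times> UNIV"
  have F: "F \<subseteq> ?E \<times> UNIV" "set X \<subseteq> F" "set Y \<subseteq> F"
    using F' e unfolding L'_eq F_def by force+
  have enc: "enc \<rho> (F \<union> S) X = A" "enc \<rho> (F \<union> S) Y = A'" if "S \<subseteq> {e} \<times> UNIV" for S
    unfolding AX AY using that e by (auto intro!: enc_cong simp: F_def)
  have Fe: "(e, t) \<notin> F" for t
    using F(1) e by auto
  have r: "linear_order_on (arcs G) r" and \<rho>: "emb \<rho> r (arcs G)"
    using r' \<rho>' unfolding L'_eq arcs by auto
  have max: "is_max r (arcs G) e"
  proof -
    have "\<rho> f \<le> n" if "f \<in> arcs G" for f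
    proof (cases "f = e")
      case False
      then have "f \<in> fst ` set (X @ Y)"
        using that unfolding arcs by auto
      moreover have "map fst (A @ A') = map \<rho> (map fst (X @ Y))"
        unfolding AX AY map_append map_fst_enc by simp
      ultimately have "\<rho> f \<in> fst ` set (A @ A')"
        by (metis imageI list.set_map)
      then show ?thesis using n by fastforce
    qed (simp add: \<rho>e)
    then show ?thesis
      using \<rho> arcs unfolding is_max_def emb_def by (simp add: \<rho>e)
  qed
  have ord: "ordered_graph G r" "ordered_graph ?H (Restr r (arcs ?H))"
    using G H r linear_order_on_Restr[OF r, of "arcs ?H"] unfolding ordered_graph_def arcs arcsH by auto
  have four: "fourientation G (F \<union> S)" if "S \<subseteq> {e} \<times> UNIV" for S
    using F that unfolding fourientation_def darts_def arcs by auto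
  have fourH: "fourientation ?H F"
    using F unfolding fourientation_def darts_def arcsH by auto
  have embE: "emb \<rho> r (fst ` set M)" if "circ G M" for M
    using emb_subset[OF \<rho>] circ_edges[OF that] by blast
  have embH: "emb \<rho> (Restr r (arcs ?H)) (fst ` set M)" if "circ ?H M" for M
  proof (rule emb_Restr)
    show "fst ` set M \<subseteq> arcs ?H"
      using circ_edges[OF that] by blast
    then show "emb \<rho> r (fst ` set M)"
      by (intro emb_subset[OF \<rho>]) (auto simp: arcs arcsH)
  qed
  have enc0: "enc \<rho> F X = A" "enc \<rho> F Y = A'"
    using enc[of "{}"] by auto
  have notneg: "\<not> neg ` set X \<subseteq> F" "\<not> neg ` set Y \<subseteq> F"
    using o unfolding enc0[symmetric] has_o_enc .
  have "F \<inter> darts ?H = F"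
    using F unfolding darts_def arcsH by auto
  then have PH: "good_minor P ?H r F \<longleftrightarrow> P ?H (Restr r (arcs ?H)) F"
    unfolding good_minor_def by simp
  have H_good: "good_minor P ?H r F" if "\<not> B A" "\<not> B A'"
    unfolding PH good_iff[OF ord(2) fourH]
  proof (intro allI impI)
    fix M assume M: "circ ?H M" "set M \<subseteq> F"
    then have "set M = set X \<or> set M = set Y"
      using circsH notneg by blast
    then show "good_minor P (cm ?H (fst ` set M)) (Restr r (arcs ?H)) F"
      using good_minor_iff[OF ord(2) fourH circH(1) F(2) embH[OF circH(1)]]
        good_minor_iff[OF ord(2) fourH circH(2) F(3) embH[OF circH(2)]] that enc0 by auto
  qed
  have H_bad: "\<not> good_minor P ?H r F" if "B A" "B A'"
    unfolding PH using bad_circ[OF ord(2) fourH circH(1) F(2) embH[OF circH(1)]] that enc0 by simp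
  have G_bad: "\<not> P G r (F \<union> S)" if "S \<subseteq> {e} \<times> UNIV" "B (A @ A')" for S
    using bad_circ[OF ord(1) four[OF that(1)] circ(3) _ embE[OF circ(3)]] that enc[OF that(1)] F by auto
  \<comment> \<open>Without darts of \<open>e\<close> the circuits through \<open>e\<close> drop
    out, and oriented letters exclude the reverse of \<open>X @ Y\<close>. So \<open>X @ Y\<close>
    alone decides.\<close>
  have G_good: "P G r F" if "\<not> B (A @ A')"
  proof -
    have four0: "fourientation G F"
      using four[of "{}"] by simp
    show ?thesis
      unfolding good_iff[OF ord(1) four0]
    proof (intro allI impI)
      fix M assume M: "circ G M" "set M \<subseteq> F"
      then have "e \<notin> fst ` set M"
        using Fe by auto
      moreover have "set M \<noteq> neg ` set (X @ Y)"
        using notneg M by auto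
      ultimately have "set M = set (X @ Y)"
        using circs[OF M(1)] by blast
      then show "good_minor P (cm G (fst ` set M)) r F"
        using good_minor_iff[OF ord(1) four0 circ(3) _ embE[OF circ(3)]] that enc0 F by auto
    qed
  qed
  \<comment> \<open>\<open>A\<close> and \<open>A'\<close> have oriented letters, so appending the
    top letter \<open>e\<close> with any sign preserves their badness.\<close>
  have bad_s: "\<not> P G r (F \<union> {(e, Pos)})" "\<not> P G r (F \<union> {(e, Neg)})" if "B A" "B A'"
  proof -
    have "B (A @ [(n, Pos, True)])" "B (A' @ [(n, Neg, True)])"
      using extend[OF A(1), of n Pos] extend[OF A(2), of n Neg] n o that by auto
    then show "\<not> P G r (F \<union> {(e, Pos)})" "\<not> P G r (F \<union> {(e, Neg)})"
      using bad_circ[OF ord(1) four circ(1) _ embE[OF circ(1)], of "{(e, Pos)}"]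
        bad_circ[OF ord(1) four circ(2) _ embE[OF circ(2)], of "{(e, Neg)}"]
        enc[of "{(e, Pos)}"] enc[of "{(e, Neg)}"] Fe \<rho>e F by auto
  qed
  have T: "(good_minor P ?H r F \<longrightarrow> P G r (F \<union> {(e, Pos)}) \<and> P G r (F \<union> {(e, Neg)})) \<and>
        (\<not> good_minor P ?H r F \<longrightarrow> P G r F \<longrightarrow> (\<exists>!\<epsilon>. P G r (F \<union> {(e, \<epsilon>)}))) \<and>
        (good_minor P ?H r F \<longleftrightarrow> P G r (F \<union> {(e, Pos), (e, Neg)}))"
    by (rule T2[OF ord(1) max il fourH])
  show ?thesis
  proof (cases i)
    \<comment> \<open>Both orientations of \<open>e\<close> are bad, so exactly one being good
      fails, and T2(b) forces \<open>F\<close> itself to be bad.\<close>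
    case True
    then have "\<not> P G r F"
      using T H_bad bad_s i unfolding ex1_sign by blast
    then show ?thesis
      using G_good True by blast
  next
    \<comment> \<open>The minor is good, so by T2(c) biorienting \<open>e\<close> gives a good
      fourientation. \<open>X @ Y\<close> is potential in it and must therefore be good.\<close>
    case False
    then have "P G r (F \<union> {(e, Pos), (e, Neg)})"
      using T H_good i by blast
    then show ?thesis
      using G_bad[of "{(e, Pos), (e, Neg)}"] False by auto
  qed
qed

lemma word_core: "word_core B"
proof (rule word_core.intro, goal_cases)
  case (1 A h)
  then show ?case by (rule B_mono)
next
  case (2 A)
  then show ?case by (rule B_rot)
next
  case (3 A)
  then show ?case by (rule B_rev_flip)
next
  case (4 A n s b)
  then show ?case using extend[OF 4(1,2), of s] by (cases b) simp_all
next
  case (5 A n s)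
  then show ?case using extend[OF 5(1,2), of s] by simp
next
  case (6 A n s)
  then show ?case using extend[OF 6(1,2), of s] by simp
next
  case (7 A n s)
  then show ?case using extend[OF 7(1,2), of s] by simp
next
  case (8 A A' i)
  then show ?case by (rule B_glue)
qed

section \<open>From words back to potential cuts and cycles\<close>

lemma good_iff_enc:
  assumes G: "ordered_graph G r" "fourientation G F" and \<rho>: "emb \<rho> r (arcs G)"
  shows "P G r F \<longleftrightarrow> (\<forall>L. circ G L \<longrightarrow> set L \<subseteq> F \<longrightarrow> \<not> B (enc \<rho> F L))"
proof -
  have "good_minor P (cm G (fst ` set L)) r F \<longleftrightarrow> \<not> B (enc \<rho> F L)" if "circ G L" "set L \<subseteq> F" for L
    using that circ_edges[OF that(1)] by (intro good_minor_iff[OF G] emb_subset[OF \<rho>]) auto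
  then show ?thesis
    unfolding good_iff[OF G] by blast
qed

lemma signs_eq:
  assumes "set L \<subseteq> F" "(e, s) \<in> set L"
  shows "signs F e = (if (e, opp s) \<in> F then {Neg, Pos} else {s})"
proof (rule set_eqI)
  fix t
  have "(e, s) \<in> F"
    using assms by blast
  then show "t \<in> signs F e \<longleftrightarrow> t \<in> (if (e, opp s) \<in> F then {Neg, Pos} else {s})"
    by (cases s; cases t) (auto simp: signs_def)
qed

lemma min_bad_circ:
  assumes L: "circ G L" "set L \<subseteq> F" and \<rho>: "emb \<rho> r (fst ` set L)" and X: "X \<subseteq> {{Neg}, {Pos}, {Neg, Pos}}"
  shows "min_bad X \<delta> r F (set L) \<longleftrightarrow> (\<exists>k s. least (enc \<rho> F L) (k, s, True) \<and> {s} \<in> X) \<or>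
    ({Neg, Pos} \<in> X \<and> (\<exists>k. least (enc \<rho> F L) (k, \<delta>, False)))"
proof -
  have "(signs F e \<in> X \<and> (bioriented F e \<longrightarrow> (e, \<delta>) \<in> set L)) \<longleftrightarrow>
    (\<exists>s. (e, s) \<in> set L \<and> (e, opp s) \<notin> F \<and> {s} \<in> X) \<or> ({Neg, Pos} \<in> X \<and> (e, \<delta>) \<in> set L \<and> (e, opp \<delta>) \<in> F)"
    if e: "e \<in> fst ` set L" for e
  proof -
    obtain s where s: "(e, s) \<in> set L"
      using e by auto
    have uniq: "(e, t) \<in> set L \<longleftrightarrow> t = s" for t
      using circ_edges[OF L(1)] s unfolding distinct_map by (metis fst_conv inj_onD prod.inject)
    have "bioriented F e \<longleftrightarrow> (e, opp s) \<in> F"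
      using s L(2) unfolding bioriented_def by (cases s) auto
    then show ?thesis
      unfolding signs_eq[OF L(2) s] uniq by auto
  qed
  then have "min_bad X \<delta> r F (set L) \<longleftrightarrow> (\<exists>e. is_min r (fst ` set L) e \<and>
    ((\<exists>s. (e, s) \<in> set L \<and> (e, opp s) \<notin> F \<and> {s} \<in> X) \<or> ({Neg, Pos} \<in> X \<and> (e, \<delta>) \<in> set L \<and> (e, opp \<delta>) \<in> F)))"
    unfolding min_bad_def is_min_def by metis
  then show ?thesis
    unfolding least_enc[OF \<rho>] by auto
qed

text \<open>A circuit inside \<open>D\<close> through a dart of the minimum edge of \<open>D\<close>
  has the same minimum edge. If that edge is bioriented, the dart of sign \<open>\<delta>\<close> is
  the one to pass through.\<close>

lemma min_bad_Pot:
  assumes G: "ordered_graph G r" and D: "D \<in> Pot G" "D \<subseteq> F" "min_bad X \<delta> r F D"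
  shows "\<exists>L. circ G L \<and> set L \<subseteq> F \<and> min_bad X \<delta> r F (set L)"
proof -
  obtain e where e: "is_min r (fst ` D) e" "signs F e \<in> X" "bioriented F e \<longrightarrow> (e, \<delta>) \<in> D"
    using D(3) unfolding min_bad_def by blast
  then obtain s where s: "(e, s) \<in> D" "bioriented F e \<longrightarrow> s = \<delta>"
    by (auto simp: is_min_def)
  obtain L where L: "circ G L" "(e, s) \<in> set L" "set L \<subseteq> D"
    using Pot_circ_sub[OF G D(1) s(1)] by blast
  have "is_min r (fst ` set L) e"
    using e(1) L(2,3) unfolding is_min_def by force
  moreover have "bioriented F e \<longrightarrow> (e, \<delta>) \<in> set L"
    using s(2) L(2) by blast
  ultimately have "min_bad X \<delta> r F (set L)"
    using e(2) unfolding min_bad_def by blast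
  then show ?thesis
    using D(2) L by blast
qed

text \<open>If \<open>D\<close> has a minimum oriented edge, a circuit through it inherits this edge
  together with its wrong orientation. Otherwise no edge of \<open>D\<close> is oriented, and any
  circuit inside \<open>D\<close> violates the condition.\<close>

lemma min_oriented_Pot:
  assumes G: "ordered_graph G r" and D: "D \<in> Pot G" "D \<subseteq> F" "\<not> min_oriented r F (fst ` D) \<delta>"
  shows "\<exists>L. circ G L \<and> set L \<subseteq> F \<and> \<not> min_oriented r F (fst ` set L) \<delta>"
proof (cases "\<exists>e. is_min r {e \<in> fst ` D. oriented F e} e")
  case True
  then obtain e where e: "is_min r {e \<in> fst ` D. oriented F e} e" by blast
  then obtain s where s: "(e, s) \<in> D"
    by (auto simp: is_min_def)
  obtain L where L: "circ G L" "(e, s) \<in> set L" "set L \<subseteq> D"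
    using Pot_circ_sub[OF G D(1) s(1)] by blast
  have min: "is_min r {e \<in> fst ` set L. oriented F e} e"
    using e L unfolding is_min_def by force
  have anti: "antisym r"
    using G by (simp add: ordered_graph_def linear_order_on_def partial_order_on_def)
  have "(e, \<delta>) \<notin> F"
    using D(3) e unfolding min_oriented_def by blast
  moreover have "e' = e" if "is_min r {e \<in> fst ` set L. oriented F e} e'" for e'
    using min that antisymD[OF anti] unfolding is_min_def by blast
  ultimately have "\<not> min_oriented r F (fst ` set L) \<delta>"
    unfolding min_oriented_def by blast
  then show ?thesis
    using L D(2) by blast
next
  case False
  obtain d where d: "d \<in> D"
    using Pot_nonempty[OF G D(1)] by blast
  have none: "\<not> oriented F e" if "e \<in> fst ` D" for e
  proof
    assume o: "oriented F e"
    let ?S = "{e \<in> fst ` D. oriented F e}"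
    have sub: "?S \<subseteq> arcs G"
    proof
      fix f assume "f \<in> ?S"
      then obtain d where "d \<in> D" "f = fst d" by blast
      then show "f \<in> arcs G"
        using Pot_circ_sub[OF G D(1)] circ_edges by blast
    qed
    have fin: "finite (arcs G)" and r: "linear_order_on (arcs G) r"
      using G by (auto simp: ordered_graph_def fin_digraph.finite_arcs)
    obtain \<rho> where \<rho>: "emb \<rho> r (arcs G)"
      using ex_emb[OF r fin] by blast
    have "finite ?S" "?S \<noteq> {}"
      using finite_subset[OF sub fin] that o by auto
    then have "Min (\<rho> ` ?S) \<in> \<rho> ` ?S"
      by (intro Min_in) auto
    then obtain m where m: "m \<in> ?S" "\<rho> m = Min (\<rho> ` ?S)"
      by (metis (no_types, lifting) imageE)
    have "(m, f) \<in> r" if "f \<in> ?S" for f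
    proof -
      have "\<rho> m \<le> \<rho> f"
        unfolding m(2) using that \<open>finite ?S\<close> by (intro Min_le) auto
      then show ?thesis
        using \<rho> m(1) that sub unfolding emb_def by blast
    qed
    then show False
      using m(1) False unfolding is_min_def by blast
  qed
  obtain L where L: "circ G L" "set L \<subseteq> D"
    using Pot_circ_sub[OF G D(1) d] by blast
  then have "\<not> min_oriented r F (fst ` set L) \<delta>"
    using none unfolding min_oriented_def is_min_def by blast
  then show ?thesis
    using L D(2) by blast
qed

lemma good_Pot_iff:
  assumes "ordered_graph G r"
  shows "(\<forall>D\<in>Pot G. D \<subseteq> F \<longrightarrow> \<not> min_bad X \<delta> r F D) \<longleftrightarrow>
      (\<forall>L. circ G L \<longrightarrow> set L \<subseteq> F \<longrightarrow> \<not> min_bad X \<delta> r F (set L))"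
    and "(\<forall>D\<in>Pot G. D \<subseteq> F \<longrightarrow> min_oriented r F (fst ` D) \<delta>) \<longleftrightarrow>
      (\<forall>L. circ G L \<longrightarrow> set L \<subseteq> F \<longrightarrow> min_oriented r F (fst ` set L) \<delta>)"
proof -
  show "(\<forall>D\<in>Pot G. D \<subseteq> F \<longrightarrow> \<not> min_bad X \<delta> r F D) \<longleftrightarrow>
      (\<forall>L. circ G L \<longrightarrow> set L \<subseteq> F \<longrightarrow> \<not> min_bad X \<delta> r F (set L))"
  proof (intro iffI ballI allI impI notI)
    fix D assume "\<forall>L. circ G L \<longrightarrow> set L \<subseteq> F \<longrightarrow> \<not> min_bad X \<delta> r F (set L)"
      and "D \<in> Pot G" "D \<subseteq> F" "min_bad X \<delta> r F D"
    then show False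
      using min_bad_Pot[OF assms, of D F X \<delta>] by blast
  qed (use Pot_circ in blast)
  show "(\<forall>D\<in>Pot G. D \<subseteq> F \<longrightarrow> min_oriented r F (fst ` D) \<delta>) \<longleftrightarrow>
      (\<forall>L. circ G L \<longrightarrow> set L \<subseteq> F \<longrightarrow> min_oriented r F (fst ` set L) \<delta>)"
  proof (intro iffI ballI allI impI)
    fix D assume "\<forall>L. circ G L \<longrightarrow> set L \<subseteq> F \<longrightarrow> min_oriented r F (fst ` set L) \<delta>"
      and "D \<in> Pot G" "D \<subseteq> F"
    then show "min_oriented r F (fst ` D) \<delta>"
      using min_oriented_Pot[OF assms, of D F \<delta>] by blast
  qed (use Pot_circ in blast)
qed

text \<open>
  If all darts of a circuit are bioriented, the circuit and its reverse are both potential, and for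
  every \<open>\<delta>\<close> exactly one of them contains the dart of sign \<open>\<delta>\<close> of the minimum edge.
\<close>

lemma all_bi_min_bad:
  assumes G: "ordered_graph G r" and L: "circ G L" "set L \<subseteq> F" "neg ` set L \<subseteq> F" and X: "{Neg, Pos} \<in> X"
    and \<rho>: "emb \<rho> r (arcs G)"
  shows "\<exists>L. circ G L \<and> set L \<subseteq> F \<and> min_bad X \<delta> r F (set L)"
proof -
  have "enc \<rho> F L \<noteq> []"
    using circ_edges[OF L(1)] by simp
  then obtain k s b where "least (enc \<rho> F L) (k, s, b)"
    using ex_least by (metis prod_cases3)
  moreover have "emb \<rho> r (fst ` set L)"
    using circ_edges[OF L(1)] by (intro emb_subset[OF \<rho>]) auto
  ultimately obtain e where e: "(e, s) \<in> set L" "is_min r (fst ` set L) e"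
    by (auto simp: least_enc)
  have "(e, opp s) \<in> neg ` set L"
    using e(1) by force
  then have bi: "signs F e = {Neg, Pos}"
    using signs_eq[OF L(2) e(1)] L(3) by auto
  show ?thesis
  proof (cases "s = \<delta>")
    case True
    then show ?thesis
      using L e X bi unfolding min_bad_def by (intro exI[of _ L]) auto
  next
    case False
    then have "(e, \<delta>) \<in> set (rev (map neg L))"
      using \<open>(e, opp s) \<in> neg ` set L\<close> neq_iff_opp[of \<delta> s] by auto
    moreover have "is_min r (fst ` set (rev (map neg L))) e"
      using e(2) by simp
    ultimately show ?thesis
      using circ_neg[OF L(1)] L(3) X bi unfolding min_bad_def by (intro exI[of _ "rev (map neg L)"]) auto
  qed
qed

theorem classification:
  "(\<exists>X \<delta>. X \<subseteq> {{Neg}, {Pos}, {Neg, Pos}} \<and> (\<forall>G r F. ordered_graph G r \<longrightarrow> fourientation G F \<longrightarrow>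
      (P G r F \<longleftrightarrow> (\<forall>D\<in>Pot G. D \<subseteq> F \<longrightarrow> \<not> min_bad X \<delta> r F D)))) \<or>
   (\<exists>\<delta>. \<forall>G r F. ordered_graph G r \<longrightarrow> fourientation G F \<longrightarrow>
      (P G r F \<longleftrightarrow> (\<forall>D\<in>Pot G. D \<subseteq> F \<longrightarrow> min_oriented r F (fst ` D) \<delta>)))"
proof -
  have facts: "\<exists>\<rho>. emb \<rho> r (arcs G)" if "ordered_graph G r" for G r
    using that ex_emb fin_digraph.finite_arcs unfolding ordered_graph_def by blast
  have circ_valid: "valid (enc \<rho> F L)" "emb \<rho> r (fst ` set L)"
    if "ordered_graph G r" "circ G L" "emb \<rho> r (arcs G)" for G r L F and \<rho> :: "'e \<Rightarrow> int"
  proof -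
    note c = circ_edges[OF that(2)]
    show "emb \<rho> r (fst ` set L)"
      using emb_subset[OF that(3)] c by blast
    have "inj_on \<rho> (arcs G)"
      using emb_inj[OF that(3)] that(1) by (simp add: ordered_graph_def)
    then show "valid (enc \<rho> F L)"
      using c by (intro valid_enc) (auto intro: inj_on_subset)
  qed
  consider (1) Y where "\<And>A. valid A \<Longrightarrow> B A = (\<exists>k s. least A (k, s, True) \<and> s \<in> Y)"
    | (2) Y \<delta> where "\<And>A. valid A \<Longrightarrow>
       B A = (\<not> has_o A \<or> (\<exists>k s. least A (k, s, True) \<and> s \<in> Y) \<or> (\<exists>k. least A (k, \<delta>, False)))"
    | (3) \<delta> where "\<And>A. valid A \<Longrightarrow>
       B A = (\<not> has_o A \<or> (\<exists>k. least (filter (\<lambda>x. snd (snd x)) A) (k, \<delta>, True)))"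
    using word_core.classification[OF word_core] by blast
  then show ?thesis
  proof cases
    case 1
    define X where "X = (\<lambda>s. {s}) ` Y"
    have X: "X \<subseteq> {{Neg}, {Pos}, {Neg, Pos}}" "{Neg, Pos} \<notin> X" "\<And>s. {s} \<in> X \<longleftrightarrow> s \<in> Y"
      unfolding X_def using sign.exhaust by (auto simp: doubleton_eq_iff)
    \<comment> \<open>\<open>Pos\<close> is a default value: no member of \<open>X\<close> describes
      a bioriented edge, so the clause about the sign is never invoked.\<close>
    have "P G r F \<longleftrightarrow> (\<forall>D\<in>Pot G. D \<subseteq> F \<longrightarrow> \<not> min_bad X Pos r F D)"
      if G: "ordered_graph G r" "fourientation G F" for G r F
    proof -
      obtain \<rho> where \<rho>: "emb \<rho> r (arcs G)"
        using facts[OF G(1)] by blast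
      show ?thesis
        unfolding good_Pot_iff(1)[OF G(1)] good_iff_enc[OF G \<rho>]
        using 1[OF circ_valid(1)[OF G(1) _ \<rho>]] min_bad_circ[OF _ _ circ_valid(2)[OF G(1) _ \<rho>] X(1)] X(2,3)
        by auto
    qed
    then show ?thesis
      using X(1) by blast
  next
    case 2
    define X where "X = insert {Neg, Pos} ((\<lambda>s. {s}) ` Y)"
    have X: "X \<subseteq> {{Neg}, {Pos}, {Neg, Pos}}" "{Neg, Pos} \<in> X" "\<And>s. {s} \<in> X \<longleftrightarrow> s \<in> Y"
      unfolding X_def using sign.exhaust by (auto simp: doubleton_eq_iff)
    have "P G r F \<longleftrightarrow> (\<forall>D\<in>Pot G. D \<subseteq> F \<longrightarrow> \<not> min_bad X \<delta> r F D)"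
      if G: "ordered_graph G r" "fourientation G F" for G r F
    proof -
      obtain \<rho> where \<rho>: "emb \<rho> r (arcs G)"
        using facts[OF G(1)] by blast
      \<comment> \<open>A circuit of bioriented edges is bad as a word even if
        \<open>min_bad\<close> holds only for its reversal. The two conditions agree once all
        circuits of \<open>G\<close> are considered, by \<open>all_bi_min_bad\<close>.\<close>
      have B: "B (enc \<rho> F L) \<longleftrightarrow> neg ` set L \<subseteq> F \<or> min_bad X \<delta> r F (set L)" if L: "circ G L" "set L \<subseteq> F" for L
        unfolding 2[OF circ_valid(1)[OF G(1) L(1) \<rho>]] min_bad_circ[OF L circ_valid(2)[OF G(1) L(1) \<rho>] X(1)] has_o_enc
        using X(2,3) by auto
      show ?thesis
        unfolding good_Pot_iff(1)[OF G(1)] good_iff_enc[OF G \<rho>]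
      proof (intro iffI allI impI)
        fix L assume L: "circ G L" "set L \<subseteq> F"
          and good: "\<forall>L. circ G L \<longrightarrow> set L \<subseteq> F \<longrightarrow> \<not> min_bad X \<delta> r F (set L)"
        have "\<not> neg ` set L \<subseteq> F"
          using all_bi_min_bad[OF G(1) L _ X(2) \<rho>, of \<delta>] good by blast
        then show "\<not> B (enc \<rho> F L)"
          using B[OF L] good L by simp
      qed (simp add: B)
    qed
    then show ?thesis
      using X(1) by blast
  next
    case 3
    \<comment> \<open>The classification of words names the bad sign of the least oriented letter,
      \<open>min_oriented\<close> the good one; hence \<open>opp \<delta>\<close>.\<close>
    have "P G r F \<longleftrightarrow> (\<forall>D\<in>Pot G. D \<subseteq> F \<longrightarrow> min_oriented r F (fst ` D) (opp \<delta>))"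
      if G: "ordered_graph G r" "fourientation G F" for G r F
    proof -
      obtain \<rho> where \<rho>: "emb \<rho> r (arcs G)"
        using facts[OF G(1)] by blast
      have "B (enc \<rho> F L) \<longleftrightarrow> \<not> min_oriented r F (fst ` set L) (opp \<delta>)" if L: "circ G L" "set L \<subseteq> F" for L
      proof -
        have mo: "(\<exists>k. least (filter (\<lambda>x. snd (snd x)) (enc \<rho> F L)) (k, s, True)) \<longleftrightarrow> min_oriented r F (fst ` set L) s" for s
          using circ_valid(2)[OF G(1) L(1) \<rho>] L(2) circ_edges[OF L(1)] by (intro least_oriented_enc) auto
        have v: "valid (filter (\<lambda>x. snd (snd x)) (enc \<rho> F L))" if "has_o (enc \<rho> F L)"
          using that circ_valid(1)[OF G(1) L(1) \<rho>, of F]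
          by (auto simp: valid_def distinct_map_filter has_o_def filter_empty_conv)
        have "(\<exists>k. least (filter (\<lambda>x. snd (snd x)) (enc \<rho> F L)) (k, opp \<delta>, True)) \<longleftrightarrow>
            has_o (enc \<rho> F L) \<and> \<not> (\<exists>k. least (filter (\<lambda>x. snd (snd x)) (enc \<rho> F L)) (k, \<delta>, True))"
        proof (cases "has_o (enc \<rho> F L)")
          case True
          obtain x where x: "least (filter (\<lambda>x. snd (snd x)) (enc \<rho> F L)) x"
            using ex_least v[OF True] unfolding valid_def by blast
          obtain k s where xs: "x = (k, s, True)"
            using x by (cases x) (auto simp: least_def)
          have "y = x" if "least (filter (\<lambda>x. snd (snd x)) (enc \<rho> F L)) y" for y
            using that x valid_eqI[OF v[OF True]] unfolding least_def by (meson order_antisym)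
          then have "t = s" if "least (filter (\<lambda>x. snd (snd x)) (enc \<rho> F L)) (k', t, True)" for k' t
            using that xs by blast
          then have ex: "(\<exists>k. least (filter (\<lambda>x. snd (snd x)) (enc \<rho> F L)) (k, t, True)) \<longleftrightarrow> t = s" for t
            using x unfolding xs by metis
          show ?thesis
            unfolding ex using True by (cases s; cases \<delta>) auto
        next
          case False
          then show ?thesis
            by (auto simp: least_def has_o_def)
        qed
        then show ?thesis
          unfolding 3[OF circ_valid(1)[OF G(1) L(1) \<rho>]] mo by blast
      qed
      then show ?thesis
        unfolding good_Pot_iff(2)[OF G(1)] good_iff_enc[OF G \<rho>] by blast
    qed
    then show ?thesis by blast
  qed
qed

end

section \<open>Connectedness\<close>

lemma source_neg [simp]: "source G (neg d) = target G d" and target_neg [simp]: "target G (neg d) = source G d"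
  by (cases d; cases "snd d"; simp)+

lemma darts_neg [simp]: "neg d \<in> darts G \<longleftrightarrow> d \<in> darts G"
  by (cases d) (simp add: darts_def)

declare neg.simps [simp del]

section \<open>Components as closed vertex sets\<close>

text \<open>Within the vertex set these are the unions of components. Reachability and connectedness
  are expressed by them, so that walks in the symmetrized graph need not be handled.\<close>

definition arc_closed :: "('v, 'e) pre_digraph \<Rightarrow> 'v set \<Rightarrow> bool" where
  "arc_closed G S \<longleftrightarrow> (\<forall>e\<in>arcs G. tail G e \<in> S \<longleftrightarrow> head G e \<in> S)"

lemma arc_closed_dart: "arc_closed G S \<Longrightarrow> d \<in> darts G \<Longrightarrow> source G d \<in> S \<longleftrightarrow> target G d \<in> S"
  by (cases d; cases "snd d") (auto simp: arc_closed_def darts_def)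

text \<open>The vertices reachable from \<open>v\<close> form a closed set, and by induction along a
  walk every closed set around \<open>v\<close> contains them.\<close>

lemma reachable_mk_symmetric_iff:
  assumes "wf_digraph K" "v \<in> verts K"
  shows "v \<rightarrow>\<^sup>*\<^bsub>with_proj (mk_symmetric K)\<^esub> w \<longleftrightarrow> w \<in> verts K \<and> (\<forall>S. v \<in> S \<longrightarrow> arc_closed K S \<longrightarrow> w \<in> S)"
proof -
  let ?r = "arcs_ends (with_proj (mk_symmetric K))"
  have ends: "(x, y) \<in> ?r \<longleftrightarrow> (\<exists>e\<in>arcs K. (x, y) = (tail K e, head K e) \<or> (x, y) = (head K e, tail K e))" for x y
    by (auto simp: arcs_ends_conv mk_symmetric_def)
  have verts: "verts (with_proj (mk_symmetric K)) = verts K"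
    by (simp add: mk_symmetric_def)
  interpret wf_digraph K by (fact assms(1))
  show ?thesis
  proof
    assume "v \<rightarrow>\<^sup>*\<^bsub>with_proj (mk_symmetric K)\<^esub> w"
    then have "(v, w) \<in> rtrancl_on (verts K) ?r"
      by (simp add: reachable_def verts)
    then show "w \<in> verts K \<and> (\<forall>S. v \<in> S \<longrightarrow> arc_closed K S \<longrightarrow> w \<in> S)"
      by induction (use assms(2) ends in \<open>auto simp: arc_closed_def\<close>)
  next
    assume w: "w \<in> verts K \<and> (\<forall>S. v \<in> S \<longrightarrow> arc_closed K S \<longrightarrow> w \<in> S)"
    let ?S = "{w. (v, w) \<in> rtrancl_on (verts K) ?r}"
    have step: "y \<in> ?S" if "x \<in> ?S" "(x, y) \<in> ?r" for x y
    proof -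
      have "y \<in> verts K"
        using that(2)[unfolded ends] by auto
      then show ?thesis
        using that by (blast intro: rtrancl_on_into_rtrancl_on)
    qed
    have "arc_closed K ?S"
      unfolding arc_closed_def
    proof
      fix e assume "e \<in> arcs K"
      then have "(tail K e, head K e) \<in> ?r" "(head K e, tail K e) \<in> ?r"
        unfolding ends by blast+
      then show "tail K e \<in> ?S \<longleftrightarrow> head K e \<in> ?S"
        using step by blast
    qed
    then show "v \<rightarrow>\<^sup>*\<^bsub>with_proj (mk_symmetric K)\<^esub> w"
    proof -
      have "v \<in> ?S"
        using assms(2) by simp
      then have "w \<in> ?S"
        using w[THEN conjunct2, rule_format, of ?S] \<open>arc_closed K ?S\<close> by simp
      then show ?thesis
        by (simp add: reachable_def verts)
    qed
  qed
qed

lemma connected_iff: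
  assumes "wf_digraph K"
  shows "connected K \<longleftrightarrow> verts K \<noteq> {} \<and> (\<forall>S v. v \<in> S \<longrightarrow> v \<in> verts K \<longrightarrow> arc_closed K S \<longrightarrow> verts K \<subseteq> S)"
proof -
  have verts: "verts (with_proj (mk_symmetric K)) = verts K"
    by (simp add: mk_symmetric_def)
  show ?thesis
    unfolding connected_def strongly_connected_def verts
    using reachable_mk_symmetric_iff[OF assms] by blast
qed

lemma arc_closed_Diff: "wf_digraph K \<Longrightarrow> arc_closed K S \<Longrightarrow> arc_closed K (verts K - S)"
  unfolding arc_closed_def wf_digraph_def by blast

text \<open>A closed set around another vertex \<open>u\<close> must contain \<open>v\<close>:
  otherwise its complement would be a closed set around \<open>v\<close> that misses
  \<open>u\<close>.\<close>

lemma connectedI: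
  assumes "wf_digraph K" "v \<in> verts K" "\<And>S. v \<in> S \<Longrightarrow> arc_closed K S \<Longrightarrow> verts K \<subseteq> S"
  shows "connected K"
  unfolding connected_iff[OF assms(1)]
proof (intro conjI allI impI)
  fix S u assume S: "u \<in> S" "u \<in> verts K" "arc_closed K S"
  have "v \<in> S"
  proof (rule ccontr)
    assume "v \<notin> S"
    then have "verts K \<subseteq> verts K - S"
      using assms(2) S by (intro assms(3) arc_closed_Diff[OF assms(1)]) auto
    then show False
      using S by blast
  qed
  then show "verts K \<subseteq> S"
    using assms(3) S(3) by blast
qed (use assms(2) in auto)

lemma arc_closed_cut: "arc_closed G U \<longleftrightarrow> cut_edges G U = {}" if "wf_digraph G"
  using that unfolding arc_closed_def cut_edges_def wf_digraph_def by blast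

lemma ordered_graph_wf: "ordered_graph G r \<Longrightarrow> wf_digraph G"
  by (simp add: ordered_graph_def fin_digraph_def)

lemma ordered_graph_cut:
  assumes "ordered_graph G r" "is_cut G U"
  shows "cut_edges G U \<noteq> {}"
proof
  have wf: "wf_digraph G" and con: "connected G"
    using assms(1) ordered_graph_wf by (auto simp: ordered_graph_def)
  assume "cut_edges G U = {}"
  then have "arc_closed G U"
    using arc_closed_cut[OF wf] by blast
  then show False
    using con assms(2) unfolding connected_iff[OF wf] is_cut_def by blast
qed

lemma wf_induce [simp]: "wf_digraph (G \<restriction> U)"
  by unfold_locales (auto simp: induce_subgraph_def)

lemma connected_induce_iff:
  "connected (G \<restriction> U) \<longleftrightarrow> U \<noteq> {} \<and> (\<forall>S v. v \<in> S \<longrightarrow> v \<in> U \<longrightarrow>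
     (\<forall>e\<in>arcs G. tail G e \<in> U \<longrightarrow> head G e \<in> U \<longrightarrow> (tail G e \<in> S \<longleftrightarrow> head G e \<in> S)) \<longrightarrow> U \<subseteq> S)"
  unfolding connected_iff[OF wf_induce] arc_closed_def by (simp add: induce_subgraph_def Ball_def imp_conjL)

text \<open>Builds a graph from the ends of chosen darts. An edge listed with \<open>Neg\<close>
  gets the two ends swapped; distinctness ensures that no edge is listed with both signs.\<close>

lemma graph_with_darts:
  assumes "distinct (map fst L)" "\<And>d. d \<in> set L \<Longrightarrow> f d \<in> V \<and> g d \<in> V"
  shows "\<exists>G. wf_digraph G \<and> verts G = V \<and> arcs G = fst ` set L \<and> (\<forall>d\<in>set L. source G d = f d \<and> target G d = g d)"
proof -
  let ?G = "\<lparr>verts = V, arcs = fst ` set L, tail = \<lambda>e. if (e, Pos) \<in> set L then f (e, Pos) else g (e, Neg),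
     head = \<lambda>e. if (e, Pos) \<in> set L then g (e, Pos) else f (e, Neg)\<rparr>"
  have d: "(e, Pos) \<notin> set L" if "(e, Neg) \<in> set L" for e
    using assms(1) that unfolding distinct_map inj_on_def by fastforce
  have "source ?G d = f d \<and> target ?G d = g d" if "d \<in> set L" for d
  proof -
    obtain e s where "d = (e, s)"
      by (cases d)
    then show ?thesis
      using that d[of e] by (cases s) simp_all
  qed
  moreover have "wf_digraph ?G"
  proof
    fix e assume "e \<in> arcs ?G"
    then obtain s where es: "(e, s) \<in> set L" by auto
    then have "(e, Pos) \<notin> set L \<Longrightarrow> (e, Neg) \<in> set L"
      by (cases s) simp_all
    then show "tail ?G e \<in> verts ?G" "head ?G e \<in> verts ?G"
      using assms(2)[of "(e, Pos)"] assms(2)[of "(e, Neg)"] by simp_all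
  qed
  ultimately show ?thesis
    by (intro exI[of _ ?G]) simp
qed

lemma darts_eq: "arcs G = fst ` D \<Longrightarrow> darts G = D \<union> neg ` D"
proof -
  assume *: "arcs G = fst ` D"
  have "d \<in> D \<union> neg ` D" if "d \<in> darts G" for d
  proof -
    from that * obtain d' where "d' \<in> D" "fst d = fst d'"
      by (auto simp: darts_def)
    then show ?thesis using same_edge_cases[of d d'] by auto
  qed
  moreover have D: "D \<subseteq> darts G"
    using * by (force simp: darts_def)
  moreover have "neg ` D \<subseteq> darts G"
    using D by auto
  ultimately show ?thesis by blast
qed

section \<open>Cuts\<close>

definition cut_pot :: "('v, 'e) pre_digraph \<Rightarrow> 'e dart set set" where
  "cut_pot G = {cut_darts G U | U. is_cut G U}"

definition cut_circ :: "('v, 'e) pre_digraph \<Rightarrow> 'e dart list \<Rightarrow> bool" where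
  "cut_circ G L \<longleftrightarrow> L \<noteq> [] \<and> distinct L \<and> (\<exists>U. simple_cut G U \<and> set L = cut_darts G U)"

definition cut_elem :: "('v, 'e) pre_digraph \<Rightarrow> 'e dart list \<Rightarrow> bool" where
  "cut_elem K L \<longleftrightarrow> L \<noteq> [] \<and> distinct (map fst L) \<and> arcs K = fst ` set L \<and>
     (\<exists>a b. a \<noteq> b \<and> verts K = {a, b} \<and> (\<forall>d\<in>set L. source K d = a \<and> target K d = b))"

definition cut_cm :: "('v, 'e) pre_digraph \<Rightarrow> 'e set \<Rightarrow> ('v, 'e) pre_digraph" where
  "cut_cm G E = contract G (arcs G - E)"

text \<open>Reversal followed by complementation: unoriented and bioriented edges are exchanged,
  while oriented edges keep their orientation.\<close>

definition dual :: "('v, 'e) pre_digraph \<Rightarrow> 'e dart set \<Rightarrow> 'e dart set" where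
  "dual G F = {d \<in> darts G. neg d \<notin> F}"

definition dual_property :: "('v, 'e) property \<Rightarrow> ('v, 'e) property" where
  "dual_property P G r F = P G r (dual G F)"

lemma fst_cut_darts: "fst ` cut_darts G U = cut_edges G U"
proof -
  have "e \<in> fst ` cut_darts G U \<longleftrightarrow> (e, Pos) \<in> cut_darts G U \<or> (e, Neg) \<in> cut_darts G U" for e
  proof
    assume "e \<in> fst ` cut_darts G U"
    then obtain s where "(e, s) \<in> cut_darts G U" by auto
    then show "(e, Pos) \<in> cut_darts G U \<or> (e, Neg) \<in> cut_darts G U"
      by (cases s) simp_all
  qed force
  then show ?thesis
    by (auto simp: cut_darts_def cut_edges_def darts_def)
qed

lemma cut_darts_Diff: "U \<subseteq> verts G \<Longrightarrow> cut_darts G (verts G - U) = neg ` cut_darts G U"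
proof (intro subset_antisym subsetI)
  fix d assume U: "U \<subseteq> verts G" and "d \<in> cut_darts G (verts G - U)"
  then have "neg d \<in> cut_darts G U"
    by (auto simp: cut_darts_def)
  then show "d \<in> neg ` cut_darts G U"
    by (metis imageI neg_neg)
next
  fix d assume U: "U \<subseteq> verts G" and "d \<in> neg ` cut_darts G U"
  then obtain d' where "d = neg d'" "d' \<in> cut_darts G U" by blast
  then show "d \<in> cut_darts G (verts G - U)"
    using U by (simp add: cut_darts_def subset_iff)
qed

lemma neg_notin_cut_darts: "d \<in> cut_darts G U \<Longrightarrow> neg d \<notin> cut_darts G U"
  by (auto simp: cut_darts_def)

lemma inj_on_fst_cut_darts: "inj_on fst (cut_darts G U)"
  using same_edge_cases neg_notin_cut_darts by (metis inj_onI)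

lemma simple_cut_Diff: "simple_cut G U \<Longrightarrow> simple_cut G (verts G - U)"
  by (auto simp: simple_cut_def is_cut_def double_diff)

lemma dual_dual: "F \<subseteq> darts G \<Longrightarrow> dual G (dual G F) = F"
  by (auto simp: dual_def)

lemma fourientation_dual: "fourientation G (dual G F)"
  by (auto simp: dual_def fourientation_def)

lemma potential_cut_iff: "potential_cut G F U \<longleftrightarrow> is_cut G U \<and> cut_darts G U \<subseteq> dual G F"
proof -
  have "cut_darts G U \<subseteq> darts G"
    by (auto simp: cut_darts_def)
  then have "cut_darts G U \<subseteq> dual G F \<longleftrightarrow> (\<forall>d\<in>cut_darts G U. neg d \<notin> F)"
    unfolding dual_def by blast
  also have "\<dots> \<longleftrightarrow> (\<forall>e \<epsilon>. (e, \<epsilon>) \<in> cut_darts G U \<longrightarrow> (e, opp \<epsilon>) \<notin> F)"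
    by (force simp: neg.simps)
  finally show ?thesis
    by (simp add: potential_cut_def)
qed

lemma cut_circ_edges: "cut_circ G L \<Longrightarrow> L \<noteq> [] \<and> distinct (map fst L) \<and> fst ` set L \<subseteq> arcs G"
proof -
  assume L: "cut_circ G L"
  then obtain U where U: "set L = cut_darts G U"
    by (auto simp: cut_circ_def)
  have "cut_edges G U \<subseteq> arcs G"
    by (auto simp: cut_edges_def)
  then show ?thesis
    using L inj_on_fst_cut_darts[of G U] unfolding cut_circ_def distinct_map U fst_cut_darts by blast
qed

lemma cut_circ_neg: "cut_circ G L \<Longrightarrow> cut_circ G (rev (map neg L))"
proof -
  assume L: "cut_circ G L"
  then obtain U where U: "simple_cut G U" "set L = cut_darts G U"
    by (auto simp: cut_circ_def)
  then have "set (rev (map neg L)) = cut_darts G (verts G - U)"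
    using cut_darts_Diff[of U G] by (simp add: simple_cut_def is_cut_def)
  then show ?thesis
    using L simple_cut_Diff[OF U(1)] by (auto simp: cut_circ_def distinct_map intro!: inj_onI)
qed

text \<open>Each side of a simple cut is connected by edges outside the cut, so contracting these
  edges shrinks it to one vertex.\<close>

lemma contract_cut:
  assumes wf: "wf_digraph G" and U: "simple_cut G U"
  obtains a b where "a \<noteq> b" "verts (cut_cm G (cut_edges G U)) = {a, b}"
    "\<And>d. d \<in> cut_darts G U \<Longrightarrow>
       source (cut_cm G (cut_edges G U)) d = a \<and> target (cut_cm G (cut_edges G U)) d = b"
proof -
  let ?A = "arcs G - cut_edges G U"
  let ?G' = "G\<lparr>arcs := arcs G \<inter> ?A\<rparr>"
  define rep where "rep v = (SOME w. v \<rightarrow>\<^sup>*\<^bsub>with_proj (mk_symmetric ?G')\<^esub> w)" for v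
  have wf': "wf_digraph ?G'"
    using wf by (simp add: wf_digraph_def)
  \<comment> \<open>The component of \<open>v\<close> stays inside its side because no cut edge is
    left, and it fills the side because the induced subgraph is connected.\<close>
  have side: "{w. v \<rightarrow>\<^sup>*\<^bsub>with_proj (mk_symmetric ?G')\<^esub> w} = W"
    if W: "W = U \<or> W = verts G - U" and v: "v \<in> W" for W v
  proof -
    have sub: "W \<subseteq> verts G" and con: "connected (G \<restriction> W)"
      using W U by (auto simp: simple_cut_def is_cut_def)
    have vG: "v \<in> verts ?G'"
      using v sub by auto
    have cl: "arc_closed ?G' W"
      using W wf U unfolding arc_closed_def cut_edges_def simple_cut_def is_cut_def wf_digraph_def by auto
    have "W \<subseteq> S" if S: "v \<in> S" "arc_closed ?G' S" for S
    proof -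
      have "tail G e \<in> S \<longleftrightarrow> head G e \<in> S" if "e \<in> arcs G" "tail G e \<in> W" "head G e \<in> W" for e
      proof -
        have "e \<notin> cut_edges G U"
          using that W by (auto simp: cut_edges_def)
        then show ?thesis
          using S(2) that by (auto simp: arc_closed_def)
      qed
      then show ?thesis
        using con S(1) v unfolding connected_induce_iff by blast
    qed
    then show ?thesis
      using cl v sub unfolding reachable_mk_symmetric_iff[OF wf' vG] by auto
  qed
  \<comment> \<open>The choice in \<open>rep\<close> is made from the whole side, hence is the same
    for all its vertices.\<close>
  define a where "a = (SOME w. w \<in> U)"
  define b where "b = (SOME w. w \<in> verts G - U)"
  have ne: "U \<noteq> {}" "verts G - U \<noteq> {}" and sub: "U \<subseteq> verts G"
    using U by (auto simp: simple_cut_def is_cut_def)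
  have rep: "v \<in> U \<Longrightarrow> rep v = a" "v \<in> verts G - U \<Longrightarrow> rep v = b" for v
  proof -
    have "rep v = (SOME w. w \<in> {w. v \<rightarrow>\<^sup>*\<^bsub>with_proj (mk_symmetric ?G')\<^esub> w})"
      by (simp add: rep_def)
    then show "v \<in> U \<Longrightarrow> rep v = a" "v \<in> verts G - U \<Longrightarrow> rep v = b"
      using side[of U v] side[of "verts G - U" v] unfolding a_def b_def by metis+
  qed
  have ab: "a \<in> U" "b \<in> verts G - U"
    unfolding a_def b_def using ne by (simp_all add: some_in_eq del: Diff_iff)
  have cm: "cut_cm G (cut_edges G U) = \<lparr>verts = rep ` verts G, arcs = arcs G - ?A,
      tail = (\<lambda>e. rep (tail G e)), head = (\<lambda>e. rep (head G e))\<rparr>"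
    unfolding cut_cm_def contract_def rep_def Let_def ..
  show thesis
  proof (rule that[of a b])
    show "a \<noteq> b"
      using ab by auto
    have "rep ` U = {a}" "rep ` (verts G - U) = {b}"
      using rep ne by (simp_all add: image_constant_conv cong: image_cong del: Diff_iff Diff_eq_empty_iff)
    then show "verts (cut_cm G (cut_edges G U)) = {a, b}"
      using sub unfolding cm by (metis Diff_partition image_Un insert_is_Un pre_digraph.select_convs(1))
    fix d assume d: "d \<in> cut_darts G U"
    have "source (cut_cm G (cut_edges G U)) d = rep (source G d)" "target (cut_cm G (cut_edges G U)) d = rep (target G d)"
      unfolding cm by (cases d; cases "snd d"; simp)+
    then show "source (cut_cm G (cut_edges G U)) d = a \<and> target (cut_cm G (cut_edges G U)) d = b"
      using d rep by (auto simp: cut_darts_def)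
  qed
qed

lemma arcs_cut_cm: "E \<subseteq> arcs G \<Longrightarrow> arcs (cut_cm G E) = E"
  by (auto simp: cut_cm_def contract_def Let_def)

lemma cut_circ_elem:
  assumes "ordered_graph G r" "cut_circ G L"
  shows "cut_elem (cut_cm G (fst ` set L)) L"
proof -
  obtain U where U: "simple_cut G U" "set L = cut_darts G U"
    using assms(2) by (auto simp: cut_circ_def)
  obtain a b where "a \<noteq> b" "verts (cut_cm G (cut_edges G U)) = {a, b}"
    "\<And>d. d \<in> cut_darts G U \<Longrightarrow>
       source (cut_cm G (cut_edges G U)) d = a \<and> target (cut_cm G (cut_edges G U)) d = b"
    using contract_cut[OF ordered_graph_wf[OF assms(1)] U(1)] by blast
  moreover have "arcs (cut_cm G (cut_edges G U)) = cut_edges G U"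
    by (intro arcs_cut_cm) (auto simp: cut_edges_def)
  ultimately show ?thesis
    using cut_circ_edges[OF assms(2)] unfolding cut_elem_def U(2) fst_cut_darts by blast
qed

section \<open>Graphs on two vertices\<close>

lemma cut_elemE:
  assumes "cut_elem K L"
  obtains a b where "a \<noteq> b" "verts K = {a, b}" "\<forall>d\<in>set L. source K d = a \<and> target K d = b"
  using assms unfolding cut_elem_def by (elim exE conjE)

lemma cut_elem_wf: "cut_elem K L \<Longrightarrow> wf_digraph K"
proof
  fix e assume K: "cut_elem K L" and e: "e \<in> arcs K"
  then obtain s where "(e, s) \<in> set L"
    by (auto simp: cut_elem_def)
  with K show "tail K e \<in> verts K" "head K e \<in> verts K"
    by (cases s; force simp: cut_elem_def)+
qed

lemma cut_elem_graph: "cut_elem K L \<Longrightarrow> fin_digraph K \<and> connected K \<and> arcs K = fst ` set L"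
proof (intro conjI)
  assume K: "cut_elem K L"
  then obtain a b where ab: "verts K = {a, b}" "\<And>d. d \<in> set L \<Longrightarrow> source K d = a \<and> target K d = b"
    unfolding cut_elem_def by blast
  show arcs: "arcs K = fst ` set L"
    using K by (simp add: cut_elem_def)
  show "fin_digraph K"
    using cut_elem_wf[OF K] ab(1) arcs by (intro wf_digraph.fin_digraphI) auto
  obtain d where d: "d \<in> set L"
    using K by (cases L) (auto simp: cut_elem_def)
  then have "d \<in> darts K"
    using darts_eq[OF arcs] by blast
  then show "connected K"
    using arc_closed_dart[of K _ d] ab(2)[OF d] by (intro connectedI[OF cut_elem_wf[OF K], of a]) (auto simp: ab(1))
qed

lemma cut_elem_cut:
  assumes "cut_elem K L" "is_cut K U"
  shows "cut_darts K U = set L \<or> cut_darts K U = neg ` set L"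
proof -
  obtain a b where ab: "a \<noteq> b" "verts K = {a, b}" "\<forall>d\<in>set L. source K d = a \<and> target K d = b"
    by (rule cut_elemE[OF assms(1)])
  note ab = ab(1,2) ab(3)[rule_format]
  have darts: "darts K = set L \<union> neg ` set L"
    using cut_elem_graph[OF assms(1)] by (intro darts_eq) simp
  have src: "source K d = b \<and> target K d = a" if "d \<in> neg ` set L" for d
    using that ab(3) by auto
  consider "U = {a}" | "U = {b}"
    using assms(2) unfolding is_cut_def ab(2) by blast
  then show ?thesis
  proof cases
    case 1
    have "cut_darts K U = set L"
      using ab(1,3) src unfolding 1 cut_darts_def darts ab(2) by blast
    then show ?thesis ..
  next
    case 2
    have "cut_darts K U = neg ` set L"
      using ab(1,3) src unfolding 2 cut_darts_def darts ab(2) by blast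
    then show ?thesis ..
  qed
qed

lemma cut_elem_neg: "cut_elem K L \<Longrightarrow> cut_elem K (rev (map neg L))"
proof -
  assume K: "cut_elem K L"
  obtain a b where ab: "a \<noteq> b" "verts K = {a, b}" "\<forall>d\<in>set L. source K d = a \<and> target K d = b"
    by (rule cut_elemE[OF K])
  note ab = ab(1,2) ab(3)[rule_format]
  have "distinct (map fst (rev (map neg L)))"
    using K by (simp add: cut_elem_def rev_map[symmetric] comp_def)
  moreover have "b \<noteq> a" "verts K = {b, a}" "\<forall>d\<in>set (rev (map neg L)). source K d = b \<and> target K d = a"
    using ab by auto
  moreover have "rev (map neg L) \<noteq> []" "arcs K = fst ` set (rev (map neg L))"
    using K by (simp_all add: cut_elem_def)
  ultimately show ?thesis
    unfolding cut_elem_def by blast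
qed

lemma cut_elem_iso:
  assumes K: "cut_elem K L" "cut_elem K' (map (map_prod h id) L)"
  shows "\<exists>g. inj_on g (verts K) \<and> g ` verts K = verts K' \<and>
          (\<forall>e\<in>arcs K. tail K' (h e) = g (tail K e) \<and> head K' (h e) = g (head K e))"
proof -
  obtain a b where ab: "a \<noteq> b" "verts K = {a, b}" "\<forall>d\<in>set L. source K d = a \<and> target K d = b"
    by (rule cut_elemE[OF K(1)])
  note ab = ab(1,2) ab(3)[rule_format]
  obtain a' b' where ab': "a' \<noteq> b'" "verts K' = {a', b'}"
    "\<forall>d\<in>set (map (map_prod h id) L). source K' d = a' \<and> target K' d = b'"
    by (rule cut_elemE[OF K(2)])
  note ab' = ab'(1,2) ab'(3)[rule_format]
  have "tail K' (h e) = (if tail K e = a then a' else b') \<and> head K' (h e) = (if head K e = a then a' else b')"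
    if "e \<in> arcs K" for e
  proof -
    have "e \<in> fst ` set L"
      using that K(1) by (simp add: cut_elem_def)
    then obtain s where s: "(e, s) \<in> set L"
      by auto
    then have "(h e, s) \<in> set (map (map_prod h id) L)"
      by force
    then show ?thesis
      using ab(3)[OF s] ab'(3)[of "(h e, s)"] ab(1) by (cases s) simp_all
  qed
  then show ?thesis
    using ab(1,2) ab'(1,2) by (intro exI[of _ "\<lambda>v. if v = a then a' else b'"]) auto
qed

lemma cut_elem_ex:
  assumes inf: "infinite (UNIV :: 'v set)" and L: "L \<noteq> []" "distinct (map fst L)"
  shows "\<exists>K :: ('v, 'e) pre_digraph. cut_elem K L"
proof -
  obtain a b :: 'v where ab: "a \<noteq> b"
    using inf by (metis UNIV_eq_I finite.emptyI finite_insert insertI1 singletonD)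
  obtain K where "verts K = {a, b}" "arcs K = fst ` set L" "\<forall>d\<in>set L. source K d = a \<and> target K d = b"
    using graph_with_darts[OF L(2), of "\<lambda>_. a" "{a, b}" "\<lambda>_. b"] by auto
  then show ?thesis
    using L ab unfolding cut_elem_def by blast
qed

lemma del_arc_source [simp]: "source (pre_digraph.del_arc G e) d = source G d"
  and del_arc_target [simp]: "target (pre_digraph.del_arc G e) d = target G d"
  by (cases d; cases "snd d"; simp add: pre_digraph.del_arc_simps)+

lemma cut_elem_minor:
  assumes K: "cut_elem K (L @ [(e, s)])" and L: "L \<noteq> []"
  shows "cut_elem (pre_digraph.del_arc K e) L \<and> \<not> isthmus K e \<and> \<not> loop K e"
proof (intro conjI)
  obtain a b where ab: "a \<noteq> b" "verts K = {a, b}" "\<forall>d\<in>set (L @ [(e, s)]). source K d = a \<and> target K d = b"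
    by (rule cut_elemE[OF K])
  note ab = ab(1,2) ab(3)[rule_format]
  have d: "distinct (map fst (L @ [(e, s)]))" and arcs: "arcs K = fst ` set (L @ [(e, s)])"
    using K by (auto simp: cut_elem_def)
  have "arcs (pre_digraph.del_arc K e) = fst ` set L"
    using d unfolding pre_digraph.del_arc_simps arcs by auto
  then show "cut_elem (pre_digraph.del_arc K e) L"
    using L d ab unfolding cut_elem_def by (auto simp: pre_digraph.del_arc_simps)
  show "\<not> isthmus K e"
  proof
    assume "isthmus K e"
    then obtain U where U: "is_cut K U" "cut_edges K U = {e}"
      by (auto simp: isthmus_def)
    \<comment> \<open>On two vertices every cut consists of all edges, and the nonempty
      \<open>L\<close> contributes one besides \<open>e\<close>.\<close>
    then have "cut_edges K U = fst ` set (L @ [(e, s)])"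
      using cut_elem_cut[OF K U(1)] unfolding fst_cut_darts[symmetric] by (metis image_fst_neg)
    then show False
      using U(2) d L by (cases L) auto
  qed
  show "\<not> loop K e"
    using ab(3)[of "(e, s)"] ab(1) by (cases s) (auto simp: loop_def)
qed

section \<open>Simple cuts inside directed cuts\<close>

lemma connected_induce_single: "connected (G \<restriction> {p})"
  unfolding connected_induce_iff by auto

lemma connected_induce_pair:
  assumes "d \<in> darts G" "source G d = p" "target G d = q"
  shows "connected (G \<restriction> {p, q})" "connected (G \<restriction> {q, p})"
proof -
  obtain e s where d: "d = (e, s)"
    by (cases d)
  have e: "e \<in> arcs G" "{tail G e, head G e} = {p, q}"
    using assms unfolding d by (cases s; auto simp: darts_def)+
  then show "connected (G \<restriction> {p, q})"
    unfolding connected_induce_iff by (auto simp: doubleton_eq_iff)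
  then show "connected (G \<restriction> {q, p})"
    by (simp add: insert_commute)
qed

lemma cut_darts_del_arc: "cut_darts (pre_digraph.del_arc G e) U = {d \<in> cut_darts G U. fst d \<noteq> e}"
  by (auto simp: cut_darts_def darts_def pre_digraph.del_arc_simps)

lemma not_cut_edge:
  assumes "U \<subseteq> verts G" "d \<in> darts G" "source G d \<in> verts G" "target G d \<in> verts G" "fst d \<notin> cut_edges G U"
  shows "source G d \<in> U \<longleftrightarrow> target G d \<in> U"
proof -
  have "d \<notin> cut_darts G U" "neg d \<notin> cut_darts G U"
    using assms(5) unfolding fst_cut_darts[symmetric] by (metis imageI, metis fst_neg imageI)
  then show ?thesis
    using assms by (auto simp: cut_darts_def)
qed

text \<open>If \<open>U\<close> fell apart into two parts with no edge between them, the darts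
  leaving the parts would be disjoint subsets of the cut, both nonempty as \<open>G\<close> is
  connected. The part at the source of \<open>d\<close> would then have a smaller cut through
  \<open>d\<close>.\<close>

lemma connected_minimal_cut:
  assumes G: "ordered_graph G r" and U: "is_cut G U" "d \<in> cut_darts G U"
    and min: "\<And>W. is_cut G W \<Longrightarrow> d \<in> cut_darts G W \<Longrightarrow> cut_darts G W \<subseteq> cut_darts G U \<Longrightarrow>
      cut_darts G W = cut_darts G U"
  shows "connected (G \<restriction> U)"
proof (rule ccontr)
  assume "\<not> connected (G \<restriction> U)"
  then obtain S v where S: "v \<in> S" "v \<in> U" "\<not> U \<subseteq> S"
    and sep: "\<And>e. e \<in> arcs G \<Longrightarrow> tail G e \<in> U \<Longrightarrow> head G e \<in> U \<Longrightarrow> tail G e \<in> S \<longleftrightarrow> head G e \<in> S"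
    using U(1) unfolding connected_induce_iff is_cut_def by blast
  \<comment> \<open>The side of the separation that contains the source of \<open>d\<close>, so that
    \<open>d\<close> still leaves \<open>U \<inter> T\<close>.\<close>
  define T where "T = (if source G d \<in> S then S else - S)"
  let ?W = "U \<inter> T" and ?W' = "U - T"
  have sep': "source G f \<in> T \<longleftrightarrow> target G f \<in> T" if "f \<in> darts G" "source G f \<in> U" "target G f \<in> U" for f
  proof -
    obtain e s where "f = (e, s)"
      by (cases f)
    then show ?thesis
      using that sep[of e] unfolding T_def by (cases s) (auto simp: darts_def)
  qed
  have sub: "U \<subseteq> verts G"
    using U(1) by (simp add: is_cut_def)
  have d: "d \<in> darts G" "source G d \<in> U" "target G d \<in> verts G" "target G d \<notin> U"
    using U(2) by (auto simp: cut_darts_def)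
  have dT: "source G d \<in> T"
    by (simp add: T_def)
  have W: "is_cut G ?W" "is_cut G ?W'"
    using U(1) S d dT unfolding is_cut_def T_def by auto
  have "d \<in> cut_darts G ?W"
    using d dT by (simp add: cut_darts_def)
  moreover have "cut_darts G ?W \<subseteq> cut_darts G U"
  proof
    fix f assume "f \<in> cut_darts G ?W"
    then show "f \<in> cut_darts G U"
      using sep'[of f] unfolding cut_darts_def by blast
  qed
  ultimately have eq: "cut_darts G ?W = cut_darts G U"
    by (rule min[OF W(1)])
  have "cut_darts G ?W' \<noteq> {}"
    using ordered_graph_cut[OF G W(2)] unfolding fst_cut_darts[symmetric] by blast
  then obtain f where f: "f \<in> cut_darts G ?W'"
    by blast
  then have "f \<in> cut_darts G U"
    using sep'[of f] unfolding cut_darts_def by blast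
  then have "f \<in> cut_darts G ?W"
    using eq by simp
  then show False
    using f by (simp add: cut_darts_def)
qed

text \<open>Among the directed cuts through \<open>d\<close> inside \<open>D\<close>, one with the
  fewest darts is simple.\<close>

lemma cut_pot_circ_sub:
  assumes G: "ordered_graph G r" and D: "D \<in> cut_pot G" "d \<in> D"
  shows "\<exists>L. cut_circ G L \<and> d \<in> set L \<and> set L \<subseteq> D"
proof -
  have fin: "finite (cut_darts G U)" for U
  proof -
    have "finite (cut_edges G U)"
      using G by (simp add: ordered_graph_def fin_digraph.finite_arcs cut_edges_def)
    then show ?thesis
      using inj_on_fst_cut_darts finite_imageD unfolding fst_cut_darts[symmetric] by blast
  qed
  let ?Q = "\<lambda>U. is_cut G U \<and> d \<in> cut_darts G U \<and> cut_darts G U \<subseteq> D"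
  obtain U0 where U0: "?Q U0"
    using D by (auto simp: cut_pot_def)
  obtain U where U: "?Q U" and min: "\<And>W. ?Q W \<Longrightarrow> card (cut_darts G U) \<le> card (cut_darts G W)"
    using ex_has_least_nat[of ?Q U0 "\<lambda>U. card (cut_darts G U)", OF U0] by blast
  have eq: "cut_darts G W = cut_darts G U"
    if "is_cut G W" "d \<in> cut_darts G W" "cut_darts G W \<subseteq> cut_darts G U" for W
    using card_seteq[OF fin that(3)] min[of W] that U by blast
  have sub: "U \<subseteq> verts G"
    using U by (simp add: is_cut_def)
  have cut': "is_cut G (verts G - W)" if "is_cut G W" for W
    using that by (auto simp: is_cut_def)
  have "connected (G \<restriction> U)"
    using U by (intro connected_minimal_cut[OF G _ _ eq]) auto
  \<comment> \<open>The other side is the source side of the reversed cut, which is minimal among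
    the cuts through \<open>neg d\<close>.\<close>
  moreover have "connected (G \<restriction> (verts G - U))"
  proof (rule connected_minimal_cut[OF G])
    show "is_cut G (verts G - U)"
      using cut' U by blast
    show "neg d \<in> cut_darts G (verts G - U)"
      using U unfolding cut_darts_Diff[OF sub] by blast
    fix W assume W: "is_cut G W" "neg d \<in> cut_darts G W" "cut_darts G W \<subseteq> cut_darts G (verts G - U)"
    have subW: "W \<subseteq> verts G"
      using W(1) by (simp add: is_cut_def)
    have "d \<in> cut_darts G (verts G - W)"
      using W(2) unfolding cut_darts_Diff[OF subW] by (metis imageI neg_neg)
    moreover have "cut_darts G (verts G - W) \<subseteq> cut_darts G U"
      using W(3) unfolding cut_darts_Diff[OF subW] cut_darts_Diff[OF sub] by auto
    ultimately have "cut_darts G (verts G - W) = cut_darts G U"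
      using eq cut'[OF W(1)] by blast
    then have "neg ` neg ` cut_darts G W = neg ` cut_darts G U"
      unfolding cut_darts_Diff[OF subW] by simp
    then show "cut_darts G W = cut_darts G (verts G - U)"
      unfolding cut_darts_Diff[OF sub] by (simp add: image_image)
  qed
  ultimately have "simple_cut G U"
    using U by (simp add: simple_cut_def)
  moreover obtain L where "set L = cut_darts G U" "distinct L"
    using finite_distinct_list[OF fin] by blast
  ultimately show ?thesis
    using U unfolding cut_circ_def by (intro exI[of _ L]) auto
qed

section \<open>The triangle\<close>

text \<open>The darts of \<open>X\<close> run from \<open>c\<close> to \<open>b\<close>, those of
  \<open>Y\<close> from \<open>c\<close> to \<open>a\<close>, and \<open>(e, Pos)\<close> from
  \<open>a\<close> to \<open>b\<close>. So \<open>X @ Y\<close> leaves \<open>{c}\<close>,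
  \<open>X\<close> with \<open>(e, Pos)\<close> leaves \<open>{a, c}\<close>, and \<open>Y\<close>
  with \<open>(e, Neg)\<close> leaves \<open>{b, c}\<close>. Without \<open>e\<close> the pair
  \<open>{a, b}\<close> is disconnected, and only the cuts around \<open>a\<close> and around
  \<open>b\<close> remain simple.\<close>

lemma cut_pair_ex:
  assumes inf: "infinite (UNIV :: 'v set)" and ne: "X \<noteq> []" "Y \<noteq> []"
    and dist: "distinct (map fst (X @ Y @ [(e, Pos)]))"
  shows "\<exists>G :: ('v, 'e) pre_digraph. fin_digraph G \<and> connected G \<and> arcs G = fst ` set (X @ Y @ [(e, Pos)]) \<and>
        \<not> isthmus G e \<and> \<not> loop G e \<and>
        cut_circ G (X @ [(e, Pos)]) \<and> cut_circ G (Y @ [(e, Neg)]) \<and> cut_circ G (X @ Y) \<and>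
        (\<forall>M. cut_circ G M \<longrightarrow> e \<in> fst ` set M \<or> set M = set (X @ Y) \<or> set M = neg ` set (X @ Y)) \<and>
        fin_digraph (pre_digraph.del_arc G e) \<and> connected (pre_digraph.del_arc G e) \<and>
        arcs (pre_digraph.del_arc G e) = fst ` set (X @ Y) \<and>
        cut_circ (pre_digraph.del_arc G e) X \<and> cut_circ (pre_digraph.del_arc G e) Y \<and>
        (\<forall>M. cut_circ (pre_digraph.del_arc G e) M \<longrightarrow> set M \<in> {set X, neg ` set X, set Y, neg ` set Y})"
proof -
  obtain a :: 'v where "a \<in> UNIV" by blast
  obtain b where b: "b \<noteq> a"
    using inf by (metis UNIV_eq_I finite.emptyI finite_insert insertI1 singletonD)
  obtain c where c: "c \<notin> {a, b}"
    using inf by (metis UNIV_eq_I finite.emptyI finite_insert)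
  have abc: "a \<noteq> b" "b \<noteq> a" "a \<noteq> c" "c \<noteq> a" "b \<noteq> c" "c \<noteq> b"
    using b c by auto
  let ?ep = "(e, Pos)" and ?en = "(e, Neg)"
  let ?f = "\<lambda>d. if d = ?ep then a else c" and ?g = "\<lambda>d. if d \<in> set Y then a else b"
  have mem: "?f d \<in> {a, b, c} \<and> ?g d \<in> {a, b, c}" for d
    by simp
  obtain G where wf: "wf_digraph G" and V: "verts G = {a, b, c}" and arcs: "arcs G = fst ` set (X @ Y @ [?ep])"
    and ends: "\<forall>d\<in>set (X @ Y @ [?ep]). source G d = ?f d \<and> target G d = ?g d"
    using graph_with_darts[of "X @ Y @ [?ep]" ?f "{a, b, c}" ?g, OF dist mem] by blast
  have e: "e \<notin> fst ` set X" "e \<notin> fst ` set Y" and XY: "fst ` set X \<inter> fst ` set Y = {}"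
    and dXY: "distinct (map fst X)" "distinct (map fst Y)"
    using dist by auto
  have dis: "distinct X" "distinct Y"
    using dXY by (simp_all add: distinct_map)
  have X: "source G d = c" "target G d = b" if "d \<in> set X" for d
  proof -
    have "d \<notin> set Y" "d \<noteq> ?ep"
      using that XY e(1) by force+
    then show "source G d = c" "target G d = b"
      using ends that by auto
  qed
  have Y: "source G d = c" "target G d = a" if "d \<in> set Y" for d
  proof -
    have "d \<noteq> ?ep"
      using that e(2) by force
    then show "source G d = c" "target G d = a"
      using ends that by auto
  qed
  have "?ep \<notin> set Y"
    using e(2) by force
  then have ep: "source G ?ep = a" "target G ?ep = b" "source G ?en = b" "target G ?en = a"
    using bspec[OF ends, of ?ep] by simp_all
  have ne': "neg ?ep = ?en"
    by (simp add: neg.simps)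
  have darts: "darts G = set X \<union> set Y \<union> {?ep} \<union> (neg ` set X \<union> neg ` set Y \<union> {?en})"
    unfolding darts_eq[OF arcs] by (auto simp: ne')
  have C: "cut_darts G {c} = set X \<union> set Y" "cut_darts G {a, c} = insert ?ep (set X)" "cut_darts G {b, c} = insert ?en (set Y)"
  proof -
    have "d \<in> cut_darts G {c} \<longleftrightarrow> d \<in> set X \<union> set Y" "d \<in> cut_darts G {a, c} \<longleftrightarrow> d \<in> insert ?ep (set X)"
      "d \<in> cut_darts G {b, c} \<longleftrightarrow> d \<in> insert ?en (set Y)" for d
    proof -
      consider "d \<in> set X" | "d \<in> set Y" | "d = ?ep" | d' where "d = neg d'" "d' \<in> set X"
        | d' where "d = neg d'" "d' \<in> set Y" | "d = ?en" | "d \<notin> darts G"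
        unfolding darts by blast
      then have "(d \<in> cut_darts G {c} \<longleftrightarrow> d \<in> set X \<union> set Y) \<and> (d \<in> cut_darts G {a, c} \<longleftrightarrow> d \<in> insert ?ep (set X)) \<and>
        (d \<in> cut_darts G {b, c} \<longleftrightarrow> d \<in> insert ?en (set Y))"
      proof cases
        case 1
        then have "d \<in> darts G" "d \<notin> set Y" "d \<noteq> ?en"
          using XY e unfolding darts by force+
        then show ?thesis using 1 X[OF 1] abc by (simp add: cut_darts_def V)
      next
        case 2
        then have "d \<in> darts G" "d \<notin> set X" "d \<noteq> ?ep"
          using XY e unfolding darts by force+
        then show ?thesis using 2 Y[OF 2] abc by (simp add: cut_darts_def V)
      next
        case 3
        then have "d \<in> darts G" "d \<notin> set X" "d \<notin> set Y" "d \<noteq> ?en"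
          using e unfolding darts by force+
        then show ?thesis using 3 ep abc by (simp add: cut_darts_def V)
      next
        case 4
        have sd: "source G d = b" "target G d = c"
          using X[OF 4(2)] by (simp_all add: 4(1))
        have "d \<notin> set X" "d \<notin> set Y" "d \<noteq> ?ep" "d \<noteq> ?en"
          using X(1)[of d] Y(1)[of d] sd abc ep by metis+
        then show ?thesis using sd abc by (simp add: cut_darts_def V)
      next
        case 5
        have sd: "source G d = a" "target G d = c"
          using Y[OF 5(2)] by (simp_all add: 5(1))
        have "d \<notin> set X" "d \<notin> set Y" "d \<noteq> ?ep" "d \<noteq> ?en"
          using X(1)[of d] Y(1)[of d] sd abc ep by metis+
        then show ?thesis using sd abc by (simp add: cut_darts_def V)
      next
        case 6
        then have "d \<in> darts G" "d \<notin> set X" "d \<notin> set Y" "d \<noteq> ?ep"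
          using e unfolding darts by force+
        then show ?thesis using 6 ep abc by (simp add: cut_darts_def V)
      next
        case 7
        then show ?thesis by (auto simp: cut_darts_def darts)
      qed
      then show "d \<in> cut_darts G {c} \<longleftrightarrow> d \<in> set X \<union> set Y" "d \<in> cut_darts G {a, c} \<longleftrightarrow> d \<in> insert ?ep (set X)"
        "d \<in> cut_darts G {b, c} \<longleftrightarrow> d \<in> insert ?en (set Y)" by blast+
    qed
    then show "cut_darts G {c} = set X \<union> set Y" "cut_darts G {a, c} = insert ?ep (set X)"
      "cut_darts G {b, c} = insert ?en (set Y)" by blast+
  qed
  have compl: "{a, b, c} - {c} = {a, b}" "{a, b, c} - {a, c} = {b}" "{a, b, c} - {b, c} = {a}"
    using abc by auto
  have C': "cut_darts G {a, b} = neg ` (set X \<union> set Y)" "cut_darts G {b} = neg ` insert ?ep (set X)"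
    "cut_darts G {a} = neg ` insert ?en (set Y)"
    using cut_darts_Diff[of "{c}" G] cut_darts_Diff[of "{a, c}" G] cut_darts_Diff[of "{b, c}" G]
    by (simp_all add: V compl C del: image_insert)
  have cuts: "U \<in> {{c}, {a, b}, {a, c}, {b}, {b, c}, {a}}" if "is_cut K U" "verts K = {a, b, c}" for U and K :: "('v, 'e) pre_digraph"
  proof -
    have "U \<in> Pow {a, b, c}"
      using that by (auto simp: is_cut_def)
    moreover have "U \<noteq> {}" "U \<noteq> {a, b, c}"
      using that by (auto simp: is_cut_def)
    ultimately show ?thesis
      by (auto simp: Pow_insert insert_commute)
  qed
  obtain x y where x: "x \<in> set X" and y: "y \<in> set Y"
    using ne by (meson last_in_set)
  have xd: "x \<in> darts G" "y \<in> darts G" "?ep \<in> darts G"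
    using x y darts by auto
  let ?H = "pre_digraph.del_arc G e"
  have VH: "verts ?H = {a, b, c}" and arcsH: "arcs ?H = fst ` set (X @ Y)"
    using V arcs e by (auto simp: pre_digraph.del_arc_simps)
  have wfH: "wf_digraph ?H"
    using wf by (rule wf_digraph.wf_digraph_del_arc)
  have xdH: "x \<in> darts ?H" "y \<in> darts ?H"
    using x y darts_eq[OF arcsH] by auto
  have con: "connected K" if "wf_digraph K" "verts K = {a, b, c}" "x \<in> darts K" "y \<in> darts K"
    "source K x = c" "target K x = b" "source K y = c" "target K y = a" for K :: "('v, 'e) pre_digraph"
    using that by (intro connectedI[OF that(1), of c]) (use arc_closed_dart[of K _ x] arc_closed_dart[of K _ y] in auto)
  have H_ends: "source ?H = source G" "target ?H = target G"
    by (auto simp: fun_eq_iff)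
  have simple: "simple_cut G {c}" "simple_cut G {a, c}" "simple_cut G {b, c}"
    unfolding simple_cut_def is_cut_def V compl
    using connected_induce_single connected_induce_pair[OF xd(1) X[OF x]] connected_induce_pair[OF xd(2) Y[OF y]]
      connected_induce_pair[OF xd(3) ep(1,2)] abc by (auto simp: compl)
  have simpleH: "simple_cut ?H {a, c}" "simple_cut ?H {b, c}"
    unfolding simple_cut_def is_cut_def VH compl
    using connected_induce_single connected_induce_pair[OF xdH(1)] connected_induce_pair[OF xdH(2)] X[OF x] Y[OF y]
    unfolding H_ends by (auto simp: compl)
  \<comment> \<open>Every edge other than \<open>e\<close> ends at \<open>c\<close>, so
    \<open>{a}\<close> is closed within \<open>{a, b}\<close>.\<close>
  have not_simpleH: "\<not> connected (?H \<restriction> {a, b})"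
  proof
    assume *: "connected (?H \<restriction> {a, b})"
    have "tail ?H f \<in> {a} \<longleftrightarrow> head ?H f \<in> {a}" if f: "f \<in> arcs ?H" "tail ?H f \<in> {a, b}" "head ?H f \<in> {a, b}" for f
    proof -
      have "\<exists>s. (f, s) \<in> set X \<union> set Y"
        using f(1) unfolding arcsH by force
      then obtain s where s: "(f, s) \<in> set X \<union> set Y" ..
      then have "source G (f, s) = c"
        using X Y by blast
      then have "c \<in> {tail G f, head G f}"
        by (cases s) auto
      then show ?thesis
        using f(2,3) abc by (auto simp: pre_digraph.del_arc_simps)
    qed
    then have "{a, b} \<subseteq> {a}"
      using * unfolding connected_induce_iff by blast
    then show False using abc by simp
  qed
  show ?thesis
  proof (intro exI[of _ G] conjI allI impI)
    show "fin_digraph G"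
      using wf V arcs by (intro wf_digraph.fin_digraphI) auto
    show "connected G"
      using con[OF wf V xd(1,2)] X[OF x] Y[OF y] by blast
    show "arcs G = fst ` set (X @ Y @ [?ep])" by (fact arcs)
    show "\<not> isthmus G e"
    proof
      assume "isthmus G e"
      then obtain U where U: "is_cut G U" "cut_edges G U = {e}"
        by (auto simp: isthmus_def)
      have "source G x \<in> U \<longleftrightarrow> target G x \<in> U" "source G y \<in> U \<longleftrightarrow> target G y \<in> U"
        using U x y e X[OF x] Y[OF y] xd by (intro not_cut_edge; force simp: V is_cut_def)+
      then show False
        using X[OF x] Y[OF y] U(1) V unfolding is_cut_def by auto
    qed
    show "\<not> loop G e"
      using ep abc by (simp add: loop_def)
    show "cut_circ G (X @ [?ep])" "cut_circ G (Y @ [?en])" "cut_circ G (X @ Y)"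
    proof -
      have "distinct (X @ [?ep])" "distinct (Y @ [?en])" "distinct (X @ Y)"
        using dis e XY by force+
      moreover have "set (X @ [?ep]) = cut_darts G {a, c}" "set (Y @ [?en]) = cut_darts G {b, c}"
        "set (X @ Y) = cut_darts G {c}"
        by (auto simp: C)
      ultimately show "cut_circ G (X @ [?ep])" "cut_circ G (Y @ [?en])" "cut_circ G (X @ Y)"
        unfolding cut_circ_def using simple ne by blast+
    qed
    fix M
    show "e \<in> fst ` set M \<or> set M = set (X @ Y) \<or> set M = neg ` set (X @ Y)" if M: "cut_circ G M"
    proof -
      obtain U where U: "simple_cut G U" "set M = cut_darts G U"
        using M by (auto simp: cut_circ_def)
      then have "U \<in> {{c}, {a, b}, {a, c}, {b}, {b, c}, {a}}"
        using cuts[OF _ V] by (simp add: simple_cut_def)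
      then have "set M \<in> {set X \<union> set Y, neg ` (set X \<union> set Y), insert ?ep (set X), neg ` insert ?ep (set X),
          insert ?en (set Y), neg ` insert ?en (set Y)}"
        unfolding U(2) using C C' by (elim insertE emptyE) simp_all
      then show ?thesis
        by auto
    qed
  next
    show "fin_digraph ?H"
      using wfH VH arcsH by (intro wf_digraph.fin_digraphI) auto
    show "connected ?H"
      using con[OF wfH VH xdH] X[OF x] Y[OF y] unfolding H_ends by blast
    show "arcs ?H = fst ` set (X @ Y)" by (fact arcsH)
    have CH: "cut_darts ?H {a, c} = set X" "cut_darts ?H {b, c} = set Y"
      unfolding cut_darts_del_arc C using e by auto
    have CH': "cut_darts ?H {b} = neg ` set X" "cut_darts ?H {a} = neg ` set Y"
      using cut_darts_Diff[of "{a, c}" ?H] cut_darts_Diff[of "{b, c}" ?H] by (simp_all add: VH compl CH)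
    show "cut_circ ?H X" "cut_circ ?H Y"
      unfolding cut_circ_def using simpleH CH ne dis by blast+
    fix M
    show "set M \<in> {set X, neg ` set X, set Y, neg ` set Y}" if M: "cut_circ ?H M"
    proof -
      obtain U where U: "simple_cut ?H U" "set M = cut_darts ?H U"
        using M by (auto simp: cut_circ_def)
      then have "U \<in> {{c}, {a, b}, {a, c}, {b}, {b, c}, {a}}"
        using cuts[OF _ VH] by (simp add: simple_cut_def)
      moreover have "U \<noteq> {a, b}" "U \<noteq> {c}"
        using U(1) not_simpleH unfolding simple_cut_def VH by (auto simp: compl)
      ultimately show ?thesis
        unfolding U(2) using CH CH' by (elim insertE emptyE) simp_all
    qed
  qed
qed

section \<open>Complementing cut properties\<close>

lemma good_minor_dual:
  assumes "fourientation G F" "arcs K \<subseteq> arcs G"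
  shows "good_minor (dual_property P) K r F \<longleftrightarrow> good_minor P K r (dual G F)"
proof -
  have "dual K (F \<inter> darts K) = dual G F \<inter> darts K"
  proof -
    have "darts K \<subseteq> darts G"
      using assms(2) by (auto simp: darts_def)
    then show ?thesis
      by (auto simp: dual_def)
  qed
  then show ?thesis
    by (simp add: good_minor_def dual_property_def)
qed

lemma dual_app_iso:
  assumes F: "fourientation G F" and h: "pre_digraph.digraph_isomorphism G h"
  shows "dual (app_iso h G) (map_prod (iso_arcs h) id ` F) = map_prod (iso_arcs h) id ` dual G F"
proof -
  let ?m = "map_prod (iso_arcs h) id"
  have inj: "inj_on (iso_arcs h) (arcs G)"
    using h by (rule pre_digraph.digraph_isomorphism_inj_on_arcs)
  have neg: "neg (?m d) = ?m (neg d)" for d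
    by (cases d) (simp add: neg.simps)
  have inj_m: "inj_on ?m (darts G)"
    using inj by (auto simp: inj_on_def darts_def)
  have mem: "?m d \<in> ?m ` F \<longleftrightarrow> d \<in> F" if "d \<in> darts G" for d
    using F that unfolding fourientation_def by (intro inj_on_image_mem_iff[OF inj_m])
  have darts: "darts (app_iso h G) = ?m ` darts G"
    unfolding darts_def by force
  show ?thesis
  proof (intro subset_antisym subsetI)
    fix d assume d: "d \<in> dual (app_iso h G) (?m ` F)"
    then have "d \<in> ?m ` darts G" "neg d \<notin> ?m ` F"
      unfolding dual_def darts by simp_all
    then obtain c where c: "c \<in> darts G" "d = ?m c"
      by (elim imageE)
    have "?m (neg c) \<notin> ?m ` F"
      using \<open>neg d \<notin> ?m ` F\<close> unfolding c(2) neg .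
    with c have "c \<in> dual G F"
      using mem[of "neg c"] by (simp add: dual_def)
    then show "d \<in> ?m ` dual G F"
      unfolding c(2) by (rule imageI)
  next
    fix d assume "d \<in> ?m ` dual G F"
    then obtain c where c: "c \<in> dual G F" "d = ?m c"
      by (elim imageE)
    then have "c \<in> darts G" "neg c \<notin> F"
      by (auto simp: dual_def)
    then have "?m (neg c) \<notin> ?m ` F" "d \<in> darts (app_iso h G)"
      using mem[of "neg c"] unfolding darts c(2) by simp_all
    then show "d \<in> dual (app_iso h G) (?m ` F)"
      unfolding dual_def c(2) by (simp add: neg)
  qed
qed

theorem cut_system:
  fixes P :: "('v::infinite, 'e::infinite) property"
  assumes tutte: "tutte_cut_property P"
  shows "tutte_system (dual_property P) cut_pot cut_circ cut_elem cut_cm pre_digraph.del_arc"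
proof (rule tutte_system.intro, goal_cases)
  case 1
  have iso: "fourientation_property P"
    using tutte by (simp add: tutte_cut_property_def cut_property_def)
  show ?case
    unfolding fourientation_property_def dual_property_def
  proof (intro allI impI)
    fix G :: "('v, 'e) pre_digraph" and r F and h :: "('v, 'e, 'v, 'e) digraph_isomorphism"
    assume *: "ordered_graph G r" "fourientation G F" "pre_digraph.digraph_isomorphism G h"
    show "P (app_iso h G) (map_prod (iso_arcs h) (iso_arcs h) ` r)
        (dual (app_iso h G) (map_prod (iso_arcs h) id ` F)) = P G r (dual G F)"
      unfolding dual_app_iso[OF *(2,3)]
      using iso[unfolded fourientation_property_def, rule_format, OF *(1) fourientation_dual *(3)] .
  qed
next
  case (2 G r F)
  have sub: "arcs (cut_cm G (cut_edges G U)) \<subseteq> arcs G" for U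
    by (auto simp: cut_cm_def contract_def Let_def)
  have cm: "cut_minor G U = cut_cm G (cut_edges G U)" for U
    by (simp add: cut_minor_def cut_cm_def)
  have "dual_property P G r F \<longleftrightarrow> (\<forall>U. simple_cut G U \<longrightarrow> good_minor P (cut_minor G U) r (dual G F))"
    using tutte 2(1) fourientation_dual[of G F] unfolding dual_property_def tutte_cut_property_def cut_property_def by simp
  also have "\<dots> \<longleftrightarrow> (\<forall>U. simple_cut G U \<longrightarrow> good_minor (dual_property P) (cut_cm G (cut_edges G U)) r F)"
    unfolding cm using good_minor_dual[OF 2(2) sub] by simp
  also have "\<dots> \<longleftrightarrow> (\<forall>L. cut_circ G L \<longrightarrow> good_minor (dual_property P) (cut_cm G (fst ` set L)) r F)"
  proof (intro iffI allI impI)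
    fix L assume "\<forall>U. simple_cut G U \<longrightarrow> good_minor (dual_property P) (cut_cm G (cut_edges G U)) r F" "cut_circ G L"
    then show "good_minor (dual_property P) (cut_cm G (fst ` set L)) r F"
      unfolding cut_circ_def by (metis fst_cut_darts)
  next
    \<comment> \<open>A simple cut has finitely many darts and, by connectedness of
      \<open>G\<close>, at least one; so some list enumerates it.\<close>
    fix U assume good: "\<forall>L. cut_circ G L \<longrightarrow> good_minor (dual_property P) (cut_cm G (fst ` set L)) r F" and U: "simple_cut G U"
    have "finite (cut_edges G U)"
      using 2(1) by (simp add: ordered_graph_def fin_digraph.finite_arcs cut_edges_def)
    then have "finite (cut_darts G U)"
      using inj_on_fst_cut_darts finite_imageD unfolding fst_cut_darts[symmetric] by blast
    then obtain L where L: "set L = cut_darts G U" "distinct L"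
      using finite_distinct_list by blast
    moreover have "cut_edges G U \<noteq> {}"
      using ordered_graph_cut[OF 2(1)] U by (simp add: simple_cut_def)
    ultimately have "cut_circ G L"
      using U unfolding cut_circ_def fst_cut_darts[symmetric] by auto
    then show "good_minor (dual_property P) (cut_cm G (cut_edges G U)) r F"
      using good L fst_cut_darts by metis
  qed
  finally show ?case .
next
  case (3 G r F)
  have "cut_T1 P"
    using tutte by (simp add: tutte_cut_property_def)
  then obtain U where "potential_cut G (dual G F) U"
    using 3 fourientation_dual[of G F] unfolding dual_property_def cut_T1_def by blast
  then show ?case
    using dual_dual[of F G] 3(2) unfolding potential_cut_iff cut_pot_def fourientation_def by auto
next
  case (4 G r e F)
  let ?H = "pre_digraph.del_arc G e"
  have F: "F \<subseteq> darts ?H" and e: "e \<in> arcs G"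
    using 4 by (auto simp: fourientation_def is_max_def)
  have darts: "darts G = darts ?H \<union> {(e, Pos), (e, Neg)}" "(e, s) \<notin> darts ?H" for s
  proof -
    have "s = Pos \<or> s = Neg" for s
      by (cases s) auto
    then show "darts G = darts ?H \<union> {(e, Pos), (e, Neg)}"
      using e by (auto simp: darts_def pre_digraph.del_arc_simps)
  qed (auto simp: darts_def pre_digraph.del_arc_simps)
  have Fe: "(e, s) \<notin> F" for s
    using F darts(2) by blast
  \<comment> \<open>Complementation exchanges the states of \<open>e\<close> with no dart and with
    both darts, and fixes the two orientations. This is what turns T2 for cuts into its form for
    cycles.\<close>
  have dual: "dual G F = dual ?H F \<union> {(e, Pos), (e, Neg)}"
    "dual G (F \<union> {(e, Pos)}) = dual ?H F \<union> {(e, Pos)}" "dual G (F \<union> {(e, Neg)}) = dual ?H F \<union> {(e, Neg)}"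
    "dual G (F \<union> {(e, Pos), (e, Neg)}) = dual ?H F"
    unfolding dual_def darts(1) using Fe darts(2) by (auto simp: neg.simps darts_def pre_digraph.del_arc_simps)
  have dual': "dual G (F \<union> {(e, s)}) = dual ?H F \<union> {(e, s)}" for s
    using dual(2,3) by (cases s) auto
  have H: "good_minor (dual_property P) ?H r F \<longleftrightarrow> good_minor P ?H r (dual ?H F)"
    by (rule good_minor_dual) (use 4 in auto)
  have "let H = ?H in
          (good_minor P H r (dual ?H F) \<longrightarrow> P G r (dual ?H F \<union> {(e, Pos)}) \<and> P G r (dual ?H F \<union> {(e, Neg)})) \<and>
          (\<not> good_minor P H r (dual ?H F) \<longrightarrow> P G r (dual ?H F \<union> {(e, Pos), (e, Neg)}) \<longrightarrow>
             (\<exists>!\<epsilon>. P G r (dual ?H F \<union> {(e, \<epsilon>)}))) \<and>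
          (good_minor P H r (dual ?H F) \<longleftrightarrow> P G r (dual ?H F))"
  proof -
    have "cut_T2 P"
      using tutte by (simp add: tutte_cut_property_def)
    from this[unfolded cut_T2_def Let_def, rule_format, OF 4(1-4) fourientation_dual] show ?thesis
      unfolding Let_def .
  qed
  then show ?case
    unfolding Let_def H dual_property_def dual dual' .
next
  case (5 G L)
  then show ?case by (rule cut_circ_edges)
next
  case (6 G L)
  then show ?case by (rule cut_circ_neg)
next
  case (7 G r L)
  then show ?case by (rule cut_circ_elem)
next
  case (8 K L)
  then show ?case
    by (simp add: cut_elem_def rotate1_map[symmetric])
next
  case (9 K L)
  then show ?case by (rule cut_elem_neg)
next
  case (10 K L)
  then show ?case by (rule cut_elem_graph)
next
  case (11 K L D)
  then show ?case
    using cut_elem_cut unfolding cut_pot_def by blast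
next
  case (12 K L K' h)
  then show ?case
    using cut_elem_iso by blast
next
  case (13 L)
  then show ?case
    by (rule cut_elem_ex[OF infinite_UNIV])
next
  case (14 K L e s)
  then show ?case
    using cut_elem_minor[OF 14(1,2)] by blast
next
  case (15 X Y e)
  show ?case
    by (rule cut_pair_ex[OF infinite_UNIV 15])
next
  case (16 G L)
  then show ?case
    unfolding cut_circ_def cut_pot_def simple_cut_def by blast
next
  case (17 G r D d)
  then show ?case by (rule cut_pot_circ_sub)
next
  case (18 G r D)
  then show ?case
    using ordered_graph_cut unfolding cut_pot_def by (auto simp: fst_cut_darts[symmetric])
qed

lemma dual_iff: "e \<in> arcs G \<Longrightarrow> (e, s) \<in> dual G F \<longleftrightarrow> (e, opp s) \<notin> F"
  by (simp add: dual_def darts_def neg.simps)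

lemma min_oriented_dual:
  assumes "A \<subseteq> arcs G"
  shows "min_oriented r (dual G F) A \<delta> \<longleftrightarrow> min_oriented r F A \<delta>"
proof -
  have or: "oriented (dual G F) e \<longleftrightarrow> oriented F e" and mem: "oriented F e \<Longrightarrow> (e, \<delta>) \<in> dual G F \<longleftrightarrow> (e, \<delta>) \<in> F"
    if "e \<in> A" for e
  proof -
    have "e \<in> arcs G"
      using assms that by blast
    then show "oriented (dual G F) e \<longleftrightarrow> oriented F e"
      and "oriented F e \<Longrightarrow> (e, \<delta>) \<in> dual G F \<longleftrightarrow> (e, \<delta>) \<in> F"
      unfolding oriented_def ex1_sign by (cases \<delta>; auto simp: dual_iff)+
  qed
  have "{e \<in> A. oriented (dual G F) e} = {e \<in> A. oriented F e}"
    using or by blast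
  then show ?thesis
    unfolding min_oriented_def is_min_def using mem by auto
qed

text \<open>On a single edge complementation sends the sign set \<open>S\<close> to
  \<open>{\<epsilon>. opp \<epsilon> \<notin> S}\<close>: the empty set becomes the set of both
  signs, and singletons stay. A potential cut has no bioriented edge, so the three listed sets are
  the possible ones.\<close>

lemma min_bad_dual:
  assumes "potential_cut G F U"
  shows "min_bad X \<delta> r (dual G F) (cut_darts G U) \<longleftrightarrow>
    bad_cut {S \<in> {{}, {Neg}, {Pos}}. {\<epsilon>. opp \<epsilon> \<notin> S} \<in> X} \<delta> G r F U"
proof -
  have "(signs (dual G F) e \<in> X \<longleftrightarrow> signs F e \<in> {S \<in> {{}, {Neg}, {Pos}}. {\<epsilon>. opp \<epsilon> \<notin> S} \<in> X}) \<and>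
      (bioriented (dual G F) e \<longleftrightarrow> unoriented F e)" if e: "e \<in> cut_edges G U" for e
  proof -
    have arc: "e \<in> arcs G"
      using e by (simp add: cut_edges_def)
    obtain s where "(e, s) \<in> cut_darts G U"
      using e unfolding fst_cut_darts[symmetric] by auto
    then have "opp s \<notin> signs F e"
      using assms by (auto simp: potential_cut_def signs_def)
    moreover have "signs F e \<subseteq> {Neg, Pos}"
      using sign.exhaust by blast
    ultimately have "signs F e \<in> {{}, {Neg}, {Pos}}"
      by (cases s) auto
    moreover have "signs (dual G F) e = {\<epsilon>. opp \<epsilon> \<notin> signs F e}"
      by (simp add: signs_def dual_iff[OF arc])
    ultimately show ?thesis
      by (auto simp: bioriented_def unoriented_def dual_iff[OF arc])
  qed
  then show ?thesis
    unfolding min_bad_def bad_cut_def fst_cut_darts is_min_def by blast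
qed

theorem cut_classification:
  fixes P :: "('v::infinite, 'e::infinite) property"
  assumes tutte: "tutte_cut_property P"
  shows "(\<exists>X \<delta>. X \<subseteq> {{}, {Neg}, {Pos}} \<and> same_property P (min_edge_cut X \<delta>))
            \<or> same_property P cut_weird \<or> same_property P cut_coweird"
proof -
  have P_dual: "dual_property P G r (dual G F) = P G r F" if "fourientation G F" for G r F
    using that dual_dual[of F G] by (simp add: dual_property_def fourientation_def)
  have pot: "(\<forall>D\<in>cut_pot G. D \<subseteq> dual G F \<longrightarrow> Q D) \<longleftrightarrow> (\<forall>U. potential_cut G F U \<longrightarrow> Q (cut_darts G U))"
    for G :: "('v, 'e) pre_digraph" and F Q
    unfolding cut_pot_def potential_cut_iff by blast
  from tutte_system.classification[OF cut_system[OF tutte]] show ?thesis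
  proof (elim disjE exE conjE)
    fix X \<delta>
    assume min: "\<forall>G r F. ordered_graph G r \<longrightarrow> fourientation G F \<longrightarrow>
      (dual_property P G r F \<longleftrightarrow> (\<forall>D\<in>cut_pot G. D \<subseteq> F \<longrightarrow> \<not> min_bad X \<delta> r F D))"
    let ?X = "{S \<in> {{}, {Neg}, {Pos}}. {\<epsilon>. opp \<epsilon> \<notin> S} \<in> X}"
    have "P G r F \<longleftrightarrow> min_edge_cut ?X \<delta> G r F" if "ordered_graph G r" "fourientation G F" for G r F
      using min[rule_format, OF that(1) fourientation_dual, of F] min_bad_dual[of G F _ X \<delta> r]
      unfolding P_dual[OF that(2)] pot min_edge_cut_def by blast
    then have "same_property P (min_edge_cut ?X \<delta>)"
      unfolding same_property_def by blast
    then show ?thesis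
      by (intro disjI1 exI[of _ ?X] exI[of _ \<delta>]) blast
  next
    fix \<delta>
    assume weird: "\<forall>G r F. ordered_graph G r \<longrightarrow> fourientation G F \<longrightarrow>
      (dual_property P G r F \<longleftrightarrow> (\<forall>D\<in>cut_pot G. D \<subseteq> F \<longrightarrow> min_oriented r F (fst ` D) \<delta>))"
    have "P G r F \<longleftrightarrow> (\<forall>U. potential_cut G F U \<longrightarrow> min_oriented r F (cut_edges G U) \<delta>)"
      if "ordered_graph G r" "fourientation G F" for G r F
    proof -
      have sub: "cut_edges G U \<subseteq> arcs G" for U
        by (auto simp: cut_edges_def)
      show ?thesis
        using weird[rule_format, OF that(1) fourientation_dual, of F]
        unfolding P_dual[OF that(2)] pot fst_cut_darts min_oriented_dual[OF sub] .
    qed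
    then show ?thesis
      unfolding same_property_def cut_weird_def cut_coweird_def by (cases \<delta>) simp_all
  qed
qed

section \<open>Cycles\<close>

fun dwalk :: "('v, 'e) pre_digraph \<Rightarrow> 'v \<Rightarrow> 'e dart list \<Rightarrow> 'v \<Rightarrow> bool" where
  "dwalk G u [] v \<longleftrightarrow> u = v"
| "dwalk G u (d # L) v \<longleftrightarrow> source G d = u \<and> dwalk G (target G d) L v"

text \<open>A directed cycle stripped of its vertices, which are recovered as the sources of the
  darts.\<close>

definition closed_trail :: "('v, 'e) pre_digraph \<Rightarrow> 'e dart list \<Rightarrow> bool" where
  "closed_trail G L \<longleftrightarrow> L \<noteq> [] \<and> (\<exists>u. dwalk G u L u) \<and> distinct (map fst L) \<and> fst ` set L \<subseteq> arcs G"

definition cycle_pot :: "('v, 'e) pre_digraph \<Rightarrow> 'e dart set set" where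
  "cycle_pot G = {set L | L. closed_trail G L}"

definition cycle_circ :: "('v, 'e) pre_digraph \<Rightarrow> 'e dart list \<Rightarrow> bool" where
  "cycle_circ G L \<longleftrightarrow> closed_trail G L \<and> distinct (map (source G) L)"

definition cycle_elem :: "('v, 'e) pre_digraph \<Rightarrow> 'e dart list \<Rightarrow> bool" where
  "cycle_elem K L \<longleftrightarrow> cycle_circ K L \<and> verts K = source K ` set L \<and> arcs K = fst ` set L"

definition cycle_cm :: "('v, 'e) pre_digraph \<Rightarrow> 'e set \<Rightarrow> ('v, 'e) pre_digraph" where
  "cycle_cm G E = G\<lparr>verts := tail G ` E \<union> head G ` E, arcs := E\<rparr>"

lemma dwalk_append: "dwalk G u (L @ M) w \<longleftrightarrow> (\<exists>v. dwalk G u L v \<and> dwalk G v M w)"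
  by (induction L arbitrary: u) auto

lemma dwalk_rev: "dwalk G u L v \<Longrightarrow> dwalk G v (rev (map neg L)) u"
  by (induction L arbitrary: u) (auto simp: dwalk_append)

lemma dwalk_targets: "dwalk G u L v \<Longrightarrow> u # map (target G) L = map (source G) L @ [v]"
  by (induction L arbitrary: u) auto

lemma dwalk_side:
  assumes "dwalk G u L v" "\<And>d. d \<in> set L \<Longrightarrow> source G d \<in> U \<longleftrightarrow> target G d \<in> U"
  shows "u \<in> U \<longleftrightarrow> v \<in> U"
  using assms by (induction L arbitrary: u) auto

lemma dwalk_arc_closed:
  assumes "dwalk G u L v" "fst ` set L \<subseteq> arcs G" "arc_closed G S" "u \<in> S"
  shows "source G ` set L \<subseteq> S"
  using assms
proof (induction L arbitrary: u)
  case (Cons d L)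
  have "d \<in> darts G"
    using Cons.prems(2) by (cases d) (auto simp: darts_def)
  then have "target G d \<in> S"
    using arc_closed_dart[OF Cons.prems(3), of d] Cons.prems(1,4) by simp
  then show ?case
    using Cons by auto
qed simp

lemma closed_trail_targets:
  assumes "closed_trail G L"
  shows "map (target G) L = rotate1 (map (source G) L)"
proof -
  obtain u where u: "dwalk G u L u" and ne: "L \<noteq> []"
    using assms by (auto simp: closed_trail_def)
  obtain d M where L: "L = d # M"
    using ne by (cases L) auto
  show ?thesis
    using dwalk_targets[OF u] u unfolding L by simp
qed

lemma closed_trail_next:
  assumes "closed_trail G L" "i < length L"
  shows "target G (L ! i) = source G (L ! (Suc i mod length L))"
proof -
  have "Suc i mod length L < length L"
    using assms(2) by (intro mod_less_divisor) auto
  have "target G (L ! i) = map (target G) L ! i"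
    using assms(2) by simp
  also have "\<dots> = source G (L ! (Suc i mod length L))"
    unfolding closed_trail_targets[OF assms(1)] using assms(2)
      \<open>Suc i mod length L < length L\<close> by (simp add: nth_rotate1)
  finally show ?thesis .
qed

lemma closed_dwalkI:
  assumes "L \<noteq> []" "\<And>i. i < length L \<Longrightarrow> target G (L ! i) = source G (L ! (Suc i mod length L))"
  shows "\<exists>u. dwalk G u L u"
proof -
  have walk: "dwalk G (source G (hd M)) M (target G (last M))"
    if "M \<noteq> []" "\<And>i. Suc i < length M \<Longrightarrow> target G (M ! i) = source G (M ! Suc i)" for M
    using that
  proof (induction M)
    case (Cons d M)
    show ?case
    proof (cases "M = []")
      case False
      have "target G d = source G (hd M)"
        using Cons.prems(2)[of 0] False by (simp add: hd_conv_nth)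
      moreover have "dwalk G (source G (hd M)) M (target G (last M))"
        using Cons.prems(2)[of "Suc _"] False by (intro Cons.IH) auto
      ultimately show ?thesis using False by simp
    qed simp
  qed simp
  have "dwalk G (source G (hd L)) L (target G (last L))"
    using assms by (intro walk) (auto simp: mod_less)
  moreover have "target G (last L) = source G (hd L)"
    using assms(2)[of "length L - 1"] assms(1) by (simp add: last_conv_nth hd_conv_nth)
  ultimately show ?thesis by auto
qed

lemma closed_trail_rotate1: "closed_trail G L \<Longrightarrow> closed_trail G (rotate1 L)"
  by (cases L) (auto simp: closed_trail_def dwalk_append)

lemma closed_trail_neg: "closed_trail G L \<Longrightarrow> closed_trail G (rev (map neg L))"
  using dwalk_rev by (fastforce simp: closed_trail_def rev_map[symmetric] comp_def image_image)

lemma cycle_circ_rotate1: "cycle_circ G L \<Longrightarrow> cycle_circ G (rotate1 L)"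
  using closed_trail_rotate1 by (auto simp: cycle_circ_def rotate1_map[symmetric])

lemma cycle_circ_neg: "cycle_circ G L \<Longrightarrow> cycle_circ G (rev (map neg L))"
proof -
  assume L: "cycle_circ G L"
  have "map (source G) (rev (map neg L)) = rev (map (target G) L)"
    by (simp add: rev_map)
  then show ?thesis
    using L closed_trail_neg closed_trail_targets[of G L] by (auto simp: cycle_circ_def)
qed

lemma cycle_circ_targets: "cycle_circ G L \<Longrightarrow> distinct (map (target G) L)"
  using closed_trail_targets[of G L] by (simp add: cycle_circ_def)

lemma target_in_sources: "closed_trail G L \<Longrightarrow> target G ` set L = source G ` set L"
  using closed_trail_targets[of G L] by (metis list.set_map set_rotate1)

lemma source_inj: "cycle_circ G L \<Longrightarrow> d \<in> set L \<Longrightarrow> d' \<in> set L \<Longrightarrow> source G d = source G d' \<Longrightarrow> d = d'"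
  by (auto simp: cycle_circ_def distinct_map dest: inj_onD)

lemma target_inj: "cycle_circ G L \<Longrightarrow> d \<in> set L \<Longrightarrow> d' \<in> set L \<Longrightarrow> target G d = target G d' \<Longrightarrow> d = d'"
  using cycle_circ_targets[of G L] by (auto simp: distinct_map dest: inj_onD)

lemma edge_inj: "closed_trail G L \<Longrightarrow> d \<in> set L \<Longrightarrow> d' \<in> set L \<Longrightarrow> fst d = fst d' \<Longrightarrow> d = d'"
  by (auto simp: closed_trail_def distinct_map dest: inj_onD)

text \<open>The successor of \<open>d\<close> cannot be \<open>neg d\<close>, since a trail uses
  each edge only once. This also covers a loop, which is its own successor.\<close>

lemma closed_trail_ex_next:
  assumes "closed_trail G M" "d \<in> set M"
  shows "\<exists>d'\<in>set M. source G d' = target G d \<and> d' \<noteq> neg d"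
proof -
  obtain d' where d': "d' \<in> set M" "source G d' = target G d"
    using target_in_sources[OF assms(1)] assms(2) by (metis image_iff)
  moreover have "d' \<noteq> neg d"
    using edge_inj[OF assms(1) d'(1) assms(2)] by auto
  ultimately show ?thesis by blast
qed

text \<open>Going round from the position of \<open>d\<close> reaches every index.\<close>

lemma cyclic_closed:
  assumes step: "\<And>i. i < length L \<Longrightarrow> L ! i \<in> A \<Longrightarrow> L ! (Suc i mod length L) \<in> A"
    and d: "d \<in> set L" "d \<in> A"
  shows "set L \<subseteq> A"
proof -
  let ?n = "length L"
  obtain j where j: "j < ?n" "L ! j \<in> A"
    using d by (metis in_set_conv_nth)
  have "L ! ((j + k) mod ?n) \<in> A" for k
  proof (induction k)
    case (Suc k)
    have "(j + k) mod ?n < ?n"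
      using j(1) by (intro mod_less_divisor) auto
    from step[OF this Suc] show ?case
      by (simp add: mod_Suc_eq)
  qed (use j in simp)
  \<comment> \<open>The number of steps is \<open>i - j\<close> modulo the length; adding the length
    first keeps the subtraction within the natural numbers.\<close>
  moreover have "\<exists>k. i = (j + k) mod ?n" if "i < ?n" for i
    using that j(1) by (intro exI[of _ "i + ?n - j"]) simp
  ultimately show ?thesis
    by (metis in_set_conv_nth subsetI)
qed

lemma cycle_circ_edges: "cycle_circ G L \<Longrightarrow> L \<noteq> [] \<and> distinct (map fst L) \<and> fst ` set L \<subseteq> arcs G"
  by (simp add: cycle_circ_def closed_trail_def)

text \<open>Only one dart of \<open>M\<close> leaves a given vertex, so the successor in
  \<open>L\<close> of a common dart is also its successor in \<open>M\<close>.\<close>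

lemma cycle_circ_minimal:
  assumes "cycle_circ G L" "cycle_circ G M" "set L \<subseteq> set M"
  shows "set L = set M"
proof -
  have "M ! (Suc i mod length M) \<in> set L" if i: "i < length M" "M ! i \<in> set L" for i
  proof -
    obtain d' where d': "d' \<in> set L" "source G d' = target G (M ! i)"
      using closed_trail_ex_next[of G L] assms(1) i(2) unfolding cycle_circ_def by blast
    have "Suc i mod length M < length M"
      using i(1) by (intro mod_less_divisor) auto
    moreover have "source G (M ! (Suc i mod length M)) = source G d'"
      using closed_trail_next[of G M, OF _ i(1)] assms(2) d'(2) by (simp add: cycle_circ_def)
    ultimately have "M ! (Suc i mod length M) = d'"
      using d'(1) assms(3) by (intro source_inj[OF assms(2)]) auto
    then show ?thesis
      using d' by simp
  qed
  moreover obtain d where "d \<in> set L"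
    using cycle_circ_edges[OF assms(1)] by (meson last_in_set)
  ultimately have "set M \<subseteq> set L"
    using assms(3) by (intro cyclic_closed[of M "set L" d]) auto
  then show ?thesis
    using assms(3) by blast
qed

lemma dart_mem: "fst d \<in> arcs G \<longleftrightarrow> d \<in> darts G"
  by (cases d) (simp add: darts_def)

section \<open>Cycle graphs\<close>

text \<open>Just two darts leave a vertex of a cycle graph, one forwards and one backwards.\<close>

lemma cycle_elem_next:
  assumes K: "cycle_elem K L" and i: "i < length L" and d: "d \<in> darts K" "source K d = target K (L ! i)"
  shows "d = L ! (Suc i mod length L) \<or> d = neg (L ! i)"
proof -
  have circ: "cycle_circ K L" and arcs: "arcs K = fst ` set L"
    using K by (auto simp: cycle_elem_def)
  have suc: "L ! (Suc i mod length L) \<in> set L"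
    using i by (intro nth_mem mod_less_divisor) auto
  consider "d \<in> set L" | "neg d \<in> set L"
    using d(1) unfolding darts_eq[OF arcs] by auto
  then show ?thesis
  proof cases
    case 1
    have "source K d = source K (L ! (Suc i mod length L))"
      using closed_trail_next[of K L, OF _ i] circ d(2) by (simp add: cycle_circ_def)
    then show ?thesis
      using source_inj[OF circ 1 suc] by blast
  next
    case 2
    then have "neg d = L ! i"
      using target_inj[OF circ 2 nth_mem[OF i]] d(2) by simp
    then show ?thesis
      by (metis neg_neg)
  qed
qed

text \<open>A trail never turns back, so in a cycle graph it has to follow \<open>L\<close> all the
  way round once it shares a dart with it.\<close>

lemma cycle_elem_sub:
  assumes K: "cycle_elem K L" and M: "closed_trail K M" and d: "d \<in> set L" "d \<in> set M"
  shows "set M = set L"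
proof -
  have arcs: "arcs K = fst ` set L"
    using K by (auto simp: cycle_elem_def)
  have step: "L ! (Suc i mod length L) \<in> set M" if i: "i < length L" "L ! i \<in> set M" for i
  proof -
    obtain d' where d': "d' \<in> set M" "source K d' = target K (L ! i)" "d' \<noteq> neg (L ! i)"
      using closed_trail_ex_next[OF M i(2)] by blast
    have "d' \<in> darts K"
      using d'(1) M by (auto simp: closed_trail_def dart_mem[symmetric])
    then show ?thesis
      using cycle_elem_next[OF K i(1) _ d'(2)] d' by auto
  qed
  have sub: "set L \<subseteq> set M"
    using cyclic_closed[OF step d] .
  have "m \<in> set L" if m: "m \<in> set M" for m
  proof -
    have "fst m \<in> fst ` set L"
      using m M arcs by (auto simp: closed_trail_def)
    then obtain l where "l \<in> set L" "fst m = fst l"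
      by blast
    then show ?thesis
      using edge_inj[OF M m] sub by blast
  qed
  then show ?thesis
    using sub by blast
qed

lemma cycle_elem_Pot:
  assumes K: "cycle_elem K L" and D: "D \<in> cycle_pot K"
  shows "D = set L \<or> D = neg ` set L"
proof -
  obtain M where M: "closed_trail K M" "D = set M"
    using D by (auto simp: cycle_pot_def)
  have arcs: "arcs K = fst ` set L"
    using K by (auto simp: cycle_elem_def)
  obtain m where m: "m \<in> set M"
    using M(1) unfolding closed_trail_def by (meson last_in_set)
  then have "m \<in> darts K"
    using M(1) by (auto simp: closed_trail_def dart_mem[symmetric])
  then consider "m \<in> set L" | "neg m \<in> set L"
    unfolding darts_eq[OF arcs] by auto
  then show ?thesis
  proof cases
    case 1
    then show ?thesis
      using cycle_elem_sub[OF K M(1) 1 m] M(2) by blast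
  next
    case 2
    have "set (rev (map neg M)) = set L"
      using m by (intro cycle_elem_sub[OF K closed_trail_neg[OF M(1)] 2]) simp
    then have "neg ` set M = set L"
      by simp
    then have "neg ` neg ` set M = neg ` set L"
      by simp
    then show ?thesis
      unfolding M(2) by (simp add: image_image)
  qed
qed

lemma cycle_elem_wf: "cycle_elem K L \<Longrightarrow> wf_digraph K"
proof
  fix e assume K: "cycle_elem K L" and e: "e \<in> arcs K"
  then have "e \<in> fst ` set L"
    by (simp add: cycle_elem_def)
  then obtain s where es: "(e, s) \<in> set L"
    by auto
  have "target K ` set L = source K ` set L"
    using K target_in_sources[of K L] by (simp add: cycle_elem_def cycle_circ_def)
  then have "source K (e, s) \<in> verts K" "target K (e, s) \<in> verts K"
    using es K unfolding cycle_elem_def by blast+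
  then show "tail K e \<in> verts K" "head K e \<in> verts K"
    by (cases s; simp)+
qed

lemma cycle_elem_graph: "cycle_elem K L \<Longrightarrow> fin_digraph K \<and> connected K \<and> arcs K = fst ` set L"
proof (intro conjI)
  assume K: "cycle_elem K L"
  show arcs: "arcs K = fst ` set L"
    using K by (simp add: cycle_elem_def)
  have V: "verts K = source K ` set L"
    using K by (simp add: cycle_elem_def)
  show "fin_digraph K"
    using cycle_elem_wf[OF K] V arcs by (intro wf_digraph.fin_digraphI) auto
  obtain u where u: "dwalk K u L u" "L \<noteq> []"
    using K by (auto simp: cycle_elem_def cycle_circ_def closed_trail_def)
  then have "u \<in> verts K"
    unfolding V by (cases L) auto
  then show "connected K"
    using dwalk_arc_closed[OF u(1)] arcs V by (intro connectedI[OF cycle_elem_wf[OF K], of u]) auto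
qed

lemma cycle_circ_elem: "cycle_circ G L \<Longrightarrow> cycle_elem (cycle_cm G (fst ` set L)) L"
proof -
  assume L: "cycle_circ G L"
  let ?K = "cycle_cm G (fst ` set L)"
  have ends: "source ?K d = source G d" "target ?K d = target G d" for d
    by (cases d; cases "snd d"; simp add: cycle_cm_def)+
  have walk: "dwalk ?K u M v = dwalk G u M v" for u M v
    by (induction M arbitrary: u) (auto simp: ends)
  have "{tail G (fst d), head G (fst d)} = {source G d, target G d}" for d
    by (cases d; cases "snd d"; auto)
  moreover have "tail G ` fst ` set L \<union> head G ` fst ` set L = (\<Union>d\<in>set L. {tail G (fst d), head G (fst d)})"
    by blast
  ultimately have "tail G ` fst ` set L \<union> head G ` fst ` set L = source G ` set L \<union> target G ` set L"
    by blast
  then have V: "verts ?K = source G ` set L"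
    using target_in_sources[of G L] L by (simp add: cycle_cm_def cycle_circ_def)
  have src: "source ?K = source G"
    by (simp add: fun_eq_iff ends)
  show ?thesis
    using L unfolding cycle_elem_def cycle_circ_def closed_trail_def V walk src
    by (simp add: cycle_cm_def)
qed

lemma cycle_elem_rotate1: "cycle_elem K L \<Longrightarrow> cycle_elem K (rotate1 L)"
  using cycle_circ_rotate1 by (auto simp: cycle_elem_def)

lemma cycle_elem_neg: "cycle_elem K L \<Longrightarrow> cycle_elem K (rev (map neg L))"
  using cycle_circ_neg target_in_sources[of K L]
  by (auto simp: cycle_elem_def cycle_circ_def image_image)

lemma cycle_elem_iso:
  assumes K: "cycle_elem K L" and K': "cycle_elem K' (map (map_prod h id) L)"
  shows "\<exists>g. inj_on g (verts K) \<and> g ` verts K = verts K' \<and>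
          (\<forall>e\<in>arcs K. tail K' (h e) = g (tail K e) \<and> head K' (h e) = g (head K e))"
proof -
  let ?m = "map_prod h id"
  have circ: "cycle_circ K L" "cycle_circ K' (map ?m L)" and V: "verts K = source K ` set L"
    and V': "verts K' = source K' ` ?m ` set L"
    using K K' by (auto simp: cycle_elem_def)
  \<comment> \<open>Vertices correspond as sources of corresponding darts, which is unambiguous as
    the sources are distinct. Targets then match because each one is the next source.\<close>
  define g where "g v = source K' (?m (the_inv_into (set L) (source K) v))" for v
  have inj: "inj_on (source K) (set L)"
    using circ(1) by (simp add: cycle_circ_def distinct_map)
  have gs: "g (source K d) = source K' (?m d)" if "d \<in> set L" for d
    using that inj by (simp add: g_def the_inv_into_f_f)
  have gt: "g (target K d) = target K' (?m d)" if d: "d \<in> set L" for d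
  proof -
    obtain i where i: "i < length L" "d = L ! i"
      using d by (metis in_set_conv_nth)
    have si: "Suc i mod length L < length L"
      using i(1) by (intro mod_less_divisor) auto
    have "target K d = source K (L ! (Suc i mod length L))"
      using closed_trail_next[of K L i] circ(1) i by (simp add: cycle_circ_def)
    moreover have "target K' (?m d) = source K' (?m (L ! (Suc i mod length L)))"
      using closed_trail_next[of K' "map ?m L" i] circ(2) i si by (simp add: cycle_circ_def)
    ultimately show ?thesis
      using gs[OF nth_mem[OF si]] by simp
  qed
  have "inj_on g (verts K)"
    unfolding V
  proof (rule inj_onI, elim imageE)
    fix x y d d' assume *: "g x = g y" "x = source K d" "y = source K d'" "d \<in> set L" "d' \<in> set L"
    then have "?m d = ?m d'"
      using gs by (intro source_inj[OF circ(2)]) auto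
    moreover have "inj_on ?m (set L)"
      using circ(2) cycle_circ_edges[OF circ(2)] by (metis distinct_map)
    ultimately show "x = y"
      using * by (auto dest: inj_onD)
  qed
  moreover have "g ` verts K = verts K'"
    unfolding V V' using gs by (simp add: image_image)
  moreover have "tail K' (h e) = g (tail K e) \<and> head K' (h e) = g (head K e)" if "e \<in> arcs K" for e
  proof -
    have "e \<in> fst ` set L"
      using that K by (simp add: cycle_elem_def)
    then obtain s where "(e, s) \<in> set L" by auto
    then show ?thesis
      using gs[of "(e, s)"] gt[of "(e, s)"] by (cases s) simp_all
  qed
  ultimately show ?thesis by blast
qed

text \<open>The dart at position \<open>i\<close> joins \<open>v i\<close> to the cyclically next
  vertex; a list of length one yields a loop.\<close>

lemma cycle_elem_ex:
  assumes inf: "infinite (UNIV :: 'v set)" and L: "L \<noteq> []" "distinct (map fst L)"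
  shows "\<exists>K :: ('v, 'e) pre_digraph. cycle_elem K L"
proof -
  obtain v :: "nat \<Rightarrow> 'v" where v: "inj v"
    using infinite_countable_subset[OF inf] by blast
  let ?n = "length L"
  define idx where "idx d = (SOME i. i < ?n \<and> L ! i = d)" for d
  have idx: "idx (L ! i) = i" if "i < ?n" for i
  proof -
    have "\<exists>j. j < ?n \<and> L ! j = L ! i"
      using that by blast
    then have "idx (L ! i) < ?n \<and> L ! idx (L ! i) = L ! i"
      unfolding idx_def by (rule someI_ex)
    moreover have "distinct L"
      using L(2) by (simp add: distinct_map)
    ultimately show ?thesis
      using that nth_eq_iff_index_eq by blast
  qed
  have mem: "v (idx d) \<in> v ` {..<?n} \<and> v (Suc (idx d) mod ?n) \<in> v ` {..<?n}" if "d \<in> set L" for d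
    using that idx L(1) by (auto simp: in_set_conv_nth intro!: imageI mod_less_divisor)
  obtain K where V: "verts K = v ` {..<?n}" and arcs: "arcs K = fst ` set L"
    and ends: "\<forall>d\<in>set L. source K d = v (idx d) \<and> target K d = v (Suc (idx d) mod ?n)"
    using graph_with_darts[OF L(2), of "\<lambda>d. v (idx d)" "v ` {..<?n}" "\<lambda>d. v (Suc (idx d) mod ?n)"] mem by blast
  have src: "source K (L ! i) = v i" "target K (L ! i) = v (Suc i mod ?n)" if "i < ?n" for i
    using ends that idx by simp_all
  have "\<exists>u. dwalk K u L u"
    using L(1) src by (intro closed_dwalkI) simp_all
  moreover have sources: "map (source K) L = map v [0..<?n]"
    using src by (intro nth_equalityI) auto
  have "distinct (map (source K) L)"
    unfolding sources distinct_map using inj_on_subset[OF v subset_UNIV] by simp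
  moreover have "verts K = source K ` set L"
    unfolding V set_map[symmetric] sources by (auto simp: atLeast0LessThan)
  ultimately show ?thesis
    using L arcs unfolding cycle_elem_def cycle_circ_def closed_trail_def by blast
qed

section \<open>Contracting an edge\<close>

text \<open>Makes the choice in \<open>contract\<close> explicit for one edge: the merged vertex is
  one of its two ends, and it is left open which.\<close>

lemma contract_edge:
  assumes wf: "wf_digraph G" and e: "e \<in> arcs G"
  obtains rep where "contract G {e} = \<lparr>verts = rep ` verts G, arcs = arcs G - {e},
      tail = \<lambda>f. rep (tail G f), head = \<lambda>f. rep (head G f)\<rparr>"
    "rep (tail G e) = rep (head G e)" "rep (tail G e) \<in> {tail G e, head G e}"
    "\<And>v. v \<in> verts G \<Longrightarrow> v \<notin> {tail G e, head G e} \<Longrightarrow> rep v = v"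
proof -
  let ?G' = "G\<lparr>arcs := arcs G \<inter> {e}\<rparr>"
  define rep where "rep v = (SOME w. v \<rightarrow>\<^sup>*\<^bsub>with_proj (mk_symmetric ?G')\<^esub> w)" for v
  have wf': "wf_digraph ?G'"
    using wf by (simp add: wf_digraph_def)
  have ends: "tail G e \<in> verts G" "head G e \<in> verts G"
    using wf e by (simp_all add: wf_digraph_def)
  have closed: "arc_closed ?G' S \<longleftrightarrow> (tail G e \<in> S \<longleftrightarrow> head G e \<in> S)" for S
    using e by (simp add: arc_closed_def)
  have reach: "v \<rightarrow>\<^sup>*\<^bsub>with_proj (mk_symmetric ?G')\<^esub> w \<longleftrightarrow>
      w \<in> (if v \<in> {tail G e, head G e} then {tail G e, head G e} else {v})" if v: "v \<in> verts G" for v w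
  proof -
    have vG: "v \<in> verts ?G'"
      using v by simp
    let ?S = "if v \<in> {tail G e, head G e} then {tail G e, head G e} else {v}"
    have "arc_closed ?G' ?S" "v \<in> ?S"
      unfolding closed by auto
    moreover have "?S \<subseteq> S" if "v \<in> S" "arc_closed ?G' S" for S
      using that unfolding closed by auto
    moreover have "?S \<subseteq> verts ?G'"
      using v ends by auto
    ultimately show ?thesis
      unfolding reachable_mk_symmetric_iff[OF wf' vG] by blast
  qed
  have rep: "rep v = (SOME w. w \<in> (if v \<in> {tail G e, head G e} then {tail G e, head G e} else {v}))" if "v \<in> verts G" for v
    unfolding rep_def reach[OF that] ..
  show thesis
  proof (rule that[of rep])
    show "contract G {e} = \<lparr>verts = rep ` verts G, arcs = arcs G - {e},
      tail = \<lambda>f. rep (tail G f), head = \<lambda>f. rep (head G f)\<rparr>"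
      unfolding contract_def rep_def Let_def ..
    show "rep (tail G e) = rep (head G e)"
      unfolding rep[OF ends(1)] rep[OF ends(2)] by simp
    show "rep (tail G e) \<in> {tail G e, head G e}"
      unfolding rep[OF ends(1)] by (rule someI2[of _ "tail G e"]) auto
    show "rep v = v" if "v \<in> verts G" "v \<notin> {tail G e, head G e}" for v
      unfolding rep[OF that(1)] using that(2) by simp
  qed
qed

lemma dwalk_hom:
  assumes "\<And>d. source H d = rep (source G d) \<and> target H d = rep (target G d)"
  shows "dwalk G u L v \<Longrightarrow> dwalk H (rep u) L (rep v)"
  by (induction L arbitrary: u) (use assms in auto)

lemma cycle_elem_minor:
  assumes K: "cycle_elem K (L @ [(e, s)])" and L: "L \<noteq> []"
  shows "cycle_elem (contract K {e}) L \<and> \<not> isthmus K e \<and> \<not> loop K e"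
proof -
  let ?d = "(e, s)"
  have circ: "cycle_circ K (L @ [?d])" and V: "verts K = source K ` set (L @ [?d])"
    and arcs: "arcs K = fst ` set (L @ [?d])"
    using K by (auto simp: cycle_elem_def)
  have dist: "distinct (map fst (L @ [?d]))" "distinct (map (source K) (L @ [?d]))"
    using circ by (auto simp: cycle_circ_def closed_trail_def)
  define p q where "p = source K ?d" and "q = target K ?d"
  obtain u where "dwalk K u (L @ [?d]) u"
    using circ by (auto simp: cycle_circ_def closed_trail_def)
  then have walk: "dwalk K q L p"
    by (auto simp: dwalk_append p_def q_def)
  have hd: "source K (hd L) = q" "hd L \<in> set L"
    using walk L by (cases L; simp)+
  have p: "p \<notin> source K ` set L"
    using dist(2) by (auto simp: p_def)
  then have pq: "p \<noteq> q"
    using hd by (metis imageI)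
  have ends: "{tail K e, head K e} = {p, q}"
    by (cases s) (auto simp: p_def q_def)
  have wf: "wf_digraph K"
    by (rule cycle_elem_wf[OF K])
  have eK: "e \<in> arcs K"
    by (simp add: arcs)
  obtain rep where H: "contract K {e} = \<lparr>verts = rep ` verts K, arcs = arcs K - {e},
      tail = \<lambda>f. rep (tail K f), head = \<lambda>f. rep (head K f)\<rparr>"
    and rep: "rep (tail K e) = rep (head K e)" "rep (tail K e) \<in> {tail K e, head K e}"
    "\<And>v. v \<in> verts K \<Longrightarrow> v \<notin> {tail K e, head K e} \<Longrightarrow> rep v = v"
    using contract_edge[OF wf eK] by blast
  let ?H = "contract K {e}"
  have rep_pq: "rep p = rep q" "rep q \<in> {p, q}"
    using rep(1,2) ends by (auto simp: doubleton_eq_iff)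
  have ends_H: "source ?H d = rep (source K d) \<and> target ?H d = rep (target K d)" for d
    unfolding H by (cases d; cases "snd d") auto
  have "dwalk ?H (rep q) L (rep p)"
    using dwalk_hom[of ?H rep K, OF ends_H walk] .
  then have "\<exists>u. dwalk ?H u L u"
    using rep_pq(1) by auto
  moreover have arcs_H: "arcs ?H = fst ` set L"
    using dist(1) unfolding H arcs by auto
  \<comment> \<open>\<open>p\<close> is the source of the contracted dart and of no dart in
    \<open>L\<close>, so merging it with \<open>q\<close> identifies no two sources of
    \<open>L\<close>.\<close>
  moreover have "inj_on rep (source K ` set L)"
  proof (rule inj_onI)
    fix x y assume xy: "x \<in> source K ` set L" "y \<in> source K ` set L" "rep x = rep y"
    then have "x \<in> verts K" "y \<in> verts K" "x \<noteq> p" "y \<noteq> p"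
      using V p by auto
    then show "x = y"
      using xy(3) rep(3) rep_pq unfolding ends by (metis insert_iff singletonD)
  qed
  then have "distinct (map (source ?H) L)"
    using dist(2) ends_H by (auto simp: distinct_map comp_inj_on_iff[symmetric] inj_on_def)
  moreover have "verts ?H = source ?H ` set L"
  proof -
    have "verts ?H = rep ` insert p (source K ` set L)"
      unfolding H by (simp add: V p_def)
    also have "\<dots> = rep ` source K ` set L"
      using rep_pq(1) hd by (metis imageI image_insert insert_absorb)
    finally show ?thesis
      using ends_H by (simp add: image_image)
  qed
  ultimately have "cycle_elem ?H L"
    using L dist(1) by (simp add: cycle_elem_def cycle_circ_def closed_trail_def)
  moreover have "\<not> isthmus K e"
  proof
    assume "isthmus K e"
    then obtain U where U: "is_cut K U" "cut_edges K U = {e}"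
      by (auto simp: isthmus_def)
    \<comment> \<open>\<open>L\<close> joins the two ends of \<open>e\<close> without using
      \<open>e\<close>, so no cut can consist of \<open>e\<close> alone.\<close>
    have "source K d \<in> U \<longleftrightarrow> target K d \<in> U" if d: "d \<in> set L" for d
    proof (rule not_cut_edge)
      show "U \<subseteq> verts K"
        using U(1) by (simp add: is_cut_def)
      show "d \<in> darts K"
        using d by (simp add: dart_mem[symmetric] arcs)
      show "source K d \<in> verts K"
        using d V by simp
      have "target K ` set (L @ [?d]) = verts K"
        using target_in_sources[of K "L @ [?d]"] circ V by (simp add: cycle_circ_def)
      then show "target K d \<in> verts K"
        using d by auto
      show "fst d \<notin> cut_edges K U"
        using d dist(1) U(2) by auto
    qed
    then have "q \<in> U \<longleftrightarrow> p \<in> U"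
      by (rule dwalk_side[OF walk])
    moreover have "e \<in> cut_edges K U"
      using U(2) by simp
    ultimately show False
      using ends unfolding cut_edges_def by (auto simp: doubleton_eq_iff)
  qed
  moreover have "\<not> loop K e"
    using ends pq by (auto simp: loop_def doubleton_eq_iff)
  ultimately show ?thesis by blast
qed

lemma cycle_elem_rotate: "cycle_elem K (X @ Y) \<Longrightarrow> cycle_elem K (Y @ X)"
proof -
  assume K: "cycle_elem K (X @ Y)"
  have "cycle_elem K (rotate n (X @ Y))" for n
    by (induction n) (use K cycle_elem_rotate1 in auto)
  from this[of "length X"] show ?thesis
    by (simp add: rotate_append)
qed

section \<open>The theta graph\<close>

lemma closed_trail_ex_prev:
  assumes "closed_trail G M" "d \<in> set M"
  shows "\<exists>d'\<in>set M. target G d' = source G d \<and> d' \<noteq> neg d"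
proof -
  obtain c where c: "c \<in> set (rev (map neg M))" "source G c = target G (neg d)" "c \<noteq> neg (neg d)"
    using closed_trail_ex_next[OF closed_trail_neg[OF assms(1)], of "neg d"] assms(2)
    by (metis imageI list.set_map set_rev)
  then obtain d' where "d' \<in> set M" "c = neg d'"
    by auto
  then show ?thesis
    using c by (intro bexI[of _ d']) auto
qed

text \<open>\<open>H\<close> is the cycle \<open>X @ Y\<close> with \<open>p\<close> and
  \<open>q\<close> merged, so \<open>X\<close> closes up. At an inner vertex of \<open>X\<close>
  there is still only one way on, hence a circuit meeting \<open>X\<close> contains all of
  \<open>X\<close> and equals it by minimality. After a rotation the same applies to
  \<open>Y\<close>.\<close>

lemma contract_chord_half:
  assumes K: "cycle_elem K (X @ Y)" and ne: "X \<noteq> []" "Y \<noteq> []"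
    and p: "p = source K (hd X)" and q: "q = source K (hd Y)"
    and arcs_H: "arcs H = arcs K" and ends_H: "\<And>d. source H d = rep (source K d) \<and> target H d = rep (target K d)"
    and rep_pq: "rep p = rep q" "rep q \<in> {p, q}" and rep: "\<forall>v\<in>verts K. v \<notin> {p, q} \<longrightarrow> rep v = v"
  shows "cycle_circ H X" and "cycle_circ H M \<Longrightarrow> x \<in> set X \<Longrightarrow> x \<in> set M \<Longrightarrow> set M = set X"
proof -
  note rep = rep[rule_format]
  have circ: "cycle_circ K (X @ Y)" and V: "verts K = source K ` set (X @ Y)" and arcs: "arcs K = fst ` set (X @ Y)"
    using K by (auto simp: cycle_elem_def)
  have trail: "closed_trail K (X @ Y)"
    using circ by (simp add: cycle_circ_def)
  have dist: "distinct (map fst (X @ Y))" "distinct (map (source K) (X @ Y))"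
    using circ by (auto simp: cycle_circ_def closed_trail_def)
  obtain u v where uv: "dwalk K u X v" "dwalk K v Y u"
    using trail by (auto simp: closed_trail_def dwalk_append)
  have "u = p" "v = q"
    using uv ne p q by (cases X; cases Y; simp)+
  then have walk: "dwalk K p X q"
    using uv by simp
  have hdY: "hd Y \<in> set Y" and hdX: "hd X \<in> set X"
    using ne by simp_all
  have qX: "q \<notin> source K ` set X"
    using dist(2) hdY unfolding q by auto
  have "dwalk H (rep p) X (rep q)"
    by (rule dwalk_hom[OF ends_H walk])
  then have "\<exists>u. dwalk H u X u"
    using rep_pq(1) by auto
  moreover have "inj_on rep (source K ` set X)"
  proof (rule inj_onI)
    fix x y assume xy: "x \<in> source K ` set X" "y \<in> source K ` set X" "rep x = rep y"
    then have "x \<in> verts K" "y \<in> verts K" "x \<noteq> q" "y \<noteq> q"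
      using V qX by auto
    then show "x = y"
      using xy(3) rep rep_pq by (metis insert_iff singletonD)
  qed
  then have "distinct (map (source H) X)"
    using dist(2) ends_H by (auto simp: distinct_map inj_on_def)
  ultimately show circ_H: "cycle_circ H X"
    using ne(1) dist(1) unfolding cycle_circ_def closed_trail_def arcs_H arcs by auto
  assume M: "cycle_circ H M" and x: "x \<in> set X" "x \<in> set M"
  have trail_M: "closed_trail H M"
    using M by (simp add: cycle_circ_def)
  have darts_M: "d \<in> darts K" if "d \<in> set M" for d
    using that trail_M by (auto simp: closed_trail_def dart_mem[symmetric] arcs_H)
  \<comment> \<open>The vertex \<open>v\<close> between two consecutive darts of \<open>X\<close> is
    neither \<open>p\<close> nor \<open>q\<close>: \<open>rep\<close> fixes it and maps no other
    vertex to it. So the neighbouring darts in \<open>M\<close> are governed by the cycle graph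
    \<open>K\<close>.\<close>
  have step: "X ! i \<in> set M \<longleftrightarrow> X ! Suc i \<in> set M" if i: "Suc i < length X" for i
  proof -
    define v where "v = source K (X ! Suc i)"
    have mem: "X ! Suc i \<in> set X" "X ! i \<in> set X"
      using i by simp_all
    have si: "Suc i mod length (X @ Y) = Suc i" "i < length (X @ Y)"
      using i by auto
    have nth: "(X @ Y) ! Suc i = X ! Suc i" "(X @ Y) ! i = X ! i"
      using i by (simp_all add: nth_append)
    have tv: "target K (X ! i) = v"
      using closed_trail_next[OF trail si(2)] unfolding si nth v_def by simp
    have "X ! Suc i \<noteq> X ! 0"
      using i dist(1) ne(1) by (auto simp: distinct_map nth_eq_iff_index_eq)
    then have "v \<noteq> p"
      using source_inj[OF circ, of "X ! Suc i" "hd X"] mem hdX ne(1) unfolding v_def p by (auto simp: hd_conv_nth)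
    moreover have "v \<noteq> q"
      using qX mem unfolding v_def by auto
    ultimately have v: "v \<notin> {p, q}" by simp
    have vK: "v \<in> verts K"
      using V mem unfolding v_def by simp
    have rep_v: "w = v" if "rep w = v" "w \<in> verts K" for w
      using that v rep rep_pq by (metis insert_iff singletonD)
    have tK: "target K d \<in> verts K \<and> source K d \<in> verts K" if "d \<in> darts K" for d
    proof -
      have "wf_digraph K"
        by (rule cycle_elem_wf[OF K])
      then show ?thesis
        using that by (cases d; cases "snd d") (auto simp: darts_def wf_digraph_def)
    qed
    show ?thesis
    proof
      assume "X ! i \<in> set M"
      then obtain d where d: "d \<in> set M" "source H d = target H (X ! i)" "d \<noteq> neg (X ! i)"
        using closed_trail_ex_next[OF trail_M] by blast
      have "rep (source K d) = v"
        using d(2) rep[OF vK v] unfolding ends_H[THEN conjunct1] ends_H[THEN conjunct2] tv by simp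
      then have "source K d = target K ((X @ Y) ! i)"
        using rep_v tK[OF darts_M[OF d(1)]] unfolding nth tv by blast
      from cycle_elem_next[OF K si(2) darts_M[OF d(1)] this] show "X ! Suc i \<in> set M"
        unfolding si nth using d by auto
    next
      assume "X ! Suc i \<in> set M"
      then obtain d where d: "d \<in> set M" "target H d = source H (X ! Suc i)" "d \<noteq> neg (X ! Suc i)"
        using closed_trail_ex_prev[OF trail_M] by blast
      have "rep (target K d) = v"
        using d(2) rep[OF vK v] unfolding ends_H[THEN conjunct1] ends_H[THEN conjunct2] v_def[symmetric] by simp
      then have "source K (neg d) = target K ((X @ Y) ! i)"
        using rep_v tK[OF darts_M[OF d(1)]] unfolding nth tv source_neg by blast
      moreover have "neg d \<in> darts K"
        using darts_M[OF d(1)] by simp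
      ultimately have "neg d = X ! Suc i \<or> neg d = neg (X ! i)"
        using cycle_elem_next[OF K si(2)] unfolding si nth by blast
      then show "X ! i \<in> set M"
        using d(1,3) by (metis neg_neg neg_eq_iff)
    qed
  qed
  have all: "X ! i \<in> set M \<longleftrightarrow> X ! 0 \<in> set M" if "i < length X" for i
    using that by (induction i) (use step in auto)
  obtain j where "j < length X" "x = X ! j"
    using x(1) by (metis in_set_conv_nth)
  then have "set X \<subseteq> set M"
    using all x(2) by (metis in_set_conv_nth subsetI)
  then show "set M = set X"
    using cycle_circ_minimal[OF circ_H M] by blast
qed

lemma source_cong: "tail G (fst d) = tail G' (fst d) \<Longrightarrow> head G (fst d) = head G' (fst d) \<Longrightarrow>
    source G d = source G' d \<and> target G d = target G' d"
  by (cases d; cases "snd d") auto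

lemma dwalk_cong:
  assumes "\<And>d. d \<in> set L \<Longrightarrow> source G d = source G' d \<and> target G d = target G' d"
  shows "dwalk G u L v \<longleftrightarrow> dwalk G' u L v"
  using assms by (induction L arbitrary: u) auto

text \<open>The cycle \<open>X @ Y\<close> gets the chord \<open>e\<close> from \<open>q\<close>,
  where \<open>X\<close> ends, to \<open>p\<close>, where it starts. Thus \<open>(e, Pos)\<close>
  closes \<open>X\<close> and \<open>(e, Neg)\<close> closes \<open>Y\<close>.\<close>

lemma cycle_pair_ex:
  assumes inf: "infinite (UNIV :: 'v set)" and ne: "X \<noteq> []" "Y \<noteq> []"
    and dist: "distinct (map fst (X @ Y @ [(e, Pos)]))"
  shows "\<exists>G :: ('v, 'e) pre_digraph. fin_digraph G \<and> connected G \<and> arcs G = fst ` set (X @ Y @ [(e, Pos)]) \<and>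
        \<not> isthmus G e \<and> \<not> loop G e \<and>
        cycle_circ G (X @ [(e, Pos)]) \<and> cycle_circ G (Y @ [(e, Neg)]) \<and> cycle_circ G (X @ Y) \<and>
        (\<forall>M. cycle_circ G M \<longrightarrow> e \<in> fst ` set M \<or> set M = set (X @ Y) \<or> set M = neg ` set (X @ Y)) \<and>
        fin_digraph (contract G {e}) \<and> connected (contract G {e}) \<and>
        arcs (contract G {e}) = fst ` set (X @ Y) \<and>
        cycle_circ (contract G {e}) X \<and> cycle_circ (contract G {e}) Y \<and>
        (\<forall>M. cycle_circ (contract G {e}) M \<longrightarrow> set M \<in> {set X, neg ` set X, set Y, neg ` set Y})"
proof -
  have distXY: "distinct (map fst (X @ Y))" and e: "e \<notin> fst ` set (X @ Y)"
    using dist by auto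
  obtain K0 :: "('v, 'e) pre_digraph" where K0: "cycle_elem K0 (X @ Y)"
    using cycle_elem_ex[OF inf _ distXY] ne by auto
  define p q where "p = source K0 (hd X)" and "q = source K0 (hd Y)"
  \<comment> \<open>The ends of \<open>e\<close> are prescribed before \<open>e\<close> becomes an
    arc, so that \<open>K\<close> and \<open>G\<close> have the same tail and head
    functions.\<close>
  define K where "K = K0\<lparr>tail := (tail K0)(e := q), head := (head K0)(e := p)\<rparr>"
  have hd: "hd X \<in> set X" "hd Y \<in> set Y"
    using ne by simp_all
  have ends: "source K d = source K0 d \<and> target K d = target K0 d" if "d \<in> set (X @ Y)" for d
  proof (rule source_cong)
    have "fst d \<noteq> e"
      using that e by auto
    then show "tail K (fst d) = tail K0 (fst d)" "head K (fst d) = head K0 (fst d)"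
      by (simp_all add: K_def)
  qed
  have p: "p = source K (hd X)" and q: "q = source K (hd Y)"
    using ends hd by (simp_all add: p_def q_def)
  have src: "map (source K) (X @ Y) = map (source K0) (X @ Y)"
    using ends by (intro map_cong[OF refl]) blast
  then have src': "source K ` set (X @ Y) = source K0 ` set (X @ Y)"
    by (metis list.set_map)
  have VA: "verts K = verts K0" "arcs K = arcs K0"
    by (simp_all add: K_def)
  have walk_K: "dwalk K u (X @ Y) v = dwalk K0 u (X @ Y) v" for u v
    by (rule dwalk_cong[OF ends])
  have K: "cycle_elem K (X @ Y)"
    using K0 unfolding cycle_elem_def cycle_circ_def closed_trail_def src src' VA walk_K .
  have circ: "cycle_circ K (X @ Y)" and VK: "verts K = source K ` set (X @ Y)" and arcsK: "arcs K = fst ` set (X @ Y)"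
    using K by (auto simp: cycle_elem_def)
  have trail: "closed_trail K (X @ Y)" and sdist: "distinct (map (source K) (X @ Y))"
    using circ by (simp_all add: cycle_circ_def)
  obtain u v where uv: "dwalk K u X v" "dwalk K v Y u"
    using trail by (auto simp: closed_trail_def dwalk_append)
  have "u = p" "v = q"
    using uv ne p q by (cases X; cases Y; simp)+
  then have walk: "dwalk K p X q" "dwalk K q Y p"
    using uv by simp_all
  have qX: "q \<notin> source K ` set X" and pY: "p \<notin> source K ` set Y"
    using sdist hd unfolding q p by auto
  then have pq: "p \<noteq> q"
    using hd unfolding q p by auto
  have pqV: "p \<in> verts K" "q \<in> verts K"
    using VK hd unfolding q p by auto
  define G where "G = K\<lparr>arcs := insert e (arcs K)\<rparr>"
  have VG: "verts G = verts K" and arcsG: "arcs G = insert e (arcs K)"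
    by (simp_all add: G_def)
  have eG: "e \<in> arcs G" "tail G e = q" "head G e = p"
    by (simp_all add: G_def K_def)
  have "source G d = source K d \<and> target G d = target K d" for d
    by (rule source_cong) (simp_all add: G_def)
  then have endsG: "source G = source K" "target G = target K"
    by auto
  have walk_G: "dwalk G u M v = dwalk K u M v" for u M v
    by (rule dwalk_cong) (simp add: endsG)
  have ep: "source K (e, Pos) = q" "target K (e, Pos) = p" "source K (e, Neg) = p" "target K (e, Neg) = q"
    by (simp_all add: K_def)
  have wfK: "wf_digraph K"
    by (rule cycle_elem_wf[OF K])
  have wf: "wf_digraph G"
    using wfK pqV eG unfolding wf_digraph_def G_def by auto
  obtain rep where H: "contract G {e} = \<lparr>verts = rep ` verts G, arcs = arcs G - {e},
      tail = \<lambda>f. rep (tail G f), head = \<lambda>f. rep (head G f)\<rparr>"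
    and rep: "rep (tail G e) = rep (head G e)" "rep (tail G e) \<in> {tail G e, head G e}"
    "\<And>v. v \<in> verts G \<Longrightarrow> v \<notin> {tail G e, head G e} \<Longrightarrow> rep v = v"
    using contract_edge[OF wf eG(1)] by blast
  let ?H = "contract G {e}"
  have arcsH: "arcs ?H = arcs K" and VH: "verts ?H = rep ` verts K"
    using e arcsG arcsK unfolding H VG by auto
  have rep_pq: "rep p = rep q" "rep q \<in> {p, q}" "rep p \<in> {q, p}" "\<forall>v\<in>verts K. v \<notin> {p, q} \<longrightarrow> rep v = v"
    using rep unfolding eG VG by auto
  have ends_H: "source ?H d = rep (source K d) \<and> target ?H d = rep (target K d)" for d
    unfolding H endsG[symmetric] by (cases d; cases "snd d") auto
  have ends_H': "tail ?H f = rep (tail K f)" "head ?H f = rep (head K f)" for f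
    using ends_H[of "(f, Pos)"] by simp_all
  note X_half = contract_chord_half[OF K ne p q arcsH ends_H rep_pq(1,2,4)]
  have rep_pq': "\<forall>v\<in>verts K. v \<notin> {q, p} \<longrightarrow> rep v = v"
    using rep_pq(4) by (simp add: insert_commute)
  note Y_half = contract_chord_half[OF cycle_elem_rotate[OF K] ne(2,1) q p arcsH ends_H rep_pq(1)[symmetric] rep_pq(3) rep_pq']
  have con: "connected K" and fin: "finite (verts K)" "finite (arcs K)"
    using cycle_elem_graph[OF K] by (auto simp: fin_digraph.finite_verts fin_digraph.finite_arcs)
  have closedK: "verts K \<subseteq> S" if "v \<in> S" "v \<in> verts K" "arc_closed K S" for S v
    using con that unfolding connected_iff[OF wfK] by blast
  have wfH: "wf_digraph ?H"
    using wf unfolding H wf_digraph_def by simp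
  have eX: "e \<notin> fst ` set X" "e \<notin> fst ` set Y"
    using e by auto
  show ?thesis
  proof (intro exI[of _ G] conjI allI impI)
    show "fin_digraph G"
      using wf fin VG arcsG by (intro wf_digraph.fin_digraphI) auto
    show "connected G"
    proof (rule connectedI[OF wf])
      show "p \<in> verts G"
        using pqV VG by simp
      fix S assume S: "p \<in> S" "arc_closed G S"
      then have "arc_closed K S"
        unfolding arc_closed_def G_def by simp
      then show "verts G \<subseteq> S"
        using closedK[OF S(1) pqV(1)] VG by simp
    qed
    show "arcs G = fst ` set (X @ Y @ [(e, Pos)])"
      unfolding arcsG arcsK by auto
    show "\<not> isthmus G e"
    proof
      assume "isthmus G e"
      then obtain U where U: "is_cut G U" "cut_edges G U = {e}"
        by (auto simp: isthmus_def)
      have "source G d \<in> U \<longleftrightarrow> target G d \<in> U" if d: "d \<in> set X" for d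
      proof (rule not_cut_edge)
        show "U \<subseteq> verts G"
          using U(1) by (simp add: is_cut_def)
        show "d \<in> darts G"
          using d by (simp add: dart_mem[symmetric] arcsG arcsK)
        show "source G d \<in> verts G"
          using d VK by (simp add: endsG VG)
        have "target K ` set (X @ Y) = verts K"
          using target_in_sources[OF trail] VK by simp
        then show "target G d \<in> verts G"
          using d unfolding endsG VG by auto
        show "fst d \<notin> cut_edges G U"
          using d eX U(2) by auto
      qed
      then have "p \<in> U \<longleftrightarrow> q \<in> U"
        using dwalk_side[of G p X q U] walk(1) by (simp add: walk_G)
      moreover have "e \<in> cut_edges G U"
        using U(2) by simp
      ultimately show False
        using eG(2,3) by (auto simp: cut_edges_def)
    qed
    show "\<not> loop G e"
      using pq by (simp add: loop_def eG)
    have arcs_sub: "fst ` set X \<subseteq> arcs K" "fst ` set Y \<subseteq> arcs K"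
      using arcsK by auto
    have "dwalk K p (X @ [(e, Pos)]) p" "dwalk K q (Y @ [(e, Neg)]) q" "dwalk K p (X @ Y) p"
      using walk ep by (auto simp: dwalk_append)
    then show "cycle_circ G (X @ [(e, Pos)])" "cycle_circ G (Y @ [(e, Neg)])" "cycle_circ G (X @ Y)"
      using distXY sdist ne eX arcs_sub ep qX pY
      unfolding cycle_circ_def closed_trail_def walk_G endsG arcsG by (auto; fail)+
    fix M
    show "e \<in> fst ` set M \<or> set M = set (X @ Y) \<or> set M = neg ` set (X @ Y)" if M: "cycle_circ G M"
    proof (cases "e \<in> fst ` set M")
      case False
      \<comment> \<open>Apart from \<open>e\<close> the graph is the cycle graph \<open>K\<close>,
        whose closed trails are the two directions of \<open>X @ Y\<close>.\<close>
      then have "closed_trail K M"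
        using M unfolding cycle_circ_def closed_trail_def walk_G arcsG by auto
      then have "set M \<in> cycle_pot K"
        by (auto simp: cycle_pot_def)
      then show ?thesis
        using cycle_elem_Pot[OF K] by blast
    qed simp
  next
    show "fin_digraph ?H"
      using wfH fin VH arcsH by (intro wf_digraph.fin_digraphI) auto
    show "connected ?H"
    proof (rule connectedI[OF wfH])
      show "rep p \<in> verts ?H"
        using pqV VH by simp
      fix S assume S: "rep p \<in> S" "arc_closed ?H S"
      then have "arc_closed K {v. rep v \<in> S}"
        unfolding arc_closed_def arcsH ends_H' by simp
      then have "verts K \<subseteq> {v. rep v \<in> S}"
        using S(1) pqV(1) by (intro closedK[of p]) auto
      then show "verts ?H \<subseteq> S"
        unfolding VH by auto
    qed
    show "arcs ?H = fst ` set (X @ Y)"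
      unfolding arcsH arcsK ..
    show "cycle_circ ?H X" "cycle_circ ?H Y"
      using X_half(1) Y_half(1) by blast+
    fix M
    show "set M \<in> {set X, neg ` set X, set Y, neg ` set Y}" if M: "cycle_circ ?H M"
    proof -
      obtain m where m: "m \<in> set M"
        using cycle_circ_edges[OF M] by (meson last_in_set)
      have negM: "cycle_circ ?H (rev (map neg M))"
        using cycle_circ_neg[OF M] .
      have "neg m \<in> set (rev (map neg M))"
        using m by simp
      have "fst m \<in> fst ` set (X @ Y)"
        using m cycle_circ_edges[OF M] unfolding arcsH arcsK by auto
      then have "m \<in> darts K"
        unfolding dart_mem[symmetric] arcsK .
      then consider "m \<in> set X" | "m \<in> set Y" | "neg m \<in> set X" | "neg m \<in> set Y"
        unfolding darts_eq[OF arcsK] by auto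
      then show ?thesis
      proof cases
        case 1
        then show ?thesis using X_half(2)[OF M 1 m] by simp
      next
        case 2
        then show ?thesis using Y_half(2)[OF M 2 m] by simp
      next
        case 3
        then have "neg ` set M = set X"
          using X_half(2)[OF negM 3] m by simp
        then have "neg ` neg ` set M = neg ` set X"
          by simp
        then show ?thesis by (simp add: image_image)
      next
        case 4
        then have "neg ` set M = set Y"
          using Y_half(2)[OF negM 4] m by simp
        then have "neg ` neg ` set M = neg ` set Y"
          by simp
        then show ?thesis by (simp add: image_image)
      qed
    qed
  qed
qed

section \<open>Decomposing closed trails and translating list cycles\<close>

text \<open>At a repeated vertex a closed trail splits into two shorter ones, and \<open>d\<close>
  lies on one of them.\<close>

lemma cycle_pot_circ_sub:
  assumes "D \<in> cycle_pot G" "d \<in> D"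
  shows "\<exists>L. cycle_circ G L \<and> d \<in> set L \<and> set L \<subseteq> D"
proof -
  have "\<exists>L'. cycle_circ G L' \<and> d \<in> set L' \<and> set L' \<subseteq> set L" if "closed_trail G L" "d \<in> set L" for L
    using that
  proof (induction "length L" arbitrary: L rule: less_induct)
    case less
    show ?case
    proof (cases "distinct (map (source G) L)")
      case True
      then show ?thesis
        using less.prems unfolding cycle_circ_def by blast
    next
      case False
      then obtain as a bs cs where "map (source G) L = as @ [a] @ bs @ [a] @ cs"
        using not_distinct_decomp by blast
      then obtain xs b ys c zs where L: "L = xs @ b # ys @ c # zs" and bc: "source G b = a" "source G c = a"
        by (auto simp: map_eq_append_conv append_eq_map_conv Cons_eq_map_conv)
      obtain u where "dwalk G u L u"
        using less.prems(1) by (auto simp: closed_trail_def)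
      then have walks: "dwalk G a (b # ys) a" "dwalk G u (xs @ c # zs) u"
        using bc unfolding L by (auto simp: dwalk_append)
      have trails: "closed_trail G (b # ys)" "closed_trail G (xs @ c # zs)"
        using less.prems(1) walks unfolding L closed_trail_def by auto
      consider "d \<in> set (b # ys)" | "d \<in> set (xs @ c # zs)"
        using less.prems(2) unfolding L by auto
      then show ?thesis
      proof cases
        case 1
        then obtain L' where "cycle_circ G L'" "d \<in> set L'" "set L' \<subseteq> set (b # ys)"
          using less.hyps[of "b # ys"] trails(1) unfolding L by auto
        then show ?thesis
          unfolding L by (intro exI[of _ L']) auto
      next
        case 2
        then obtain L' where "cycle_circ G L'" "d \<in> set L'" "set L' \<subseteq> set (xs @ c # zs)"
          using less.hyps[of "xs @ c # zs"] trails(2) unfolding L by auto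
        then show ?thesis
          unfolding L by (intro exI[of _ L']) auto
      qed
    qed
  qed
  then show ?thesis
    using assms by (auto simp: cycle_pot_def)
qed

text \<open>Each vertex entry of a directed cycle is the source of its dart, so the darts carry all
  the information.\<close>

lemma directed_cycle_iff:
  "directed_cycle G c \<longleftrightarrow> closed_trail G (map snd c) \<and> c = map (\<lambda>d. (source G d, d)) (map snd c)"
proof
  assume c: "directed_cycle G c"
  have len: "length (undirected c) = length c"
    by (simp add: undirected_def)
  have snd_u: "map snd (undirected c) = map fst (map snd c)"
    by (simp add: undirected_def split_def)
  have cyc: "undirected c \<noteq> []" "distinct (map snd (undirected c))"
    "\<And>i. i < length c \<Longrightarrow> snd (undirected c ! i) \<in> arcs G"
    and ends: "\<And>i. i < length c \<Longrightarrow> source G (snd (c ! i)) = fst (c ! i) \<and>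
        target G (snd (c ! i)) = fst (c ! (Suc i mod length c))"
    using c unfolding directed_cycle_def is_cycle_def len by auto
  have ne: "c \<noteq> []"
    using cyc(1) by (auto simp: undirected_def)
  have mod: "Suc i mod length c < length c" for i
    using ne by (intro mod_less_divisor) simp
  have "\<exists>u. dwalk G u (map snd c) u"
    using ne ends mod by (intro closed_dwalkI) simp_all
  moreover have "fst ` set (map snd c) \<subseteq> arcs G"
  proof
    fix e assume "e \<in> fst ` set (map snd c)"
    then have "e \<in> set (map snd (undirected c))"
      unfolding snd_u by (simp only: set_map)
    then obtain i where "i < length c" "e = snd (undirected c ! i)"
      by (auto simp: in_set_conv_nth len)
    then show "e \<in> arcs G"
      using cyc(3) by blast
  qed
  ultimately have "closed_trail G (map snd c)"
    using ne cyc(2) unfolding closed_trail_def snd_u by simp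
  moreover have "c = map (\<lambda>d. (source G d, d)) (map snd c)"
    using ends by (intro nth_equalityI) (auto simp: prod_eq_iff)
  ultimately show "closed_trail G (map snd c) \<and> c = map (\<lambda>d. (source G d, d)) (map snd c)" ..
next
  assume *: "closed_trail G (map snd c) \<and> c = map (\<lambda>d. (source G d, d)) (map snd c)"
  have nth: "source G (snd (c ! i)) = fst (c ! i)" if "i < length c" for i
    using arg_cong[OF conjunct2[OF *], of "\<lambda>c. fst (c ! i)"] that by simp
  have ne: "c \<noteq> []"
    using * by (auto simp: closed_trail_def)
  have mod: "Suc i mod length c < length c" for i
    using ne by (intro mod_less_divisor) simp
  have ends: "source G (snd (c ! i)) = fst (c ! i) \<and> target G (snd (c ! i)) = fst (c ! (Suc i mod length c))"
    if "i < length c" for i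
    using closed_trail_next[of G "map snd c" i] * that nth[OF that] nth[OF mod] mod by simp
  have th: "{tail G (fst d), head G (fst d)} = {source G d, target G d}" for d
    by (cases d; cases "snd d"; auto)
  show "directed_cycle G c"
    unfolding directed_cycle_def is_cycle_def
  proof (intro conjI allI impI)
    show "undirected c \<noteq> []"
      using ne by (simp add: undirected_def)
    show "distinct (map snd (undirected c))"
      using * by (simp add: undirected_def closed_trail_def split_def comp_def)
    fix i assume "i < length (undirected c)"
    then have i: "i < length c"
      by (simp add: undirected_def)
    have u: "undirected c ! j = (fst (c ! j), fst (snd (c ! j)))" if "j < length c" for j
      using that by (simp add: undirected_def split_def)
    show "snd (undirected c ! i) \<in> arcs G"
      using * i unfolding u[OF i] closed_trail_def by auto
    show "{tail G (snd (undirected c ! i)), head G (snd (undirected c ! i))} =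
        {fst (undirected c ! i), fst (undirected c ! (Suc i mod length (undirected c)))}"
      using u[OF i] u[OF mod] ends[OF i] th by (simp add: undirected_def)
  qed (use ends in auto)
qed

lemma directed_cycle_darts:
  "cycle_darts c = set (map snd c)" "cycle_edges (undirected c) = fst ` set (map snd c)"
  by (auto simp: cycle_darts_def cycle_edges_def undirected_def image_image split_def)

lemma potential_cycles: "{cycle_darts c | c. directed_cycle G c} = cycle_pot G"
proof (intro subset_antisym subsetI)
  fix D assume "D \<in> cycle_pot G"
  then obtain L where L: "closed_trail G L" "D = set L"
    by (auto simp: cycle_pot_def)
  have "map snd (map (\<lambda>d. (source G d, d)) L) = L"
    by (simp add: comp_def)
  then have "directed_cycle G (map (\<lambda>d. (source G d, d)) L)" "D = cycle_darts (map (\<lambda>d. (source G d, d)) L)"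
    using L unfolding directed_cycle_iff directed_cycle_darts by simp_all
  then show "D \<in> {cycle_darts c | c. directed_cycle G c}"
    by blast
next
  fix D assume "D \<in> {cycle_darts c | c. directed_cycle G c}"
  then show "D \<in> cycle_pot G"
    unfolding directed_cycle_iff directed_cycle_darts cycle_pot_def by blast
qed

lemma simple_cycle_circ:
  assumes "simple_cycle G c"
  shows "\<exists>L. cycle_circ G L \<and> fst ` set L = cycle_edges c"
proof -
  let ?n = "length c"
  have c: "c \<noteq> []" "distinct (map snd c)" "distinct (map fst c)"
    and inc: "\<And>i. i < ?n \<Longrightarrow> snd (c ! i) \<in> arcs G \<and>
        {tail G (snd (c ! i)), head G (snd (c ! i))} = {fst (c ! i), fst (c ! (Suc i mod ?n))}"
    using assms by (auto simp: simple_cycle_def is_cycle_def)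
  \<comment> \<open>The sign that directs the edge from its own vertex to the next one; for a loop
    both signs qualify and one is chosen.\<close>
  have "\<exists>s. source G (snd (c ! i), s) = fst (c ! i) \<and> target G (snd (c ! i), s) = fst (c ! (Suc i mod ?n))"
    if i: "i < ?n" for i
  proof -
    consider "tail G (snd (c ! i)) = fst (c ! i)" "head G (snd (c ! i)) = fst (c ! (Suc i mod ?n))"
      | "head G (snd (c ! i)) = fst (c ! i)" "tail G (snd (c ! i)) = fst (c ! (Suc i mod ?n))"
      using inc[OF i] by (auto simp: doubleton_eq_iff)
    then show ?thesis
    proof cases
      case 1
      then show ?thesis by (intro exI[of _ Pos]) simp
    next
      case 2
      then show ?thesis by (intro exI[of _ Neg]) simp
    qed
  qed
  then obtain s where s: "\<And>i. i < ?n \<Longrightarrow>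
      source G (snd (c ! i), s i) = fst (c ! i) \<and> target G (snd (c ! i), s i) = fst (c ! (Suc i mod ?n))"
    by metis
  define L where "L = map (\<lambda>i. (snd (c ! i), s i)) [0..<?n]"
  have edges: "map fst L = map snd c" and sources: "map (source G) L = map fst c"
    using s by (auto simp: L_def intro!: nth_equalityI)
  have len: "length L = ?n" and nth: "\<And>i. i < ?n \<Longrightarrow> L ! i = (snd (c ! i), s i)"
    by (simp_all add: L_def)
  have mod: "Suc i mod ?n < ?n" for i
    using c(1) by (intro mod_less_divisor) simp
  have "\<exists>u. dwalk G u L u"
    using c(1) s mod by (intro closed_dwalkI) (auto simp: len nth L_def)
  moreover have "fst ` set L = cycle_edges c"
    unfolding cycle_edges_def using edges by (metis list.set_map)
  moreover have "cycle_edges c \<subseteq> arcs G"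
    using inc by (auto simp: cycle_edges_def in_set_conv_nth) (metis snd_conv)
  ultimately have "cycle_circ G L"
    using c edges sources unfolding cycle_circ_def closed_trail_def by auto
  then show ?thesis
    using \<open>fst ` set L = cycle_edges c\<close> by blast
qed

lemma circ_simple_cycle:
  assumes "cycle_circ G L"
  shows "\<exists>c. simple_cycle G c \<and> cycle_edges c = fst ` set L"
proof -
  let ?c = "map (\<lambda>d. (source G d, d)) L"
  have "map snd ?c = L"
    by (simp add: comp_def)
  then have "directed_cycle G ?c"
    using assms unfolding directed_cycle_iff cycle_circ_def by simp
  moreover have "map fst (undirected ?c) = map (source G) L"
    by (simp add: undirected_def split_def)
  moreover have "cycle_edges (undirected ?c) = fst ` set L"
    unfolding directed_cycle_darts \<open>map snd ?c = L\<close> ..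
  ultimately show ?thesis
    using assms unfolding simple_cycle_def directed_cycle_def cycle_circ_def by (intro exI[of _ "undirected ?c"]) simp
qed

theorem cycle_system:
  fixes P :: "('v::infinite, 'e::infinite) property"
  assumes tutte: "tutte_cycle_property P"
  shows "tutte_system P cycle_pot cycle_circ cycle_elem cycle_cm (\<lambda>G e. contract G {e})"
proof (rule tutte_system.intro, goal_cases)
  case 1
  then show ?case
    using tutte by (simp add: tutte_cycle_property_def cycle_property_def)
next
  case (2 G r F)
  have cm: "cycle_minor G c = cycle_cm G (cycle_edges c)" for c
    by (simp add: cycle_minor_def cycle_cm_def)
  have "cycle_property P"
    using tutte by (simp add: tutte_cycle_property_def)
  then have "P G r F \<longleftrightarrow> (\<forall>c. simple_cycle G c \<longrightarrow> good_minor P (cycle_cm G (cycle_edges c)) r F)"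
    using 2 unfolding cycle_property_def by (simp add: cm)
  also have "\<dots> \<longleftrightarrow> (\<forall>L. cycle_circ G L \<longrightarrow> good_minor P (cycle_cm G (fst ` set L)) r F)"
    using simple_cycle_circ[of G] circ_simple_cycle[of G] by metis
  finally show ?case .
next
  case (3 G r F)
  have "cycle_T1 P"
    using tutte by (simp add: tutte_cycle_property_def)
  then obtain c where "potential_cycle G F c"
    using 3 unfolding cycle_T1_def by blast
  then show ?case
    unfolding potential_cycle_def potential_cycles[symmetric] by blast
next
  case (4 G r e F)
  have "cycle_T2 P"
    using tutte by (simp add: tutte_cycle_property_def)
  from this[unfolded cycle_T2_def Let_def, rule_format, OF 4] show ?case .
next
  case (5 G L)
  then show ?case by (rule cycle_circ_edges)
next
  case (6 G L)
  then show ?case by (rule cycle_circ_neg)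
next
  case (7 G r L)
  from 7(2) show ?case by (rule cycle_circ_elem)
next
  case (8 K L)
  then show ?case by (rule cycle_elem_rotate1)
next
  case (9 K L)
  then show ?case by (rule cycle_elem_neg)
next
  case (10 K L)
  then show ?case by (rule cycle_elem_graph)
next
  case (11 K L D)
  then show ?case by (rule cycle_elem_Pot)
next
  case (12 K L K' h)
  from 12(1,2) show ?case by (rule cycle_elem_iso)
next
  case (13 L)
  show ?case by (rule cycle_elem_ex[OF infinite_UNIV 13])
next
  case (14 K L e s)
  from 14(1,2) show ?case by (rule cycle_elem_minor)
next
  case (15 X Y e)
  show ?case by (rule cycle_pair_ex[OF infinite_UNIV 15])
next
  case (16 G L)
  then show ?case
    unfolding cycle_circ_def cycle_pot_def by blast
next
  case (17 G r D d)
  from 17(2,3) show ?case by (rule cycle_pot_circ_sub)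
next
  case (18 G r D)
  then show ?case
    by (auto simp: cycle_pot_def closed_trail_def)
qed

theorem cycle_classification:
  fixes P :: "('v::infinite, 'e::infinite) property"
  assumes tutte: "tutte_cycle_property P"
  shows "(\<exists>X \<delta>. X \<subseteq> {{Neg}, {Pos}, {Neg, Pos}} \<and> same_property P (min_edge_cycle X \<delta>))
            \<or> same_property P cycle_weird \<or> same_property P cycle_coweird"
proof -
  have pot: "(\<forall>D\<in>cycle_pot G. D \<subseteq> F \<longrightarrow> Q D) \<longleftrightarrow> (\<forall>c. potential_cycle G F c \<longrightarrow> Q (cycle_darts c))"
    for G :: "('v, 'e) pre_digraph" and F Q
    unfolding potential_cycles[symmetric] potential_cycle_def by blast
  have edges: "fst ` cycle_darts c = cycle_edges (undirected c)" for c :: "('v \<times> 'e dart) list"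
    unfolding directed_cycle_darts ..
  from tutte_system.classification[OF cycle_system[OF tutte]] show ?thesis
  proof (elim disjE exE conjE)
    fix X \<delta>
    assume X: "X \<subseteq> {{Neg}, {Pos}, {Neg, Pos}}"
      and min: "\<forall>G r F. ordered_graph G r \<longrightarrow> fourientation G F \<longrightarrow>
      (P G r F \<longleftrightarrow> (\<forall>D\<in>cycle_pot G. D \<subseteq> F \<longrightarrow> \<not> min_bad X \<delta> r F D))"
    have "same_property P (min_edge_cycle X \<delta>)"
      using min unfolding pot same_property_def min_edge_cycle_def bad_cycle_def min_bad_def edges .
    then show ?thesis
      using X by blast
  next
    fix \<delta>
    assume "\<forall>G r F. ordered_graph G r \<longrightarrow> fourientation G F \<longrightarrow>
      (P G r F \<longleftrightarrow> (\<forall>D\<in>cycle_pot G. D \<subseteq> F \<longrightarrow> min_oriented r F (fst ` D) \<delta>))"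
    then show ?thesis
      unfolding pot edges same_property_def cycle_weird_def cycle_coweird_def by (cases \<delta>) simp_all
  qed
qed

theorem theorem2p17:
  fixes P :: "('v::infinite, 'e::infinite) property"
  shows "(tutte_cut_property P \<longrightarrow>
            (\<exists>X \<delta>. X \<subseteq> {{}, {Neg}, {Pos}} \<and> same_property P (min_edge_cut X \<delta>))
            \<or> same_property P cut_weird \<or> same_property P cut_coweird)
       \<and> (tutte_cycle_property P \<longrightarrow>
            (\<exists>X \<delta>. X \<subseteq> {{Neg}, {Pos}, {Neg, Pos}} \<and> same_property P (min_edge_cycle X \<delta>))
            \<or> same_property P cycle_weird \<or> same_property P cycle_coweird)"
  using cut_classification[of P] cycle_classification[of P] by blast

end
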